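(* Let $H$ be a Lie algebra over a field $F$ and let $\chi$ be a filtration on $H$. (1) The following are equivalent: (a) $\chi$ is tame; (b) $\chi\sim\gamma\cap H$, where $\gamma$ is the degree filtration on a $2$-generator Lie algebra $G$ in which $H$ is embedded as a subalgebra; (c) $\chi\sim\rho\cap H$, where $\rho$ is the degree filtration on a $2$-generator associative algebra $R$ in which $H$ is embedded as a Lie subalgebra. (2) The following are equivalent: (a) $\chi$ is tame; (b) $\chi=\gamma\cap H$, where $\gamma$ is the degree filtration on a finitely generated Lie algebra $G$ in which $H$ is embedded as a subalgebra; (c) $\chi=\rho\cap H$, where $\rho$ is the degree filtration on a finitely generated associative algebra $R$ in which $H$ is embedded as a Lie subalgebra.
   Context: A filtration on a Lie algebra $H$ is a sequence $\chi=\{H_n\}_{n\ge 0}$ of finite-dimensional subspaces $H_0\subset H_1\subset\cdots$ with $\bigcup_nH_n=H$ and $[H_k,H_l]\subset H_{k+l}$ for all $k,l\ge0$. A filtration is tame if there is $c>0$ with $\dim H_n<c^n$ for all $n\ge 1$. The degree filtration of a Lie algebra $G$ generated by a finite set $X$ has as $n$th term the span of all commutators (arbitrary bracketing) of length at most $n$ in elements of $X$. The degree filtration of a unital associative algebra $R$ generated by a finite set $X$ has as $n$th term the span of all products of at most $n$ elements of $X$ (including the empty product $1$). A Lie subalgebra of an associative algebra $R$ is a subspace closed under $[a,b]=ab-ba$. For $H\subset A$ and a filtration $\alpha=\{A_n\}$ on $A$, $\alpha\cap H=\{A_n\cap H\}$. For filtrations $\chi=\{H_n\}$, $\chi'=\{H'_n\}$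 on $H$, $\chi\sim\chi'$ means that there is an integer $t>0$ with $H_n\subset H'_{tn}$ and $H'_n\subset H_{tn}$ for all $n\ge 0$.
   Formalization: The equivalences are stated for filtrations with H_0 = 0 (otherwise false: the constant filtration on a one-dimensional H is tame, but the degree filtration of a Lie algebra has zeroth term 0); (b)⇒(a) and (c)⇒(a) are proved without this assumption. *)

theory Defs
  imports Complex_Main "HOL-Library.Poly_Mapping"
begin

text \<open>
  An algebra over a field \<open>'f\<close> lives on a linear subspace of a vector space (a type with a
  scalar multiplication). Its bilinear operation matters only on that carrier.
\<close>

locale lie_algebra = vector_space scale
  for scale :: "'f::field \<Rightarrow> 'a::ab_group_add \<Rightarrow> 'a" +
  fixes L :: "'a set" and br :: "'a \<Rightarrow> 'a \<Rightarrow> 'a"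
  assumes subspace_carrier: "subspace L"
    and br_closed: "\<lbrakk>x \<in> L; y \<in> L\<rbrakk> \<Longrightarrow> br x y \<in> L"
    and br_add_left: "\<lbrakk>x \<in> L; y \<in> L; z \<in> L\<rbrakk> \<Longrightarrow> br (x + y) z = br x z + br y z"
    and br_add_right: "\<lbrakk>x \<in> L; y \<in> L; z \<in> L\<rbrakk> \<Longrightarrow> br x (y + z) = br x y + br x z"
    and br_scale_left: "\<lbrakk>x \<in> L; y \<in> L\<rbrakk> \<Longrightarrow> br (scale c x) y = scale c (br x y)"
    and br_scale_right: "\<lbrakk>x \<in> L; y \<in> L\<rbrakk> \<Longrightarrow> br x (scale c y) = scale c (br x y)"
    and br_self: "x \<in> L \<Longrightarrow> br x x = 0"
    and jacobi: "\<lbrakk>x \<in> L; y \<in> L; z \<in> L\<rbrakk> \<Longrightarrow>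
      br x (br y z) + br y (br z x) + br z (br x y) = 0"

locale unital_assoc_algebra = vector_space scale
  for scale :: "'f::field \<Rightarrow> 'a::ab_group_add \<Rightarrow> 'a" +
  fixes R :: "'a set" and mul :: "'a \<Rightarrow> 'a \<Rightarrow> 'a" and one :: 'a
  assumes subspace_carrier: "subspace R"
    and mul_closed: "\<lbrakk>x \<in> R; y \<in> R\<rbrakk> \<Longrightarrow> mul x y \<in> R"
    and one_closed: "one \<in> R"
    and mul_add_left: "\<lbrakk>x \<in> R; y \<in> R; z \<in> R\<rbrakk> \<Longrightarrow> mul (x + y) z = mul x z + mul y z"
    and mul_add_right: "\<lbrakk>x \<in> R; y \<in> R; z \<in> R\<rbrakk> \<Longrightarrow> mul x (y + z) = mul x y + mul x z"
    and mul_scale_left: "\<lbrakk>x \<in> R; y \<in> R\<rbrakk> \<Longrightarrow> mul (scale c x) y = scale c (mul x y)"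
    and mul_scale_right: "\<lbrakk>x \<in> R; y \<in> R\<rbrakk> \<Longrightarrow> mul x (scale c y) = scale c (mul x y)"
    and mul_assoc: "\<lbrakk>x \<in> R; y \<in> R; z \<in> R\<rbrakk> \<Longrightarrow> mul (mul x y) z = mul x (mul y z)"
    and mul_one_left: "x \<in> R \<Longrightarrow> mul one x = x"
    and mul_one_right: "x \<in> R \<Longrightarrow> mul x one = x"

definition lie_filtration ::
  "('f::field \<Rightarrow> 'a::ab_group_add \<Rightarrow> 'a) \<Rightarrow> 'a set \<Rightarrow> ('a \<Rightarrow> 'a \<Rightarrow> 'a) \<Rightarrow> (nat \<Rightarrow> 'a set) \<Rightarrow> bool"
  where "lie_filtration scale L br \<chi> \<longleftrightarrow>
    (\<forall>n. \<exists>B. finite B \<and> module.span scale B = \<chi> n) \<and>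
    (\<forall>n. \<chi> n \<subseteq> \<chi> (Suc n)) \<and>
    (\<Union>n. \<chi> n) = L \<and>
    (\<forall>k l. \<forall>x\<in>\<chi> k. \<forall>y\<in>\<chi> l. br x y \<in> \<chi> (k + l))"

definition tame :: "('f::field \<Rightarrow> 'a::ab_group_add \<Rightarrow> 'a) \<Rightarrow> (nat \<Rightarrow> 'a set) \<Rightarrow> bool"
  where "tame scale \<chi> \<longleftrightarrow>
    (\<exists>c::real. c > 0 \<and> (\<forall>n\<ge>1. real (vector_space.dim scale (\<chi> n)) < c ^ n))"

definition filtration_equiv :: "(nat \<Rightarrow> 'a set) \<Rightarrow> (nat \<Rightarrow> 'a set) \<Rightarrow> bool"
  where "filtration_equiv \<chi> \<chi>' \<longleftrightarrow>
    (\<exists>t::nat. t > 0 \<and> (\<forall>n. \<chi> n \<subseteq> \<chi>' (t * n) \<and> \<chi>' n \<subseteq> \<chi> (t * n)))"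

definition lie_subalgebra ::
  "('f::field \<Rightarrow> 'a::ab_group_add \<Rightarrow> 'a) \<Rightarrow> ('a \<Rightarrow> 'a \<Rightarrow> 'a) \<Rightarrow> 'a set \<Rightarrow> bool"
  where "lie_subalgebra scale br S \<longleftrightarrow>
    module.subspace scale S \<and> (\<forall>x\<in>S. \<forall>y\<in>S. br x y \<in> S)"

definition unital_subalgebra ::
  "('f::field \<Rightarrow> 'a::ab_group_add \<Rightarrow> 'a) \<Rightarrow> ('a \<Rightarrow> 'a \<Rightarrow> 'a) \<Rightarrow> 'a \<Rightarrow> 'a set \<Rightarrow> bool"
  where "unital_subalgebra scale mul one S \<longleftrightarrow>
    module.subspace scale S \<and> one \<in> S \<and> (\<forall>x\<in>S. \<forall>y\<in>S. mul x y \<in> S)"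

definition lie_generated_by ::
  "('f::field \<Rightarrow> 'a::ab_group_add \<Rightarrow> 'a) \<Rightarrow> 'a set \<Rightarrow> ('a \<Rightarrow> 'a \<Rightarrow> 'a) \<Rightarrow> 'a set \<Rightarrow> bool"
  where "lie_generated_by scale L br X \<longleftrightarrow>
    X \<subseteq> L \<and> (\<lambda>S. S \<subseteq> L \<and> lie_subalgebra scale br S) hull X = L"

definition assoc_generated_by ::
  "('f::field \<Rightarrow> 'a::ab_group_add \<Rightarrow> 'a) \<Rightarrow> 'a set \<Rightarrow> ('a \<Rightarrow> 'a \<Rightarrow> 'a) \<Rightarrow> 'a \<Rightarrow> 'a set \<Rightarrow> bool"
  where "assoc_generated_by scale R mul one X \<longleftrightarrow>
    X \<subseteq> R \<and> (\<lambda>S. S \<subseteq> R \<and> unital_subalgebra scale mul one S) hull X = R"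

text \<open>\<open>lie_commutator br X n u\<close>: \<open>u\<close> is a commutator of length \<open>n\<close> in elements of \<open>X\<close>.\<close>

inductive lie_commutator :: "('a \<Rightarrow> 'a \<Rightarrow> 'a) \<Rightarrow> 'a set \<Rightarrow> nat \<Rightarrow> 'a \<Rightarrow> bool"
  for br :: "'a \<Rightarrow> 'a \<Rightarrow> 'a" and X :: "'a set"
  where
    generator: "x \<in> X \<Longrightarrow> lie_commutator br X 1 x"
  | bracket: "\<lbrakk>lie_commutator br X m u; lie_commutator br X n v\<rbrakk>
      \<Longrightarrow> lie_commutator br X (m + n) (br u v)"

definition lie_degree_filtration ::
  "('f::field \<Rightarrow> 'a::ab_group_add \<Rightarrow> 'a) \<Rightarrow> ('a \<Rightarrow> 'a \<Rightarrow> 'a) \<Rightarrow> 'a set \<Rightarrow> nat \<Rightarrow> 'a set"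
  where "lie_degree_filtration scale br X n =
    module.span scale {u. \<exists>m\<le>n. lie_commutator br X m u}"

definition assoc_degree_filtration ::
  "('f::field \<Rightarrow> 'a::ab_group_add \<Rightarrow> 'a) \<Rightarrow> ('a \<Rightarrow> 'a \<Rightarrow> 'a) \<Rightarrow> 'a \<Rightarrow> 'a set \<Rightarrow> nat \<Rightarrow> 'a set"
  where "assoc_degree_filtration scale mul one X n =
    module.span scale {foldr mul xs one | xs. set xs \<subseteq> X \<and> length xs \<le> n}"

text \<open>An embedding of \<open>(H, br)\<close> onto a subspace of \<open>G\<close> closed under \<open>br'\<close>.\<close>

definition lie_embedding ::
  "('f::field \<Rightarrow> 'h::ab_group_add \<Rightarrow> 'h) \<Rightarrow> 'h set \<Rightarrow> ('h \<Rightarrow> 'h \<Rightarrow> 'h) \<Rightarrow>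
   ('f \<Rightarrow> 'g::ab_group_add \<Rightarrow> 'g) \<Rightarrow> 'g set \<Rightarrow> ('g \<Rightarrow> 'g \<Rightarrow> 'g) \<Rightarrow> ('h \<Rightarrow> 'g) \<Rightarrow> bool"
  where "lie_embedding scale H br scale' G br' \<iota> \<longleftrightarrow>
    \<iota> ` H \<subseteq> G \<and> inj_on \<iota> H \<and>
    (\<forall>x\<in>H. \<forall>y\<in>H. \<iota> (x + y) = \<iota> x + \<iota> y) \<and>
    (\<forall>c. \<forall>x\<in>H. \<iota> (scale c x) = scale' c (\<iota> x)) \<and>
    (\<forall>x\<in>H. \<forall>y\<in>H. \<iota> (br x y) = br' (\<iota> x) (\<iota> y))"

definition assoc_commutator :: "('a::ab_group_add \<Rightarrow> 'a \<Rightarrow> 'a) \<Rightarrow> 'a \<Rightarrow> 'a \<Rightarrow> 'a"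
  where "assoc_commutator mul a b = mul a b - mul b a"

text \<open>The restriction to \<open>H\<close> of a filtration \<open>\<alpha>\<close>, for \<open>H\<close> embedded through \<open>\<iota>\<close>.\<close>

definition restrict_filtration :: "'h set \<Rightarrow> ('h \<Rightarrow> 'g) \<Rightarrow> (nat \<Rightarrow> 'g set) \<Rightarrow> nat \<Rightarrow> 'h set"
  where "restrict_filtration H \<iota> \<alpha> n = {x \<in> H. \<iota> x \<in> \<alpha> n}"

text \<open>
  The type argument of the next four predicates names the type on which the ambient algebra
  lives, since HOL cannot quantify over it existentially. A finitely generated algebra over
  \<open>'f\<close> has countable dimension, hence is isomorphic to one carried by a subspace of
  \<open>nat \<Rightarrow>\<^sub>0 'f\<close>, so on that type the predicates express existence without loss of generality.
\<close>

definition equiv_two_generator_lie ::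
  "'g::ab_group_add itself \<Rightarrow> ('f::field \<Rightarrow> 'h::ab_group_add \<Rightarrow> 'h) \<Rightarrow> 'h set \<Rightarrow>
   ('h \<Rightarrow> 'h \<Rightarrow> 'h) \<Rightarrow> (nat \<Rightarrow> 'h set) \<Rightarrow> bool"
  where "equiv_two_generator_lie T scale H br \<chi> \<longleftrightarrow>
    (\<exists>(scale' :: 'f \<Rightarrow> 'g \<Rightarrow> 'g) G br' x y \<iota>.
      lie_algebra scale' G br' \<and> lie_generated_by scale' G br' {x, y} \<and>
      lie_embedding scale H br scale' G br' \<iota> \<and>
      filtration_equiv \<chi> (restrict_filtration H \<iota> (lie_degree_filtration scale' br' {x, y})))"

definition equiv_two_generator_assoc ::
  "'r::ab_group_add itself \<Rightarrow> ('f::field \<Rightarrow> 'h::ab_group_add \<Rightarrow> 'h) \<Rightarrow> 'h set \<Rightarrow>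
   ('h \<Rightarrow> 'h \<Rightarrow> 'h) \<Rightarrow> (nat \<Rightarrow> 'h set) \<Rightarrow> bool"
  where "equiv_two_generator_assoc T scale H br \<chi> \<longleftrightarrow>
    (\<exists>(scale' :: 'f \<Rightarrow> 'r \<Rightarrow> 'r) R mul one x y \<iota>.
      unital_assoc_algebra scale' R mul one \<and> assoc_generated_by scale' R mul one {x, y} \<and>
      lie_embedding scale H br scale' R (assoc_commutator mul) \<iota> \<and>
      filtration_equiv \<chi>
        (restrict_filtration H \<iota> (assoc_degree_filtration scale' mul one {x, y})))"

definition eq_fin_gen_lie ::
  "'g::ab_group_add itself \<Rightarrow> ('f::field \<Rightarrow> 'h::ab_group_add \<Rightarrow> 'h) \<Rightarrow> 'h set \<Rightarrow>
   ('h \<Rightarrow> 'h \<Rightarrow> 'h) \<Rightarrow> (nat \<Rightarrow> 'h set) \<Rightarrow> bool"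
  where "eq_fin_gen_lie T scale H br \<chi> \<longleftrightarrow>
    (\<exists>(scale' :: 'f \<Rightarrow> 'g \<Rightarrow> 'g) G br' X \<iota>.
      lie_algebra scale' G br' \<and> finite X \<and> lie_generated_by scale' G br' X \<and>
      lie_embedding scale H br scale' G br' \<iota> \<and>
      \<chi> = restrict_filtration H \<iota> (lie_degree_filtration scale' br' X))"

definition eq_fin_gen_assoc ::
  "'r::ab_group_add itself \<Rightarrow> ('f::field \<Rightarrow> 'h::ab_group_add \<Rightarrow> 'h) \<Rightarrow> 'h set \<Rightarrow>
   ('h \<Rightarrow> 'h \<Rightarrow> 'h) \<Rightarrow> (nat \<Rightarrow> 'h set) \<Rightarrow> bool"
  where "eq_fin_gen_assoc T scale H br \<chi> \<longleftrightarrow>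
    (\<exists>(scale' :: 'f \<Rightarrow> 'r \<Rightarrow> 'r) R mul one X \<iota>.
      unital_assoc_algebra scale' R mul one \<and> finite X \<and> assoc_generated_by scale' R mul one X \<and>
      lie_embedding scale H br scale' R (assoc_commutator mul) \<iota> \<and>
      \<chi> = restrict_filtration H \<iota> (assoc_degree_filtration scale' mul one X))"

text \<open>
  There are no commutators of length 0, so a degree filtration of a Lie algebra starts with
  the zero space. Comparing filtrations at \<open>n = 0\<close> then forces \<open>\<chi> 0 = {0}\<close>, whereas tameness
  puts no condition on \<open>\<chi> 0\<close>: without that hypothesis a tame filtration need not be induced
  from a degree filtration (take \<open>H\<close> of dimension 1 and \<open>\<chi>\<close> constant).
\<close>

lemma lie_commutator_pos: "lie_commutator br X n u \<Longrightarrow> 0 < n"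
  by (induction rule: lie_commutator.induct) auto

lemma lie_degree_filtration_0:
  assumes "vector_space scale"
  shows "lie_degree_filtration scale br X 0 = {0}"
proof -
  interpret vector_space scale by fact
  have "{u. \<exists>m\<le>0. lie_commutator br X m u} = {}"
    using lie_commutator_pos by fastforce
  then show ?thesis
    by (simp add: lie_degree_filtration_def)
qed

lemma equiv_two_generator_lie_term_0:
  assumes "lie_algebra scale H br" "lie_filtration scale H br \<chi>"
    and "equiv_two_generator_lie T scale H br \<chi>"
  shows "\<chi> 0 = {0}"
proof -
  interpret H: lie_algebra scale H br by fact
  obtain B where B: "module.span scale B = \<chi> 0"
    using assms(2) unfolding lie_filtration_def by blast
  then have z: "0 \<in> \<chi> 0"
    using H.span_zero by metis
  have sub: "\<chi> 0 \<subseteq> H"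
    using assms(2) unfolding lie_filtration_def by blast
  obtain scale' :: "'a \<Rightarrow> 'c \<Rightarrow> 'c" and G br' x y \<iota> where
    G: "lie_algebra scale' G br'" and e: "lie_embedding scale H br scale' G br' \<iota>"
    and q: "filtration_equiv \<chi> (restrict_filtration H \<iota> (lie_degree_filtration scale' br' {x, y}))"
    using assms(3) unfolding equiv_two_generator_lie_def by blast
  have "lie_degree_filtration scale' br' {x, y} 0 = {0}"
    using G lie_degree_filtration_0 unfolding lie_algebra_def by blast
  moreover have "\<chi> 0 \<subseteq> restrict_filtration H \<iota> (lie_degree_filtration scale' br' {x, y}) 0"
    using q unfolding filtration_equiv_def by (metis mult_0_right)
  ultimately have "\<iota> u = 0" if "u \<in> \<chi> 0" for u
    using that unfolding restrict_filtration_def by auto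
  then have "u = 0" if "u \<in> \<chi> 0" for u
    using that z sub e unfolding lie_embedding_def inj_on_def by (metis subsetD)
  then show ?thesis
    using z by blast
qed

end

theory Submission
  imports Defs "HOL-Library.Function_Algebras" "HOL-Library.Product_Plus" "HOL-Library.Countable_Set"
begin

text \<open>
  Tameness is necessary because a degree filtration on finitely many generators grows at most
  exponentially: the products of at most \<open>n\<close> generators are words, and the commutators of length
  at most \<open>n\<close> can be written in postfix notation as words of length below \<open>2 n\<close>. An embedding
  preserves dimensions, so a filtration lying below a restricted degree filtration is tame.
  
  Conversely, a tame filtration has a basis \<open>B\<close> adapted to it, and the exponential bound leaves
  room to name the basis elements of weight \<open>n\<close> by distinct words of length \<open>n\<close> over a finite
  alphabet. Marking the first and the last letter of each word makes the code synchronizing: a code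
  word is recognised inside a product of code words whatever surrounds it. Two constructions
  turn such a code into an embedding for which the degree filtration restricts to \<open>\<chi>\<close>.
  
  For Lie algebras, consider the maps from words to \<open>H\<close> with the bracket that distributes the
  letters of a word over the two factors (the completed tensor product of \<open>H\<close> with the shuffle
  algebra), extended by derivations, among them the shifts \<open>f \<mapsto> (\<lambda>v. f (l # v))\<close> for letters \<open>l\<close>.
  An element \<open>h\<close> is identified with the map that is \<open>h\<close> at the empty word and zero elsewhere.
  For each letter \<open>l\<close> a single map
  sends \<open>v\<close> to \<open>b\<close> whenever \<open>l # v\<close> is the code word of \<open>b\<close>; shifting it by the remaining letters
  of that code word gives exactly \<open>b\<close>. So \<open>b\<close> is a commutator of length equal to its weight in
  the shifts and these maps. Giving each letter weight one defines a filtration that bounds the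
  degree filtration from above and induces \<open>\<chi>\<close> on \<open>H\<close>, which proves equality. The same semidirect
  product, now with a one-letter alphabet and applied twice, embeds any finitely generated Lie
  algebra into a two-generator one with an equivalent degree filtration.
  
  For associative algebras, the Poincare-Birkhoff-Witt straightening gives a map \<open>pbw\<close> from words
  in \<open>B\<close> to \<open>H\<close> that respects the commutation relations of \<open>H\<close>, fixes each single basis
  element and does not raise the weight. Composing it with decoding (and sending words that are not
  products of code words to zero) gives an \<open>H\<close>-valued function on words in the alphabet. It lies
  in a space of functions on which right translations by letters generate an associative algebra,
  and there the translations by code words satisfy the relations of \<open>H\<close>. Evaluating an operator at
  this function and at the empty word recovers \<open>H\<close> and controls degrees. Recoding the alphabet in
  two letters gives two generators at the cost of a bounded factor in the length.
  
  The algebras so constructed are spanned by countably many elements, so they can be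
  transported to the space of finitely supported sequences.
\<close>

section \<open>Degree filtrations\<close>

text \<open>
  Brackets and products are bilinear on the carrier only; for such operations, closure of a
  subspace under them is reduced to spanning sets.
\<close>

lemma (in vector_space) bilinear_span_closed:
  assumes "S \<subseteq> L" "T \<subseteq> L" "subspace L" "subspace U"
    and addl: "\<And>x y z. \<lbrakk>x \<in> L; y \<in> L; z \<in> L\<rbrakk> \<Longrightarrow> b (x + y) z = b x z + b y z"
    and addr: "\<And>x y z. \<lbrakk>x \<in> L; y \<in> L; z \<in> L\<rbrakk> \<Longrightarrow> b x (y + z) = b x y + b x z"
    and scl: "\<And>c x y. \<lbrakk>x \<in> L; y \<in> L\<rbrakk> \<Longrightarrow> b (scale c x) y = scale c (b x y)"
    and scr: "\<And>c x y. \<lbrakk>x \<in> L; y \<in> L\<rbrakk> \<Longrightarrow> b x (scale c y) = scale c (b x y)"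
    and base: "\<And>s t. \<lbrakk>s \<in> S; t \<in> T\<rbrakk> \<Longrightarrow> b s t \<in> U"
    and "x \<in> span S" "y \<in> span T"
  shows "b x y \<in> U"
proof -
  have SL: "span S \<subseteq> L" and TL: "span T \<subseteq> L"
    using assms(1-3) by (simp_all add: span_minimal)
  have zl: "b 0 t = 0" if "t \<in> L" for t
    using scl[of 0 t 0] that subspace_0[OF assms(3)] by simp
  have zr: "b t 0 = 0" if "t \<in> L" for t
    using scr[of t 0 0] that subspace_0[OF assms(3)] by simp
  have left: "x \<in> L \<and> b x t \<in> U" if t: "t \<in> T" for t
    using \<open>x \<in> span S\<close>
  proof (induction rule: span_induct_alt)
    case base
    show ?case using zl t assms(2) subspace_0[OF assms(3)] subspace_0[OF assms(4)] by auto
  next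
    case (step c s y)
    have "s \<in> L" "t \<in> L" "scale c s \<in> L"
      using step t assms(1,2,3) subspace_scale by auto
    then show ?case
      using step t base assms(3,4) by (simp add: addl scl subspace_add subspace_scale)
  qed
  have "x \<in> L"
    using SL \<open>x \<in> span S\<close> by auto
  have "y \<in> L \<and> b x y \<in> U"
    using \<open>y \<in> span T\<close>
  proof (induction rule: span_induct_alt)
    case base
    show ?case using zr \<open>x \<in> L\<close> subspace_0[OF assms(3)] subspace_0[OF assms(4)] by auto
  next
    case (step c t y)
    have "t \<in> L" "scale c t \<in> L"
      using step TL assms(1,2,3) subspace_scale by auto
    then show ?case
      using step left assms(3,4) \<open>x \<in> L\<close> by (simp add: addr scr subspace_add subspace_scale)
  qed
  then show ?thesis by simp
qed

context lie_algebra begin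

lemma commutator_in_carrier:
  assumes "X \<subseteq> L" "lie_commutator br X m u"
  shows "u \<in> L"
  using assms(2,1) by (induction) (auto intro: br_closed)

lemma degree_filtration_subspace: "subspace (lie_degree_filtration scale br X n)"
  by (simp add: lie_degree_filtration_def)

lemma degree_filtration_mono:
  "m \<le> n \<Longrightarrow> lie_degree_filtration scale br X m \<subseteq> lie_degree_filtration scale br X n"
  unfolding lie_degree_filtration_def by (rule span_mono) (auto intro: order_trans)

lemma commutator_in_degree_filtration:
  "lie_commutator br X m u \<Longrightarrow> u \<in> lie_degree_filtration scale br X m"
  unfolding lie_degree_filtration_def by (rule span_base) auto

lemma degree_filtration_in_carrier:
  assumes "X \<subseteq> L"
  shows "lie_degree_filtration scale br X n \<subseteq> L"
  unfolding lie_degree_filtration_def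
  by (rule span_minimal) (use assms commutator_in_carrier subspace_carrier in auto)

lemma degree_filtration_br:
  assumes X: "X \<subseteq> L" and x: "x \<in> lie_degree_filtration scale br X k"
    and y: "y \<in> lie_degree_filtration scale br X l"
  shows "br x y \<in> lie_degree_filtration scale br X (k + l)"
proof (rule bilinear_span_closed[where b = br and L = L])
  show "x \<in> span {u. \<exists>m\<le>k. lie_commutator br X m u}" "y \<in> span {u. \<exists>m\<le>l. lie_commutator br X m u}"
    using x y by (simp_all add: lie_degree_filtration_def)
  show "br s t \<in> lie_degree_filtration scale br X (k + l)"
    if "s \<in> {u. \<exists>m\<le>k. lie_commutator br X m u}" "t \<in> {u. \<exists>m\<le>l. lie_commutator br X m u}" for s t
  proof -
    from that obtain m n
      where mn: "m \<le> k" "n \<le> l" "lie_commutator br X m s" "lie_commutator br X n t"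
      unfolding mem_Collect_eq by (elim exE conjE)
    have "br s t \<in> lie_degree_filtration scale br X (m + n)"
      by (rule commutator_in_degree_filtration[OF lie_commutator.bracket[OF mn(3,4)]])
    then show ?thesis
      using degree_filtration_mono[OF add_mono[OF mn(1,2)], of X] by (rule subsetD[rotated])
  qed
qed (auto simp: commutator_in_carrier[OF X] subspace_carrier degree_filtration_subspace br_add_left
    br_add_right br_scale_left br_scale_right)

text \<open>
  Upper bounds for a degree filtration are proved by exhibiting any multiplicative filtration
  whose term of index \<open>1\<close> contains the generators.
\<close>

lemma degree_filtration_least:
  assumes "\<And>n. subspace (P n)" "\<And>n. P n \<subseteq> P (Suc n)"
    and "\<And>k l x y. \<lbrakk>x \<in> P k; y \<in> P l\<rbrakk> \<Longrightarrow> br x y \<in> P (k + l)" and "X \<subseteq> P 1"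
  shows "lie_degree_filtration scale br X n \<subseteq> P n"
proof -
  have *: "u \<in> P m" if "lie_commutator br X m u" for m u
    using that by induction (use assms in auto)
  have "P m \<subseteq> P n" if "m \<le> n" for m n
    using lift_Suc_mono_le[of P, OF assms(2) that] .
  then show ?thesis
    unfolding lie_degree_filtration_def
    by (intro span_minimal) (use * assms(1) in blast)+
qed

lemma span_commutators_br_closed:
  assumes "X \<subseteq> L" "x \<in> span {u. \<exists>m. lie_commutator br X m u}"
    "y \<in> span {u. \<exists>m. lie_commutator br X m u}"
  shows "br x y \<in> span {u. \<exists>m. lie_commutator br X m u}"
  by (rule bilinear_span_closed[where b = br and L = L, OF _ _ _ _ _ _ _ _ _ assms(2,3)])
    (use commutator_in_carrier[OF assms(1)] subspace_carrier br_add_left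
      br_add_right br_scale_left br_scale_right lie_commutator.bracket in
      \<open>auto intro!: span_base intro: lie_commutator.bracket\<close>)

lemma span_commutators_in_carrier:
  "X \<subseteq> L \<Longrightarrow> span {u. \<exists>m. lie_commutator br X m u} \<subseteq> L"
  by (rule span_minimal) (use commutator_in_carrier subspace_carrier in auto)

lemma lie_hull_eq_span_commutators:
  assumes X: "X \<subseteq> L"
  shows "(\<lambda>S. S \<subseteq> L \<and> lie_subalgebra scale br S) hull X = span {u. \<exists>m. lie_commutator br X m u}"
proof (rule hull_unique)
  show "X \<subseteq> span {u. \<exists>m. lie_commutator br X m u}"
    by (auto intro!: span_base intro: lie_commutator.generator)
  show "span {u. \<exists>m. lie_commutator br X m u} \<subseteq> L \<and>
      lie_subalgebra scale br (span {u. \<exists>m. lie_commutator br X m u})"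
    unfolding lie_subalgebra_def
    using span_commutators_in_carrier[OF X] span_commutators_br_closed[OF X] by blast
  show "span {u. \<exists>m. lie_commutator br X m u} \<subseteq> S"
    if "X \<subseteq> S" "S \<subseteq> L \<and> lie_subalgebra scale br S" for S
  proof (rule span_minimal)
    have "u \<in> S" if "lie_commutator br X m u" for m u
      using that by induction (use that \<open>X \<subseteq> S\<close> \<open>S \<subseteq> L \<and> lie_subalgebra scale br S\<close> in
          \<open>auto simp: lie_subalgebra_def\<close>)
    then show "{u. \<exists>m. lie_commutator br X m u} \<subseteq> S" by auto
  qed (use that in \<open>auto simp: lie_subalgebra_def\<close>)
qed

lemma lie_generated_by_iff:
  "lie_generated_by scale L br X \<longleftrightarrow> X \<subseteq> L \<and> L = span {u. \<exists>m. lie_commutator br X m u}"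
  unfolding lie_generated_by_def using lie_hull_eq_span_commutators by auto

lemma generated_lie_algebra:
  assumes X: "X \<subseteq> L"
  defines "G \<equiv> span {u. \<exists>m. lie_commutator br X m u}"
  shows "lie_algebra scale G br" "lie_generated_by scale G br X"
proof -
  have sub: "x \<in> L" if "x \<in> G" for x
    using span_commutators_in_carrier[OF X] that by (auto simp: G_def)
  have cl: "br x y \<in> G" if "x \<in> G" "y \<in> G" for x y
    using span_commutators_br_closed[OF X] that by (auto simp: G_def)
  show 1: "lie_algebra scale G br"
    by unfold_locales (auto simp: sub cl br_add_left br_add_right br_scale_left br_scale_right
        br_self jacobi, auto simp: G_def)
  have "X \<subseteq> G"
    by (auto simp: G_def intro!: span_base intro: lie_commutator.generator)
  then show "lie_generated_by scale G br X"
    by (subst lie_algebra.lie_generated_by_iff[OF 1]) (simp add: G_def)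
qed

lemma br_zero: "x \<in> L \<Longrightarrow> br 0 x = 0" "x \<in> L \<Longrightarrow> br x 0 = 0"
  using br_scale_left[of x x 0] br_scale_right[of x x 0] by auto

lemma br_anticomm:
  assumes "x \<in> L" "y \<in> L"
  shows "br y x = - br x y"
proof -
  have xy: "x + y \<in> L"
    using assms subspace_carrier by (simp add: subspace_add)
  have "0 = br (x + y) (x + y)"
    using xy by (simp add: br_self)
  also have "\<dots> = br x (x + y) + br y (x + y)"
    using assms xy by (simp add: br_add_left)
  also have "\<dots> = br x y + br y x"
    using assms by (simp add: br_add_right br_self)
  finally have "br x y + br y x = 0" by simp
  then show ?thesis
    by (simp add: eq_neg_iff_add_eq_0 add.commute)
qed

end

lemma foldr_closed:
  "\<lbrakk>\<And>x y. \<lbrakk>x \<in> S; y \<in> S\<rbrakk> \<Longrightarrow> f x y \<in> S; e \<in> S; set xs \<subseteq> S\<rbrakk> \<Longrightarrow> foldr f xs e \<in> S"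
  by (induction xs) auto

context unital_assoc_algebra begin

lemma product_in_carrier: "set xs \<subseteq> R \<Longrightarrow> foldr mul xs one \<in> R"
  by (rule foldr_closed) (auto simp: mul_closed one_closed)

lemma product_append:
  "\<lbrakk>set xs \<subseteq> R; set ys \<subseteq> R\<rbrakk> \<Longrightarrow>
    foldr mul (xs @ ys) one = mul (foldr mul xs one) (foldr mul ys one)"
  by (induction xs)
    (auto simp: mul_one_left product_in_carrier mul_assoc simp del: foldr_append)

lemma products_in_carrier:
  "X \<subseteq> R \<Longrightarrow> {foldr mul xs one | xs. set xs \<subseteq> X} \<subseteq> R"
  using product_in_carrier by blast

lemma span_products_closed:
  assumes X: "X \<subseteq> R"
  defines "S \<equiv> span {foldr mul xs one | xs. set xs \<subseteq> X}"
  shows "X \<subseteq> S" "S \<subseteq> R" "unital_subalgebra scale mul one S"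
proof -
  let ?W = "{foldr mul xs one | xs. set xs \<subseteq> X}"
  have WR: "?W \<subseteq> R"
    by (rule products_in_carrier[OF X])
  show "X \<subseteq> S"
  proof
    fix x assume "x \<in> X"
    then have "foldr mul [x] one = x" "set [x] \<subseteq> X"
      using X mul_one_right by auto
    then have "x \<in> ?W" by (metis (mono_tags, lifting) mem_Collect_eq)
    then show "x \<in> S" unfolding S_def by (rule span_base)
  qed
  show "S \<subseteq> R"
    unfolding S_def by (rule span_minimal[OF WR subspace_carrier])
  have one: "one \<in> S"
    unfolding S_def by (rule span_base) (auto intro!: exI[of _ "[]"])
  have "mul x y \<in> span ?W" if "x \<in> span ?W" "y \<in> span ?W" for x y
  proof (rule bilinear_span_closed[where b = mul and L = R, OF WR WR _ _ _ _ _ _ _ that])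
    show "mul s t \<in> span ?W" if st: "s \<in> ?W" "t \<in> ?W" for s t
    proof -
      obtain xs ys where "s = foldr mul xs one" "t = foldr mul ys one" "set xs \<subseteq> X" "set ys \<subseteq> X"
        using st by auto
      then have "mul s t = foldr mul (xs @ ys) one" "set (xs @ ys) \<subseteq> X"
        using product_append[of xs ys] X by auto
      then have "mul s t \<in> ?W" by blast
      then show ?thesis by (rule span_base)
    qed
  qed (auto simp: subspace_carrier mul_add_left mul_add_right mul_scale_left mul_scale_right)
  then show "unital_subalgebra scale mul one S"
    unfolding unital_subalgebra_def using one by (simp add: S_def)
qed

lemma assoc_generated_by_iff:
  "assoc_generated_by scale R mul one X \<longleftrightarrow>
    X \<subseteq> R \<and> R = span {foldr mul xs one | xs. set xs \<subseteq> X}"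
proof -
  let ?W = "{foldr mul xs one | xs. set xs \<subseteq> X}"
  have "(\<lambda>S. S \<subseteq> R \<and> unital_subalgebra scale mul one S) hull X = span ?W" if X: "X \<subseteq> R"
  proof (rule hull_unique)
    show "span ?W \<subseteq> S" if S: "X \<subseteq> S" "S \<subseteq> R \<and> unital_subalgebra scale mul one S" for S
    proof (rule span_minimal)
      show "?W \<subseteq> S"
        using S by (auto simp: unital_subalgebra_def intro!: foldr_closed)
    qed (use S in \<open>auto simp: unital_subalgebra_def\<close>)
  qed (use span_products_closed[OF X] in auto)
  then show ?thesis
    unfolding assoc_generated_by_def by auto
qed

lemma generated_assoc_algebra:
  assumes X: "X \<subseteq> R"
  defines "S \<equiv> span {foldr mul xs one | xs. set xs \<subseteq> X}"
  shows "unital_assoc_algebra scale S mul one" "assoc_generated_by scale S mul one X"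
proof -
  note c = span_products_closed[OF X, folded S_def]
  have sub: "x \<in> R" if "x \<in> S" for x
    using c(2) that by blast
  show 1: "unital_assoc_algebra scale S mul one"
    using c(3) unfolding unital_subalgebra_def
    by unfold_locales (auto simp: sub mul_add_left mul_add_right mul_scale_left mul_scale_right
        mul_assoc mul_one_left mul_one_right)
  show "assoc_generated_by scale S mul one X"
    using c(1) by (subst unital_assoc_algebra.assoc_generated_by_iff[OF 1]) (simp add: S_def)
qed

end

section \<open>Tameness of restrictions of degree filtrations\<close>

lemma sum_powers_le: "(\<Sum>i\<le>n. a ^ i) \<le> (a + 1) ^ n" for a :: nat
proof (induction n)
  case (Suc n)
  have "a ^ n \<le> (a + 1) ^ n"
    by (rule power_mono) auto
  then have "a ^ Suc n \<le> a * (a + 1) ^ n"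
    unfolding power_Suc by (rule mult_le_mono2)
  then have "(\<Sum>i\<le>Suc n. a ^ i) \<le> (a + 1) ^ n + a * (a + 1) ^ n"
    unfolding sum.atMost_Suc using Suc by (rule add_mono[rotated])
  then show ?case
    by simp
qed simp

text \<open>
  Allowing shorter words costs one additional letter in the base of the exponential bound.
\<close>

lemma card_short_lists:
  assumes "finite A"
  shows "finite {xs. set xs \<subseteq> A \<and> length xs \<le> n}"
    "card {xs. set xs \<subseteq> A \<and> length xs \<le> n} \<le> (card A + 1) ^ n"
  using assms sum_powers_le[of "card A" n]
  by (simp_all add: finite_lists_length_le card_lists_length_le)

fun run_postfix :: "('a \<Rightarrow> 'a \<Rightarrow> 'a) \<Rightarrow> 'a option list \<Rightarrow> 'a list \<Rightarrow> 'a list" where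
  "run_postfix b [] st = st"
| "run_postfix b (Some x # p) st = run_postfix b p (x # st)"
| "run_postfix b (None # p) (v # u # st) = run_postfix b p (b u v # st)"
| "run_postfix b (None # p) st = st"

text \<open>
  A bracketing is determined by its postfix form, in which \<open>None\<close> stands for the bracket. A
  commutator of length \<open>m\<close> has \<open>m\<close> generators and \<open>m - 1\<close> brackets, so its postfix form is shorter
  than \<open>2 m\<close>; this replaces the count of bracketings by Catalan numbers.
\<close>

lemma commutator_postfix:
  assumes "lie_commutator b X m u"
  shows "\<exists>p. set p \<subseteq> insert None (Some ` X) \<and> length p < 2 * m \<and>
    (\<forall>q st. run_postfix b (p @ q) st = run_postfix b q (u # st))"
  using assms
proof induction
  case (generator x)
  then show ?case by (intro exI[of _ "[Some x]"]) auto
next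
  case (bracket m u n v)
  then obtain p q where
    "set p \<subseteq> insert None (Some ` X)" "length p < 2 * m"
    "\<And>r st. run_postfix b (p @ r) st = run_postfix b r (u # st)"
    "set q \<subseteq> insert None (Some ` X)" "length q < 2 * n"
    "\<And>r st. run_postfix b (q @ r) st = run_postfix b r (v # st)"
    by metis
  then show ?case by (intro exI[of _ "p @ q @ [None]"]) auto
qed

lemma finitely_many_commutators:
  assumes "finite X"
  shows "finite {u. \<exists>m\<le>n. lie_commutator b X m u}"
    "card {u. \<exists>m\<le>n. lie_commutator b X m u} \<le> ((card X + 2) ^ 2) ^ n"
proof -
  let ?A = "insert None (Some ` X)"
  let ?P = "{p. set p \<subseteq> ?A \<and> length p \<le> 2 * n}"
  have "card ?A = card X + 1"
    using assms by (simp add: card_image)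
  then have P: "finite ?P" "card ?P \<le> (card X + 2) ^ (2 * n)"
    using card_short_lists[of ?A "2 * n"] assms by auto
  have *: "{u. \<exists>m\<le>n. lie_commutator b X m u} \<subseteq> (\<lambda>p. hd (run_postfix b p [])) ` ?P"
  proof
    fix u assume "u \<in> {u. \<exists>m\<le>n. lie_commutator b X m u}"
    then obtain m where "m \<le> n" "lie_commutator b X m u" by auto
    then obtain p where p: "set p \<subseteq> ?A" "length p < 2 * m"
      "\<And>q st. run_postfix b (p @ q) st = run_postfix b q (u # st)"
      using commutator_postfix by metis
    have "hd (run_postfix b p []) = u"
      using p(3)[of "[]" "[]"] by simp
    then show "u \<in> (\<lambda>p. hd (run_postfix b p [])) ` ?P"
      using p(1,2) \<open>m \<le> n\<close> by (intro image_eqI[of _ _ p]) auto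
  qed
  show "finite {u. \<exists>m\<le>n. lie_commutator b X m u}"
    by (rule finite_subset[OF * finite_imageI[OF P(1)]])
  show "card {u. \<exists>m\<le>n. lie_commutator b X m u} \<le> ((card X + 2) ^ 2) ^ n"
    using le_trans[OF surj_card_le[OF P(1) *] P(2)] by (simp only: power_mult)
qed

text \<open>
  An embedding is additive and homogeneous on \<open>H\<close> only. A globally linear map that agrees with it
  on \<open>H\<close> preserves spans and, being injective there, independence.
\<close>

lemma lie_embedding_linear_extension:
  assumes "vector_space scale" "vector_space scale'" "module.subspace scale H"
    and e: "lie_embedding scale H br scale' G br' \<iota>"
  obtains f where "Vector_Spaces.linear scale scale' f" "\<And>v. v \<in> H \<Longrightarrow> f v = \<iota> v"
proof -
  interpret a: vector_space scale by fact
  interpret b: vector_space scale' by fact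
  interpret vector_space_pair scale scale' ..
  obtain B where B: "B \<subseteq> H" "a.independent B" "H \<subseteq> a.span B"
    using a.maximal_independent_subset by metis
  let ?f = "construct B \<iota>"
  have lin: "Vector_Spaces.linear scale scale' ?f"
    by (rule linear_construct[OF B(2)])
  have "v \<in> H \<and> ?f v = \<iota> v" if "v \<in> a.span B" for v
    using that
  proof (induction rule: a.span_induct_alt)
    case base
    have "\<iota> 0 = 0"
      using e a.subspace_0[OF assms(3)] a.scale_zero_left b.scale_zero_left
      unfolding lie_embedding_def by metis
    then show ?case
      using linear_0[OF lin] a.subspace_0[OF assms(3)] by simp
  next
    case (step c x y)
    then have "x \<in> H" "scale c x \<in> H" "?f x = \<iota> x"
      using B assms(3) a.subspace_scale construct_basis[OF B(2)] by auto
    then show ?case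
      using step e linear_add[OF lin] linear_scale[OF lin] a.subspace_add[OF assms(3)]
      unfolding lie_embedding_def by simp
  qed
  then show thesis
    using that[OF lin] B(3) by blast
qed

text \<open>
  Injective linear maps preserve independence, so the dimension of \<open>\<chi> n\<close> is bounded by the number
  of elements spanning a space that contains its image.
\<close>

lemma tame_of_embedding:
  assumes "vector_space scale" "vector_space scale'" "module.subspace scale H"
    and "lie_embedding scale H br scale' G br' \<iota>"
    and sub: "\<And>n. module.subspace scale (\<chi> n)" "\<And>n. \<chi> n \<subseteq> H"
    and S: "\<And>n. \<iota> ` \<chi> n \<subseteq> module.span scale' (S n)" "\<And>n. finite (S n)" "\<And>n. card (S n) \<le> a ^ n"
  shows "tame scale \<chi>"
proof -
  interpret a: vector_space scale by fact
  interpret b: vector_space scale' by fact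
  interpret vector_space_pair scale scale' ..
  obtain f where f: "Vector_Spaces.linear scale scale' f" "\<And>v. v \<in> H \<Longrightarrow> f v = \<iota> v"
    using lie_embedding_linear_extension[OF assms(1-4)] by metis
  have inj: "inj_on f H"
    using assms(4) f(2) unfolding lie_embedding_def inj_on_def by auto
  have dim: "a.dim (\<chi> n) \<le> a ^ n" for n
  proof -
    obtain B where B: "B \<subseteq> \<chi> n" "a.independent B" "\<chi> n \<subseteq> a.span B" "card B = a.dim (\<chi> n)"
      using a.basis_exists by metis
    have H: "a.span B \<subseteq> H" "B \<subseteq> H"
      using B(1) sub(2)[of n] a.span_minimal[OF B(1) sub(1)] by simp_all
    have "b.independent (f ` B)"
      by (rule linear_independent_injective_image[OF f(1) B(2) inj_on_subset[OF inj H(1)]])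
    moreover have "card (f ` B) = card B"
      by (rule card_image[OF inj_on_subset[OF inj H(2)]])
    moreover have "f ` B \<subseteq> b.span (S n)"
      using S(1)[of n] B(1) f(2) sub(2)[of n] by force
    ultimately have "card B \<le> card (S n)"
      using b.independent_span_bound[OF S(2)[of n]] by metis
    then show ?thesis
      using S(3)[of n] B(4) by simp
  qed
  \<comment> \<open>tameness asks for a strict inequality, hence the base \<open>a + 1\<close>\<close>
  have "real (a.dim (\<chi> n)) < (real a + 1) ^ n" if "n \<ge> 1" for n
  proof -
    have "real (a.dim (\<chi> n)) \<le> real a ^ n"
      using dim[of n] by (metis of_nat_le_iff of_nat_power)
    also have "\<dots> < (real a + 1) ^ n"
      using that by (intro power_strict_mono) auto
    finally show ?thesis .
  qed
  then show ?thesis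
    unfolding tame_def by (intro exI[of _ "real a + 1"]) auto
qed

lemma lie_filtrationD:
  assumes "lie_algebra scale H br" "lie_filtration scale H br \<chi>"
  shows "module.subspace scale (\<chi> n)" "\<chi> n \<subseteq> H" "\<chi> n \<subseteq> \<chi> (Suc n)" "m \<le> n \<Longrightarrow> \<chi> m \<subseteq> \<chi> n"
    "\<lbrakk>x \<in> \<chi> k; y \<in> \<chi> l\<rbrakk> \<Longrightarrow> br x y \<in> \<chi> (k + l)" "\<exists>B. finite B \<and> module.span scale B = \<chi> n"
    "(\<Union>n. \<chi> n) = H"
proof -
  interpret lie_algebra scale H br by fact
  show 1: "\<chi> n \<subseteq> \<chi> (Suc n)" for n
    using assms(2) unfolding lie_filtration_def by simp
  show "m \<le> n \<Longrightarrow> \<chi> m \<subseteq> \<chi> n"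
    using lift_Suc_mono_le[of \<chi>, OF 1] .
  show "subspace (\<chi> n)"
    using assms(2) subspace_span unfolding lie_filtration_def by metis
  show "(\<Union>n. \<chi> n) = H"
    using assms(2) unfolding lie_filtration_def by simp
  then show "\<chi> n \<subseteq> H"
    by auto
  show "\<exists>B. finite B \<and> module.span scale B = \<chi> n"
    using assms(2) unfolding lie_filtration_def by simp
  show "\<lbrakk>x \<in> \<chi> k; y \<in> \<chi> l\<rbrakk> \<Longrightarrow> br x y \<in> \<chi> (k + l)"
    using assms(2) unfolding lie_filtration_def by simp
qed

lemma tame_if_below_lie_degree_filtration:
  assumes H: "lie_algebra scale H br" "lie_filtration scale H br \<chi>"
    and G: "lie_algebra scale' G br'" "finite X"
    and e: "lie_embedding scale H br scale' G br' \<iota>"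
    and sub: "\<And>n. \<chi> n \<subseteq> restrict_filtration H \<iota> (lie_degree_filtration scale' br' X) (t * n)"
  shows "tame scale \<chi>"
proof (rule tame_of_embedding[OF _ _ _ e])
  show "\<iota> ` \<chi> n \<subseteq> module.span scale' {u. \<exists>m\<le>t * n. lie_commutator br' X m u}" for n
    using sub[of n] by (auto simp: restrict_filtration_def lie_degree_filtration_def)
  show "finite {u. \<exists>m\<le>t * n. lie_commutator br' X m u}"
    "card {u. \<exists>m\<le>t * n. lie_commutator br' X m u} \<le> (((card X + 2) ^ 2) ^ t) ^ n" for n
    using finitely_many_commutators[OF G(2), where n = "t * n"] by (simp_all only: power_mult)
qed (use H G lie_filtrationD[OF H] in \<open>simp_all add: lie_algebra_def lie_algebra_axioms_def\<close>)

lemma tame_if_below_assoc_degree_filtration: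
  assumes H: "lie_algebra scale H br" "lie_filtration scale H br \<chi>"
    and R: "unital_assoc_algebra scale' R mul one" "finite X"
    and e: "lie_embedding scale H br scale' R (assoc_commutator mul) \<iota>"
    and sub: "\<And>n. \<chi> n \<subseteq> restrict_filtration H \<iota> (assoc_degree_filtration scale' mul one X) (t * n)"
  shows "tame scale \<chi>"
proof (rule tame_of_embedding[OF _ _ _ e])
  let ?S = "\<lambda>n. {foldr mul xs one | xs. set xs \<subseteq> X \<and> length xs \<le> t * n}"
  have S: "?S n = (\<lambda>xs. foldr mul xs one) ` {xs. set xs \<subseteq> X \<and> length xs \<le> t * n}" for n
    by auto
  show "\<iota> ` \<chi> n \<subseteq> module.span scale' (?S n)" for n
    using sub[of n] by (auto simp: restrict_filtration_def assoc_degree_filtration_def)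
  show "finite (?S n)" for n
    unfolding S using card_short_lists[OF R(2)] by simp
  show "card (?S n) \<le> ((card X + 1) ^ t) ^ n" for n
    unfolding S power_mult[symmetric] using card_short_lists[OF R(2), of "t * n"] card_image_le
    by (metis (no_types, lifting) order_trans)
qed (use H R lie_filtrationD[OF H] in
    \<open>simp_all add: lie_algebra_def lie_algebra_axioms_def unital_assoc_algebra_def\<close>)

lemma
  assumes H: "lie_algebra scale H br" "lie_filtration scale H br \<chi>"
  shows tame_if_equiv_two_generator_lie:
      "equiv_two_generator_lie TYPE('g::ab_group_add) scale H br \<chi> \<Longrightarrow> tame scale \<chi>"
    and tame_if_equiv_two_generator_assoc:
      "equiv_two_generator_assoc TYPE('g) scale H br \<chi> \<Longrightarrow> tame scale \<chi>"
    and tame_if_eq_fin_gen_lie: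
      "eq_fin_gen_lie TYPE('g) scale H br \<chi> \<Longrightarrow> tame scale \<chi>"
    and tame_if_eq_fin_gen_assoc:
      "eq_fin_gen_assoc TYPE('g) scale H br \<chi> \<Longrightarrow> tame scale \<chi>"
proof -
  assume "equiv_two_generator_lie TYPE('g::ab_group_add) scale H br \<chi>"
  then obtain scale' :: "_ \<Rightarrow> 'g \<Rightarrow> 'g" and G br' x y \<iota> t where
    "lie_algebra scale' G br'" "lie_embedding scale H br scale' G br' \<iota>"
    "\<forall>n. \<chi> n \<subseteq> restrict_filtration H \<iota> (lie_degree_filtration scale' br' {x, y}) (t * n) \<and>
      restrict_filtration H \<iota> (lie_degree_filtration scale' br' {x, y}) n \<subseteq> \<chi> (t * n)"
    unfolding equiv_two_generator_lie_def filtration_equiv_def by (elim exE conjE)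
  then show "tame scale \<chi>"
    by (intro tame_if_below_lie_degree_filtration[OF H, where t = t and X = "{x, y}"]) auto
next
  assume "equiv_two_generator_assoc TYPE('g) scale H br \<chi>"
  then obtain scale' :: "_ \<Rightarrow> 'g \<Rightarrow> 'g" and R mul one x y \<iota> t where
    "unital_assoc_algebra scale' R mul one"
    "lie_embedding scale H br scale' R (assoc_commutator mul) \<iota>"
    "\<forall>n. \<chi> n \<subseteq> restrict_filtration H \<iota> (assoc_degree_filtration scale' mul one {x, y}) (t * n) \<and>
      restrict_filtration H \<iota> (assoc_degree_filtration scale' mul one {x, y}) n \<subseteq> \<chi> (t * n)"
    unfolding equiv_two_generator_assoc_def filtration_equiv_def by (elim exE conjE)
  then show "tame scale \<chi>"
    by (intro tame_if_below_assoc_degree_filtration[OF H, where t = t and X = "{x, y}"]) auto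
next
  assume "eq_fin_gen_lie TYPE('g) scale H br \<chi>"
  then obtain scale' :: "_ \<Rightarrow> 'g \<Rightarrow> 'g" and G br' X \<iota> where
    "lie_algebra scale' G br'" "finite X" "lie_embedding scale H br scale' G br' \<iota>"
    "\<chi> = restrict_filtration H \<iota> (lie_degree_filtration scale' br' X)"
    unfolding eq_fin_gen_lie_def by (elim exE conjE)
  then show "tame scale \<chi>"
    by (intro tame_if_below_lie_degree_filtration[OF H, where t = 1 and X = X]) auto
next
  assume "eq_fin_gen_assoc TYPE('g) scale H br \<chi>"
  then obtain scale' :: "_ \<Rightarrow> 'g \<Rightarrow> 'g" and R mul one X \<iota> where
    "unital_assoc_algebra scale' R mul one" "finite X"
    "lie_embedding scale H br scale' R (assoc_commutator mul) \<iota>"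
    "\<chi> = restrict_filtration H \<iota> (assoc_degree_filtration scale' mul one X)"
    unfolding eq_fin_gen_assoc_def by (elim exE conjE)
  then show "tame scale \<chi>"
    by (intro tame_if_below_assoc_degree_filtration[OF H, where t = 1 and X = X]) auto
qed

section \<open>Transport to the space of finitely supported sequences\<close>

text \<open>
  The structure of a Lie algebra \<open>G\<close> is carried along a linear map \<open>f\<close> that is injective on \<open>G\<close>.
  Commutators, degree filtrations and restricted filtrations are carried along with it.
\<close>

locale lie_transport = G: lie_algebra scale G br + T: vector_space scale' + vector_space_pair scale scale'
  for scale :: "'f::field \<Rightarrow> 'g::ab_group_add \<Rightarrow> 'g" and G br
    and scale' :: "'f \<Rightarrow> 'k::ab_group_add \<Rightarrow> 'k" +
  fixes f :: "'g \<Rightarrow> 'k"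
  assumes lin: "Vector_Spaces.linear scale scale' f" and inj: "inj_on f G"
begin

definition br' :: "'k \<Rightarrow> 'k \<Rightarrow> 'k"
  where "br' x y = f (br (inv_into G f x) (inv_into G f y))"

lemma br'_image: "\<lbrakk>x \<in> G; y \<in> G\<rbrakk> \<Longrightarrow> br' (f x) (f y) = f (br x y)"
  by (simp add: br'_def inv_into_f_f[OF inj])

lemma lie_algebra_image: "lie_algebra scale' (f ` G) br'"
proof -
  note ops = linear_add[OF lin, symmetric] linear_scale[OF lin, symmetric] br'_image
    G.br_closed G.subspace_add[OF G.subspace_carrier] G.subspace_scale[OF G.subspace_carrier]
  show ?thesis
    by unfold_locales
      (auto simp: linear_subspace_image[OF lin G.subspace_carrier] ops G.br_add_left G.br_add_right
        G.br_scale_left G.br_scale_right G.br_self G.jacobi linear_0[OF lin])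
qed

lemma commutators_image:
  assumes "X \<subseteq> G"
  shows "lie_commutator br' (f ` X) m v \<longleftrightarrow> (\<exists>u. lie_commutator br X m u \<and> v = f u)"
proof
  show "\<exists>u. lie_commutator br X m u \<and> v = f u" if "lie_commutator br' (f ` X) m v"
    using that
  proof induction
    case (generator x)
    then show ?case using lie_commutator.generator[of _ _ br] lie_commutator.generator[of _ _ br'] by (metis image_iff imageI)
  next
    case (bracket m u n v)
    then obtain u' v' where u': "lie_commutator br X m u'" "u = f u'"
        "lie_commutator br X n v'" "v = f v'"
      by auto
    then have "br' u v = f (br u' v')"
      using br'_image G.commutator_in_carrier[OF assms] by simp
    then show ?case
      using lie_commutator.bracket[OF u'(1,3)] by auto
  qed
  have "lie_commutator br' (f ` X) m (f u)" if "lie_commutator br X m u" for u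
    using that
  proof induction
    case (generator x)
    then show ?case using lie_commutator.generator[of _ _ br] lie_commutator.generator[of _ _ br'] by (metis image_iff imageI)
  next
    case (bracket m u n v)
    then have "br' (f u) (f v) = f (br u v)"
      using br'_image G.commutator_in_carrier[OF assms] by simp
    then show ?case
      using lie_commutator.bracket[OF bracket.IH] by simp
  qed
  then show "\<exists>u. lie_commutator br X m u \<and> v = f u \<Longrightarrow> lie_commutator br' (f ` X) m v"
    by auto
qed

lemma degree_filtration_image:
  assumes "X \<subseteq> G"
  shows "lie_degree_filtration scale' br' (f ` X) n = f ` lie_degree_filtration scale br X n"
proof -
  have "{v. \<exists>m\<le>n. lie_commutator br' (f ` X) m v} = f ` {u. \<exists>m\<le>n. lie_commutator br X m u}"
    using commutators_image[OF assms] by auto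
  then show ?thesis
    by (simp add: lie_degree_filtration_def linear_span_image[OF lin])
qed

lemma generated_image:
  assumes "lie_generated_by scale G br X"
  shows "lie_generated_by scale' (f ` G) br' (f ` X)"
proof -
  have X: "X \<subseteq> G" "G = G.span {u. \<exists>m. lie_commutator br X m u}"
    using assms G.lie_generated_by_iff by auto
  have "{v. \<exists>m. lie_commutator br' (f ` X) m v} = f ` {u. \<exists>m. lie_commutator br X m u}"
    using commutators_image[OF X(1)] by auto
  then have "T.span {v. \<exists>m. lie_commutator br' (f ` X) m v} = f ` G"
    by (simp only: linear_span_image[OF lin] X(2)[symmetric])
  then show ?thesis
    using X(1) lie_algebra.lie_generated_by_iff[OF lie_algebra_image, of "f ` X"] by auto
qed

lemma embedding_image:
  assumes "lie_embedding s H b scale G br \<iota>"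
  shows "lie_embedding s H b scale' (f ` G) br' (f \<circ> \<iota>)"
  using assms unfolding lie_embedding_def
  by (auto simp: linear_add[OF lin] linear_scale[OF lin] br'_image image_subset_iff
      intro!: comp_inj_on inj_on_subset[OF inj])

lemma restrict_filtration_image:
  assumes "lie_embedding s H b scale G br \<iota>" "X \<subseteq> G"
  shows "restrict_filtration H (f \<circ> \<iota>) (lie_degree_filtration scale' br' (f ` X)) =
    restrict_filtration H \<iota> (lie_degree_filtration scale br X)"
proof -
  have "\<iota> x \<in> G" if "x \<in> H" for x
    using assms(1) that unfolding lie_embedding_def by auto
  then have "f (\<iota> x) \<in> f ` lie_degree_filtration scale br X n \<longleftrightarrow>
      \<iota> x \<in> lie_degree_filtration scale br X n" if "x \<in> H" for x n
    using inj_on_image_mem_iff[OF inj _ G.degree_filtration_in_carrier[OF assms(2)]] that by metis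
  then show ?thesis
    by (simp add: restrict_filtration_def degree_filtration_image[OF assms(2)] fun_eq_iff set_eq_iff
      cong: conj_cong)
qed

end

locale assoc_transport = R: unital_assoc_algebra scale R mul one + T: vector_space scale' + vector_space_pair scale scale'
  for scale :: "'f::field \<Rightarrow> 'g::ab_group_add \<Rightarrow> 'g" and R mul one
    and scale' :: "'f \<Rightarrow> 'k::ab_group_add \<Rightarrow> 'k" +
  fixes f :: "'g \<Rightarrow> 'k"
  assumes lin: "Vector_Spaces.linear scale scale' f" and inj: "inj_on f R"
begin

definition mul' :: "'k \<Rightarrow> 'k \<Rightarrow> 'k"
  where "mul' x y = f (mul (inv_into R f x) (inv_into R f y))"

lemma mul'_image: "\<lbrakk>x \<in> R; y \<in> R\<rbrakk> \<Longrightarrow> mul' (f x) (f y) = f (mul x y)"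
  by (simp add: mul'_def inv_into_f_f[OF inj])

lemma assoc_algebra_image: "unital_assoc_algebra scale' (f ` R) mul' (f one)"
proof -
  note ops = linear_add[OF lin, symmetric] linear_scale[OF lin, symmetric] mul'_image
    R.mul_closed R.subspace_add[OF R.subspace_carrier] R.subspace_scale[OF R.subspace_carrier]
  show ?thesis
    by unfold_locales
      (auto simp: linear_subspace_image[OF lin R.subspace_carrier] ops R.mul_add_left
        R.mul_add_right R.mul_scale_left R.mul_scale_right R.mul_assoc R.one_closed
        R.mul_one_left R.mul_one_right)
qed

lemma product_image:
  "set xs \<subseteq> R \<Longrightarrow> foldr mul' (map f xs) (f one) = f (foldr mul xs one)"
  by (induction xs) (auto simp: mul'_image R.product_in_carrier)

lemma products_image:
  assumes "X \<subseteq> R"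
  shows "{foldr mul' ys (f one) | ys. set ys \<subseteq> f ` X \<and> P (length ys)} =
    f ` {foldr mul xs one | xs. set xs \<subseteq> X \<and> P (length xs)}" (is "?A = f ` ?B")
proof
  show "?A \<subseteq> f ` ?B"
  proof
    fix v assume "v \<in> ?A"
    then obtain ys where ys: "set ys \<subseteq> f ` X" "P (length ys)" "v = foldr mul' ys (f one)"
      by auto
    from ys(1) have "ys \<in> map f ` lists X"
      unfolding lists_image[symmetric] by (simp add: in_lists_conv_set subset_iff)
    then obtain xs where "set xs \<subseteq> X" "ys = map f xs"
      by auto
    then have "v = f (foldr mul xs one)" "foldr mul xs one \<in> ?B"
      using ys assms product_image[of xs] by auto
    then show "v \<in> f ` ?B" by blast
  qed
  show "f ` ?B \<subseteq> ?A"
  proof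
    fix v assume "v \<in> f ` ?B"
    then obtain xs where xs: "set xs \<subseteq> X" "P (length xs)" "v = f (foldr mul xs one)"
      by auto
    then have "v = foldr mul' (map f xs) (f one)" "set (map f xs) \<subseteq> f ` X" "P (length (map f xs))"
      using product_image[of xs] assms by auto
    then show "v \<in> ?A" by blast
  qed
qed

lemma degree_filtration_image:
  assumes "X \<subseteq> R"
  shows "assoc_degree_filtration scale' mul' (f one) (f ` X) n =
    f ` assoc_degree_filtration scale mul one X n"
  by (simp add: assoc_degree_filtration_def linear_span_image[OF lin]
      products_image[OF assms, of "\<lambda>m. m \<le> n"])

lemma generated_image:
  assumes "assoc_generated_by scale R mul one X"
  shows "assoc_generated_by scale' (f ` R) mul' (f one) (f ` X)"
proof -
  have X: "X \<subseteq> R" "R = R.span {foldr mul xs one | xs. set xs \<subseteq> X}"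
    using assms R.assoc_generated_by_iff by auto
  have "T.span {foldr mul' ys (f one) | ys. set ys \<subseteq> f ` X} = f ` R"
    unfolding products_image[OF X(1), of "\<lambda>_. True", unfolded simp_thms]
      linear_span_image[OF lin] by (rule arg_cong[OF X(2)[symmetric]])
  then show ?thesis
    using X(1) unital_assoc_algebra.assoc_generated_by_iff[OF assoc_algebra_image, of "f ` X"]
    by auto
qed

lemma embedding_image:
  assumes "lie_embedding s H b scale R (assoc_commutator mul) \<iota>"
  shows "lie_embedding s H b scale' (f ` R) (assoc_commutator mul') (f \<circ> \<iota>)"
  using assms unfolding lie_embedding_def
  by (auto simp: linear_add[OF lin] linear_scale[OF lin] linear_diff[OF lin] mul'_image
      assoc_commutator_def image_subset_iff intro!: comp_inj_on inj_on_subset[OF inj])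

lemma restrict_filtration_image:
  assumes "lie_embedding s H b scale R (assoc_commutator mul) \<iota>" "X \<subseteq> R"
  shows "restrict_filtration H (f \<circ> \<iota>) (assoc_degree_filtration scale' mul' (f one) (f ` X)) =
    restrict_filtration H \<iota> (assoc_degree_filtration scale mul one X)"
proof -
  have "\<iota> x \<in> R" if "x \<in> H" for x
    using assms(1) that unfolding lie_embedding_def by auto
  moreover have "assoc_degree_filtration scale mul one X n \<subseteq> R" for n
    unfolding assoc_degree_filtration_def
    by (rule R.span_minimal) (use R.products_in_carrier[OF assms(2)] R.subspace_carrier in auto)
  ultimately have "f (\<iota> x) \<in> f ` assoc_degree_filtration scale mul one X n \<longleftrightarrow>
      \<iota> x \<in> assoc_degree_filtration scale mul one X n" if "x \<in> H" for x n
    using inj_on_image_mem_iff[OF inj] that by metis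
  then show ?thesis
    by (simp add: restrict_filtration_def degree_filtration_image[OF assms(2)] fun_eq_iff set_eq_iff
      cong: conj_cong)
qed

end

lift_definition scale_sequence :: "'f::field \<Rightarrow> (nat \<Rightarrow>\<^sub>0 'f) \<Rightarrow> (nat \<Rightarrow>\<^sub>0 'f)"
  is "\<lambda>c p n. c * p n"
  by (rule rev_finite_subset) auto

lemma vector_space_scale_sequence: "vector_space scale_sequence"
  by unfold_locales (transfer, simp add: fun_eq_iff algebra_simps)+

text \<open>
  A countable spanning set contains a countable basis; the map sends its elements to distinct
  unit sequences.
\<close>

lemma countably_spanned_embedding:
  fixes scale :: "'f::field \<Rightarrow> 'g::ab_group_add \<Rightarrow> 'g"
  assumes "vector_space scale" "countable C"
  obtains f :: "'g \<Rightarrow> (nat \<Rightarrow>\<^sub>0 'f)" where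
    "Vector_Spaces.linear scale scale_sequence f" "inj_on f (module.span scale C)"
proof -
  interpret a: vector_space scale by fact
  interpret b: vector_space "scale_sequence :: 'f \<Rightarrow> _"
    by (rule vector_space_scale_sequence)
  interpret vector_space_pair scale "scale_sequence :: 'f \<Rightarrow> _" ..
  obtain B where B: "B \<subseteq> C" "a.independent B" "C \<subseteq> a.span B"
    using a.maximal_independent_subset by metis
  then have "countable B"
    using assms(2) countable_subset by blast
  then obtain k :: "'g \<Rightarrow> nat" where k: "inj_on k B"
    by blast
  let ?e = "\<lambda>b. Poly_Mapping.single (k b) (1 :: 'f)"
  let ?f = "construct B ?e"
  have lin: "Vector_Spaces.linear scale scale_sequence ?f"
    by (rule linear_construct[OF B(2)])
  have e: "?f b = ?e b" if "b \<in> B" for b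
    using construct_basis[OF B(2) that] .
  have kernel: "v = 0" if v: "v \<in> a.span B" "?f v = 0" for v
  proof -
    let ?r = "a.representation B v"
    let ?S = "{b. ?r b \<noteq> 0}"
    have S: "finite ?S" "?S \<subseteq> B"
      using a.finite_representation a.representation_ne_zero by auto
    have v_sum: "v = (\<Sum>b\<in>?S. scale (?r b) b)"
      using a.sum_nonzero_representation_eq[OF B(2) v(1)] by simp
    have "0 = (\<Sum>b\<in>?S. scale_sequence (?r b) (?e b))"
      unfolding v(2)[symmetric] using S e
      by (subst (1) v_sum) (auto simp: linear_sum[OF lin] linear_scale[OF lin] intro!: sum.cong)
    then have coeff: "(\<Sum>b\<in>?S. ?r b * (1 when k b = n)) = 0" for n
      by (metis (no_types, lifting) lookup_sum lookup_zero scale_sequence.rep_eq lookup_single sum.cong)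
    have "?S = {}"
    proof (rule ccontr)
      assume "?S \<noteq> {}"
      then obtain b where b: "b \<in> ?S" by blast
      have "(\<Sum>b'\<in>?S. ?r b' * (1 when k b' = k b)) = (\<Sum>b'\<in>?S. if b' = b then ?r b else 0)"
        using S(2) b k by (intro sum.cong) (auto simp: when_def inj_on_def)
      also have "\<dots> = ?r b"
        using b S(1) by simp
      finally show False
        using coeff[of "k b"] b by simp
    qed
    then show "v = 0"
      using v_sum by simp
  qed
  have "inj_on ?f (a.span B)"
    using linear_inj_on_iff_eq_0[OF lin] kernel by blast
  moreover have "a.span C \<subseteq> a.span B"
    using B(3) a.span_minimal by blast
  ultimately show thesis
    using that[OF lin] inj_on_subset by blast
qed

lemma countable_commutators:
  assumes "finite X"
  shows "countable {u. \<exists>m. lie_commutator b X m u}"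
proof -
  have "{u. \<exists>m. lie_commutator b X m u} = (\<Union>n. {u. \<exists>m\<le>n. lie_commutator b X m u})"
    by auto
  then show ?thesis
    by (simp only:) (rule countable_UN[OF countableI_type
          countable_finite[OF finitely_many_commutators(1)[OF assms]]])
qed

lemma countable_products: "finite X \<Longrightarrow> countable {foldr f xs e | xs. set xs \<subseteq> X}"
proof -
  assume "finite X"
  then have "countable ((\<lambda>xs. foldr f xs e) ` lists X)"
    by (intro countable_image countable_lists countable_finite)
  moreover have "{foldr f xs e | xs. set xs \<subseteq> X} = (\<lambda>xs. foldr f xs e) ` lists X"
    by auto
  ultimately show ?thesis by simp
qed

lemma lie_transport_to_sequences:
  fixes scale' :: "'f::field \<Rightarrow> 'g::ab_group_add \<Rightarrow> 'g"
  assumes "lie_algebra scale' G br'" "finite X" "lie_generated_by scale' G br' X"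
  obtains f :: "'g \<Rightarrow> (nat \<Rightarrow>\<^sub>0 'f)" where "lie_transport scale' G br' scale_sequence f"
proof -
  interpret lie_algebra scale' G br' by fact
  obtain f :: "'g \<Rightarrow> (nat \<Rightarrow>\<^sub>0 'f)" where
    "Vector_Spaces.linear scale' scale_sequence f" "inj_on f (span {u. \<exists>m. lie_commutator br' X m u})"
    using countably_spanned_embedding[OF vector_space_axioms countable_commutators[OF assms(2), of br']]
    by blast
  then have "lie_transport scale' G br' scale_sequence f"
    using assms(1,3) vector_space_scale_sequence lie_generated_by_iff
    by (auto simp: lie_transport_def lie_transport_axioms_def vector_space_pair_def vector_space_axioms)
  then show thesis by (rule that)
qed

lemma assoc_transport_to_sequences:
  fixes scale' :: "'f::field \<Rightarrow> 'g::ab_group_add \<Rightarrow> 'g"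
  assumes "unital_assoc_algebra scale' R mul one" "finite X" "assoc_generated_by scale' R mul one X"
  obtains f :: "'g \<Rightarrow> (nat \<Rightarrow>\<^sub>0 'f)" where "assoc_transport scale' R mul one scale_sequence f"
proof -
  interpret unital_assoc_algebra scale' R mul one by fact
  obtain f :: "'g \<Rightarrow> (nat \<Rightarrow>\<^sub>0 'f)" where
    "Vector_Spaces.linear scale' scale_sequence f" "inj_on f (span {foldr mul xs one | xs. set xs \<subseteq> X})"
    using countably_spanned_embedding[OF vector_space_axioms countable_products[OF assms(2), of mul one]]
    by blast
  then have "assoc_transport scale' R mul one scale_sequence f"
    using assms(1,3) vector_space_scale_sequence assoc_generated_by_iff
    by (auto simp: assoc_transport_def assoc_transport_axioms_def vector_space_pair_def vector_space_axioms)
  then show thesis by (rule that)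
qed

lemma equiv_two_generator_lie_sequences:
  fixes scale :: "'f::field \<Rightarrow> 'h::ab_group_add \<Rightarrow> 'h"
  assumes "equiv_two_generator_lie TYPE('g::ab_group_add) scale H br \<chi>"
  shows "equiv_two_generator_lie TYPE(nat \<Rightarrow>\<^sub>0 'f) scale H br \<chi>"
proof -
  obtain scale' :: "'f \<Rightarrow> 'g \<Rightarrow> 'g" and G br' x y \<iota> where
    G: "lie_algebra scale' G br'" "lie_generated_by scale' G br' {x, y}"
    "lie_embedding scale H br scale' G br' \<iota>"
    "filtration_equiv \<chi> (restrict_filtration H \<iota> (lie_degree_filtration scale' br' {x, y}))"
    using assms unfolding equiv_two_generator_lie_def by (elim exE conjE)
  obtain f :: "'g \<Rightarrow> (nat \<Rightarrow>\<^sub>0 'f)" where "lie_transport scale' G br' scale_sequence f"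
    using lie_transport_to_sequences[OF G(1) _ G(2)] by blast
  then interpret lie_transport scale' G br' scale_sequence f .
  have X: "{x, y} \<subseteq> G" "f ` {x, y} = {f x, f y}"
    using G(2) unfolding lie_generated_by_def by auto
  show ?thesis
    unfolding equiv_two_generator_lie_def
    using lie_algebra_image generated_image[OF G(2)] embedding_image[OF G(3)]
      restrict_filtration_image[OF G(3) X(1)] G(4) unfolding X(2) by metis
qed

lemma eq_fin_gen_lie_sequences:
  fixes scale :: "'f::field \<Rightarrow> 'h::ab_group_add \<Rightarrow> 'h"
  assumes "eq_fin_gen_lie TYPE('g::ab_group_add) scale H br \<chi>"
  shows "eq_fin_gen_lie TYPE(nat \<Rightarrow>\<^sub>0 'f) scale H br \<chi>"
proof -
  obtain scale' :: "'f \<Rightarrow> 'g \<Rightarrow> 'g" and G br' X \<iota> where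
    G: "lie_algebra scale' G br'" "finite X" "lie_generated_by scale' G br' X"
    "lie_embedding scale H br scale' G br' \<iota>"
    "\<chi> = restrict_filtration H \<iota> (lie_degree_filtration scale' br' X)"
    using assms unfolding eq_fin_gen_lie_def by (elim exE conjE)
  obtain f :: "'g \<Rightarrow> (nat \<Rightarrow>\<^sub>0 'f)" where "lie_transport scale' G br' scale_sequence f"
    using lie_transport_to_sequences[OF G(1-3)] by blast
  then interpret lie_transport scale' G br' scale_sequence f .
  have X: "X \<subseteq> G"
    using G(3) unfolding lie_generated_by_def by auto
  show ?thesis
    unfolding eq_fin_gen_lie_def
    using lie_algebra_image generated_image[OF G(3)] embedding_image[OF G(4)]
      restrict_filtration_image[OF G(4) X] G(5) finite_imageI[OF G(2)] by metis
qed

lemma equiv_two_generator_assoc_sequences: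
  fixes scale :: "'f::field \<Rightarrow> 'h::ab_group_add \<Rightarrow> 'h"
  assumes "equiv_two_generator_assoc TYPE('g::ab_group_add) scale H br \<chi>"
  shows "equiv_two_generator_assoc TYPE(nat \<Rightarrow>\<^sub>0 'f) scale H br \<chi>"
proof -
  obtain scale' :: "'f \<Rightarrow> 'g \<Rightarrow> 'g" and R mul one x y \<iota> where
    R: "unital_assoc_algebra scale' R mul one" "assoc_generated_by scale' R mul one {x, y}"
    "lie_embedding scale H br scale' R (assoc_commutator mul) \<iota>"
    "filtration_equiv \<chi> (restrict_filtration H \<iota> (assoc_degree_filtration scale' mul one {x, y}))"
    using assms unfolding equiv_two_generator_assoc_def by (elim exE conjE)
  obtain f :: "'g \<Rightarrow> (nat \<Rightarrow>\<^sub>0 'f)" where "assoc_transport scale' R mul one scale_sequence f"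
    using assoc_transport_to_sequences[OF R(1) _ R(2)] by blast
  then interpret assoc_transport scale' R mul one scale_sequence f .
  have X: "{x, y} \<subseteq> R" "f ` {x, y} = {f x, f y}"
    using R(2) unfolding assoc_generated_by_def by auto
  show ?thesis
    unfolding equiv_two_generator_assoc_def
    using assoc_algebra_image generated_image[OF R(2)] embedding_image[OF R(3)]
      restrict_filtration_image[OF R(3) X(1)] R(4) unfolding X(2) by metis
qed

lemma eq_fin_gen_assoc_sequences:
  fixes scale :: "'f::field \<Rightarrow> 'h::ab_group_add \<Rightarrow> 'h"
  assumes "eq_fin_gen_assoc TYPE('g::ab_group_add) scale H br \<chi>"
  shows "eq_fin_gen_assoc TYPE(nat \<Rightarrow>\<^sub>0 'f) scale H br \<chi>"
proof -
  obtain scale' :: "'f \<Rightarrow> 'g \<Rightarrow> 'g" and R mul one X \<iota> where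
    R: "unital_assoc_algebra scale' R mul one" "finite X" "assoc_generated_by scale' R mul one X"
    "lie_embedding scale H br scale' R (assoc_commutator mul) \<iota>"
    "\<chi> = restrict_filtration H \<iota> (assoc_degree_filtration scale' mul one X)"
    using assms unfolding eq_fin_gen_assoc_def by (elim exE conjE)
  obtain f :: "'g \<Rightarrow> (nat \<Rightarrow>\<^sub>0 'f)" where "assoc_transport scale' R mul one scale_sequence f"
    using assoc_transport_to_sequences[OF R(1-3)] by blast
  then interpret assoc_transport scale' R mul one scale_sequence f .
  have X: "X \<subseteq> R"
    using R(3) unfolding assoc_generated_by_def by auto
  show ?thesis
    unfolding eq_fin_gen_assoc_def
    using assoc_algebra_image generated_image[OF R(3)] embedding_image[OF R(4)]
      restrict_filtration_image[OF R(4) X] R(5) finite_imageI[OF R(2)] by metis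
qed

section \<open>Adapted bases and synchronizing codes\<close>

text \<open>
  Extend a basis of \<open>\<chi> n\<close> to one of \<open>\<chi> (Suc n)\<close>, for all \<open>n\<close> in turn, and take the union. An
  element of the union that lies in \<open>\<chi> n\<close> already belongs to the basis of \<open>\<chi> n\<close>, since it
  would otherwise depend on other elements of a later basis.
\<close>

lemma adapted_basis:
  assumes H: "lie_algebra scale H br" "lie_filtration scale H br \<chi>"
  obtains B where "\<not> module.dependent scale B" "\<And>n. module.span scale (B \<inter> \<chi> n) = \<chi> n"
    "\<And>n. finite (B \<inter> \<chi> n)" "B \<subseteq> H"
proof -
  interpret lie_algebra scale H br by fact
  note filt = lie_filtrationD[OF H]
  let ?basis = "\<lambda>n S. independent S \<and> S \<subseteq> \<chi> n \<and> \<chi> n \<subseteq> span S"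
  have "\<exists>S. \<forall>n. ?basis n (S n) \<and> S n \<subseteq> S (Suc n)"
  proof (rule dependent_nat_choice)
    show "\<exists>S. ?basis 0 S"
      using maximal_independent_subset[of "\<chi> 0"] by metis
    show "\<exists>T. ?basis (Suc n) T \<and> S \<subseteq> T" if "?basis n S" for S n
    proof -
      have "S \<subseteq> \<chi> (Suc n)" "independent S"
        using that filt(3)[of n] by auto
      then show ?thesis
        using maximal_independent_subset_extend[of S "\<chi> (Suc n)"] by metis
    qed
  qed
  then obtain S where S: "\<And>n. ?basis n (S n)" and "\<And>n. S n \<subseteq> S (Suc n)"
    by blast
  then have mono: "S m \<subseteq> S n" if "m \<le> n" for m n
    using lift_Suc_mono_le[of S] that by blast
  have span: "span (S n) = \<chi> n" for n
    using S[of n] span_minimal[OF _ filt(1)] by blast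
  define B where "B = (\<Union>n. S n)"
  have "independent B"
    unfolding B_def
  proof (rule independent_Union_directed)
    show "c \<subseteq> d \<or> d \<subseteq> c" if "c \<in> range S" "d \<in> range S" for c d
    proof -
      from that obtain m n where "c = S m" "d = S n" by (elim imageE)
      then show ?thesis
        using mono[of m n] mono[of n m] linear[of m n] by blast
    qed
  qed (use S in auto)
  have B_Int: "B \<inter> \<chi> n = S n" for n
  proof
    show "S n \<subseteq> B \<inter> \<chi> n"
      using S by (auto simp: B_def)
    show "B \<inter> \<chi> n \<subseteq> S n"
    proof
      fix b assume b: "b \<in> B \<inter> \<chi> n"
      then obtain m where m: "b \<in> S m" by (auto simp: B_def)
      show "b \<in> S n"
      proof (rule ccontr)
        assume "b \<notin> S n"
        then have "S n \<subseteq> S (max m n) - {b}"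
          using mono[of n "max m n"] by auto
        then have "b \<in> span (S (max m n) - {b})"
          using b span[of n] span_mono by blast
        moreover have "b \<in> S (max m n)"
          using m mono[of m "max m n"] by auto
        ultimately show False
          using S[of "max m n"] dependent_def by blast
      qed
    qed
  qed
  have "finite (S n)" for n
  proof -
    obtain T where "finite T" "span T = \<chi> n"
      using filt(6) by blast
    then show ?thesis
      using S[of n] independent_span_bound[of T "S n"] by auto
  qed
  moreover have "B \<subseteq> H"
    using S filt(2) by (fastforce simp: B_def)
  ultimately show thesis
    using that[of B] \<open>independent B\<close> span by (simp add: B_Int)
qed

text \<open>
  A code is synchronized if an occurrence of a code word in a product of code words is always one
  of the factors. This is stronger than unique decodability: no code word overlaps or is contained
  in a product of others in an unexpected place. It makes the set of products of code words
  insensitive to inserting, deleting or exchanging code words.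
\<close>

definition synchronized :: "'b set \<Rightarrow> ('b \<Rightarrow> 'v list) \<Rightarrow> bool"
  where "synchronized B w \<longleftrightarrow> (\<forall>b\<in>B. w b \<noteq> []) \<and>
    (\<forall>b\<in>B. \<forall>bs u v. set bs \<subseteq> B \<longrightarrow> concat (map w bs) = u @ w b @ v \<longrightarrow>
      (\<exists>ys zs. bs = ys @ b # zs \<and> u = concat (map w ys) \<and> v = concat (map w zs)))"

lemma synchronized_nonempty: "\<lbrakk>synchronized B w; b \<in> B\<rbrakk> \<Longrightarrow> w b \<noteq> []"
  by (simp add: synchronized_def)

lemma synchronizedE:
  assumes "synchronized B w" "b \<in> B" "set bs \<subseteq> B" "concat (map w bs) = u @ w b @ v"
  obtains ys zs where "bs = ys @ b # zs" "u = concat (map w ys)" "v = concat (map w zs)"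
  using assms unfolding synchronized_def by metis

lemma synchronized_concat_Nil:
  "\<lbrakk>synchronized B w; set bs \<subseteq> B; concat (map w bs) = []\<rbrakk> \<Longrightarrow> bs = []"
  by (cases bs) (auto simp: synchronized_def)

lemma synchronized_prefix_free:
  assumes "synchronized B w" "b \<in> B" "b' \<in> B" "w b' = w b @ u"
  shows "b' = b"
proof -
  obtain ys zs where "[b'] = ys @ b # zs"
    by (rule synchronizedE[OF assms(1,2), of "[b']" "[]" u]) (use assms in auto)
  then show ?thesis
    by (cases ys) auto
qed

lemma synchronized_unique:
  assumes w: "synchronized B w"
  shows "\<lbrakk>set bs \<subseteq> B; set cs \<subseteq> B; concat (map w bs) = concat (map w cs)\<rbrakk> \<Longrightarrow> bs = cs"
proof (induction bs arbitrary: cs)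
  case Nil
  then show ?case using synchronized_concat_Nil[OF w, of cs] by simp
next
  case (Cons b bs)
  obtain ys zs where yz: "cs = ys @ b # zs" "[] = concat (map w ys)"
    "concat (map w bs) = concat (map w zs)"
    by (rule synchronizedE[OF w, of b cs "[]" "concat (map w bs)"]) (use Cons.prems in auto)
  moreover have "ys = []"
    using synchronized_concat_Nil[OF w, of ys] yz Cons.prems by simp
  ultimately show ?case
    using Cons.IH[of zs] Cons.prems by simp
qed

lemma synchronized_word:
  assumes f: "synchronized A f"
  shows "\<lbrakk>set zs \<subseteq> A; set p \<subseteq> A; p \<noteq> []; concat (map f zs) = u @ concat (map f p) @ v\<rbrakk> \<Longrightarrow>
    \<exists>us vs. zs = us @ p @ vs \<and> u = concat (map f us) \<and> v = concat (map f vs)"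
proof (induction p arbitrary: u zs)
  case (Cons a p)
  obtain us vs where us: "zs = us @ a # vs" "u = concat (map f us)"
    "concat (map f p) @ v = concat (map f vs)"
    by (rule synchronizedE[OF f, of a zs u "concat (map f p) @ v"]) (use Cons.prems in auto)
  show ?case
  proof (cases "p = []")
    case True
    then show ?thesis
      using us by auto
  next
    case False
    then obtain us' vs' where us': "vs = us' @ p @ vs'" "[] = concat (map f us')" "v = concat (map f vs')"
      using Cons.IH[of vs "[]"] us Cons.prems by auto
    moreover have "us' = []"
      using synchronized_concat_Nil[OF f, of us'] us us' Cons.prems by simp
    ultimately show ?thesis
      using us by auto
  qed
qed simp

text \<open>
  Encoding the letters of a synchronized code by another synchronized code gives a synchronized
  code; this reduces the two-letter alphabet to an arbitrary finite one.
\<close>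

lemma synchronized_compose:
  assumes w: "synchronized B w" and f: "synchronized A f" and A: "\<And>b. b \<in> B \<Longrightarrow> set (w b) \<subseteq> A"
  shows "synchronized B (\<lambda>b. concat (map f (w b)))"
  unfolding synchronized_def
proof (intro conjI ballI allI impI)
  fix b assume b: "b \<in> B"
  show "concat (map f (w b)) \<noteq> []"
    using synchronized_concat_Nil[OF f A[OF b]] synchronized_nonempty[OF w b] by blast
  fix bs u v assume bs: "set bs \<subseteq> B"
    and eq: "concat (map (\<lambda>b. concat (map f (w b))) bs) = u @ concat (map f (w b)) @ v"
  have flat: "concat (map (\<lambda>b. concat (map f (w b))) cs) = concat (map f (concat (map w cs)))" for cs
    by (induction cs) auto
  have "set (concat (map w bs)) \<subseteq> A"
    using bs A by auto
  then obtain us vs where us: "concat (map w bs) = us @ w b @ vs"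
    and uv: "u = concat (map f us)" "v = concat (map f vs)"
    using synchronized_word[OF f _ A[OF b] synchronized_nonempty[OF w b]] eq unfolding flat by blast
  obtain ys zs where "bs = ys @ b # zs" "us = concat (map w ys)" "vs = concat (map w zs)"
    by (rule synchronizedE[OF w b bs us])
  then show "\<exists>ys zs. bs = ys @ b # zs \<and> u = concat (map (\<lambda>b. concat (map f (w b))) ys) \<and>
      v = concat (map (\<lambda>b. concat (map f (w b))) zs)"
    using uv unfolding flat by blast
qed

text \<open>
  Each letter records whether it is the first and whether it is the last one of its word. The
  length of the word does not change, which is what the exact equality of filtrations needs.
\<close>

definition mark_ends :: "'v list \<Rightarrow> ('v \<times> bool \<times> bool) list"
  where "mark_ends xs = map (\<lambda>i. (xs ! i, i = 0, Suc i = length xs)) [0..<length xs]"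

lemma length_mark_ends [simp]: "length (mark_ends xs) = length xs"
  by (simp add: mark_ends_def)

lemma mark_ends_Nil_iff [simp]: "mark_ends xs = [] \<longleftrightarrow> xs = []"
  by (simp add: mark_ends_def)

lemma nth_mark_ends: "i < length xs \<Longrightarrow> mark_ends xs ! i = (xs ! i, i = 0, Suc i = length xs)"
  by (simp add: mark_ends_def)

lemma set_mark_ends: "set (mark_ends xs) \<subseteq> set xs \<times> UNIV"
  by (auto simp: mark_ends_def)

text \<open>
  If the lengths differed, the letter ending the shorter word would be marked as final in one word
  and not in the other.
\<close>

lemma mark_ends_prefix:
  assumes "mark_ends xs @ u = mark_ends ys @ v" "xs \<noteq> []" "ys \<noteq> []"
  shows "xs = ys"
proof -
  have "length xs = length ys"
  proof (rule ccontr)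
    assume neq: "length xs \<noteq> length ys"
    define i where "i = min (length xs) (length ys) - 1"
    have i: "i < length xs" "i < length ys"
      using assms(2,3)[folded length_greater_0_conv] unfolding i_def by linarith+
    have "mark_ends xs ! i = mark_ends ys ! i"
      using arg_cong[OF assms(1), of "\<lambda>l. l ! i"] i by (simp add: nth_append)
    then have "Suc i = length xs \<longleftrightarrow> Suc i = length ys"
      using i by (simp add: nth_mark_ends)
    then show False
      using neq i unfolding i_def by linarith
  qed
  moreover from this have "mark_ends xs = mark_ends ys"
    using assms(1) by (simp add: append_eq_append_conv)
  then have "xs ! i = ys ! i" if "i < length xs" for i
    using that calculation nth_mark_ends[of i xs] nth_mark_ends[of i ys] by simp
  ultimately show ?thesis
    by (simp add: list_eq_iff_nth_eq)
qed

text \<open>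
  A marked initial letter cannot occur inside another code word, so an occurrence starts where a
  factor starts; the final marks then force it to be this factor.
\<close>

lemma synchronized_mark_ends:
  assumes inj: "inj_on c B" and nonempty: "\<And>b. b \<in> B \<Longrightarrow> c b \<noteq> []"
  shows "synchronized B (\<lambda>b. mark_ends (c b))"
  unfolding synchronized_def
proof (intro conjI ballI allI impI)
  let ?w = "\<lambda>b. mark_ends (c b)"
  show "?w b \<noteq> []" if "b \<in> B" for b
    using nonempty[OF that] by simp
  fix b bs u v assume b: "b \<in> B" and "set bs \<subseteq> B" "concat (map ?w bs) = u @ ?w b @ v"
  then show "\<exists>ys zs. bs = ys @ b # zs \<and> u = concat (map ?w ys) \<and> v = concat (map ?w zs)"
  proof (induction bs arbitrary: u)
    case Nil
    then show ?case using nonempty[OF b] by simp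
  next
    case (Cons a bs)
    have eq: "?w a @ concat (map ?w bs) = u @ ?w b @ v" and a: "a \<in> B"
      using Cons.prems by auto
    consider "u = []" | "u \<noteq> []" "length u < length (c a)" | "length (c a) \<le> length u"
      by linarith
    then show ?case
    proof cases
      case 1
      then have "c a = c b"
        using mark_ends_prefix[of "c a" _ "c b"] eq nonempty a b by simp
      then have "a = b"
        using inj a b by (auto dest: inj_onD)
      then show ?thesis
        using 1 eq by (intro exI[of _ "[]"] exI[of _ bs]) simp
    next
      case 2
      have "(?w a @ concat (map ?w bs)) ! length u = (u @ ?w b @ v) ! length u"
        by (simp only: eq)
      then have "?w a ! length u = ?w b ! 0"
        using 2 nonempty[OF b] by (simp add: nth_append)
      then show ?thesis
        using 2 nonempty[OF b] by (simp add: nth_mark_ends)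
    next
      case 3
      then obtain u' where u': "u = ?w a @ u'" "concat (map ?w bs) = u' @ ?w b @ v"
        using eq by (auto simp: append_eq_append_conv_if) (metis append_take_drop_id length_mark_ends)
      then obtain ys zs where "bs = ys @ b # zs \<and> u' = concat (map ?w ys) \<and> v = concat (map ?w zs)"
        using Cons.IH[of u'] Cons.prems by auto
      then show ?thesis
        using u' by (intro exI[of _ "a # ys"] exI[of _ zs]) simp
    qed
  qed
qed

text \<open>
  Both ends are \<open>True\<close> and at least one \<open>False\<close> lies in between, so two adjacent occurrences of
  \<open>True\<close> mark the boundary between two code words.
\<close>

definition comma_word :: "nat \<Rightarrow> bool list"
  where "comma_word k = True # replicate (Suc k) False @ [True]"

lemma replicate_False_cancel:
  "replicate m False @ True # xs = replicate n False @ True # ys \<Longrightarrow> m = n \<and> xs = ys"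
proof (induction m arbitrary: n)
  case 0
  then show ?case by (cases n) auto
next
  case (Suc m)
  then show ?case by (cases n) auto
qed

lemma synchronized_comma_word: "synchronized UNIV comma_word"
  unfolding synchronized_def
proof (intro conjI ballI allI impI)
  show "comma_word k \<noteq> []" for k
    by (simp add: comma_word_def)
  fix k bs u v assume "concat (map comma_word bs) = u @ comma_word k @ v"
  then show "\<exists>ys zs. bs = ys @ k # zs \<and> u = concat (map comma_word ys) \<and> v = concat (map comma_word zs)"
  proof (induction bs arbitrary: u)
    case Nil
    then show ?case by (simp add: comma_word_def)
  next
    case (Cons a bs)
    let ?r = "concat (map comma_word bs)"
    have eq: "True # replicate (Suc a) False @ True # ?r = u @ comma_word k @ v"
      using Cons.prems by (simp add: comma_word_def[of a])
    show ?case
    proof (cases u)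
      case Nil
      then have "replicate (Suc a) False @ True # ?r = replicate (Suc k) False @ True # v"
        using eq by (simp add: comma_word_def)
      then have "a = k" "?r = v"
        using replicate_False_cancel by blast+
      then show ?thesis
        using Nil by (intro exI[of _ "[]"] exI[of _ bs]) simp
    next
      case (Cons x u1)
      then have eq1: "replicate (Suc a) False @ True # ?r = u1 @ True # False # replicate k False @ True # v"
        and x: "x = True"
        using eq by (simp_all add: comma_word_def)
      have not_True: "True \<notin> set (replicate (Suc a) False)"
        by simp
      obtain u2 where u2: "u1 = replicate (Suc a) False @ u2"
        "True # ?r = u2 @ True # False # replicate k False @ True # v"
      proof -
        consider us where "replicate (Suc a) False = u1 @ us"
            "us @ True # ?r = True # False # replicate k False @ True # v"
          | us where "u1 = replicate (Suc a) False @ us"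
            "True # ?r = us @ True # False # replicate k False @ True # v"
          using eq1 unfolding append_eq_append_conv2 by blast
        then show thesis
        proof cases
          case 1
          have "us = []"
          proof (cases us)
            case (Cons y ys)
            then have "True \<in> set (u1 @ us)" using 1(2) by simp
            then show ?thesis using not_True 1(1) by metis
          qed
          then show thesis
            using that[of "[]"] 1 by simp
        next
          case 2
          then show thesis by (rule that)
        qed
      qed
      show ?thesis
      proof (cases u2)
        case Nil
        then have "?r = False # replicate k False @ True # v"
          using u2 by simp
        then show ?thesis
          by (cases bs) (auto simp: comma_word_def)
      next
        case (Cons y u3)
        then have "?r = u3 @ comma_word k @ v" and y: "y = True"
          using u2 by (simp_all add: comma_word_def)
        then obtain ys zs where "bs = ys @ k # zs \<and> u3 = concat (map comma_word ys) \<and>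
            v = concat (map comma_word zs)"
          using Cons.IH by blast
        moreover have "u = comma_word a @ u3"
          using \<open>u = x # u1\<close> x u2 Cons y by (simp add: comma_word_def)
        ultimately show ?thesis
          by (intro exI[of _ "a # ys"] exI[of _ zs]) simp
      qed
    qed
  qed
qed

text \<open>
  Tameness enters only here: the basis elements of weight \<open>n\<close> number at most \<open>c ^ n \<le> K ^ n\<close>, so they
  can be named by distinct words of length \<open>n\<close> over \<open>K\<close> letters. The hypothesis \<open>\<chi> 0 = {0}\<close> excludes
  basis elements of weight zero, which would need the empty word.
\<close>

lemma tame_coding:
  fixes scale :: "'f::field \<Rightarrow> 'h::ab_group_add \<Rightarrow> 'h"
  assumes H: "lie_algebra scale H br" "lie_filtration scale H br \<chi>" and "\<chi> 0 = {0}" "tame scale \<chi>"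
  obtains B and word :: "'h \<Rightarrow> (nat \<times> bool \<times> bool) list" and \<Lambda> where
    "\<not> module.dependent scale B" "\<And>n. module.span scale (B \<inter> \<chi> n) = \<chi> n" "B \<subseteq> H"
    "synchronized B word" "\<And>b. b \<in> B \<Longrightarrow> set (word b) \<subseteq> \<Lambda>" "finite \<Lambda>"
    "\<And>b n. b \<in> B \<Longrightarrow> b \<in> \<chi> n \<longleftrightarrow> length (word b) \<le> n"
proof -
  interpret lie_algebra scale H br by fact
  note filt = lie_filtrationD[OF H]
  obtain B where B: "independent B" "\<And>n. span (B \<inter> \<chi> n) = \<chi> n" "\<And>n. finite (B \<inter> \<chi> n)" "B \<subseteq> H"
    using adapted_basis[OF H] by metis
  define wt where "wt b = (LEAST n. b \<in> \<chi> n)" for b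
  have wt: "b \<in> \<chi> n \<longleftrightarrow> wt b \<le> n" if "b \<in> B" for b n
  proof
    show "b \<in> \<chi> n \<Longrightarrow> wt b \<le> n"
      unfolding wt_def by (rule Least_le)
    have "b \<in> (\<Union>n. \<chi> n)"
      using B(4) filt(7) that by auto
    then obtain m where "b \<in> \<chi> m"
      by blast
    then have "b \<in> \<chi> (wt b)"
      unfolding wt_def by (rule LeastI)
    then show "wt b \<le> n \<Longrightarrow> b \<in> \<chi> n"
      using filt(4) by blast
  qed
  have wt_pos: "wt b \<ge> 1" if "b \<in> B" for b
  proof -
    have "b \<noteq> 0"
      using B(1) that dependent_zero by blast
    then have "\<not> wt b \<le> 0"
      using wt[OF that, of 0] assms(3) by auto
    then show ?thesis by simp
  qed
  obtain c :: real where c: "c > 0" "\<And>n. n \<ge> 1 \<Longrightarrow> real (dim (\<chi> n)) < c ^ n"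
    using assms(4) unfolding tame_def by blast
  \<comment> \<open>an alphabet with \<open>K\<close> letters has at least \<open>c ^ n\<close> words of length \<open>n\<close>\<close>
  define K where "K = nat \<lceil>c\<rceil>"
  define lists_of where "lists_of n = {xs. set xs \<subseteq> {..<K} \<and> length xs = n}" for n
  have "\<forall>n. \<exists>f. f ` {b \<in> B. wt b = n} \<subseteq> lists_of n \<and> inj_on f {b \<in> B. wt b = n}"
  proof
    fix n
    show "\<exists>f. f ` {b \<in> B. wt b = n} \<subseteq> lists_of n \<and> inj_on f {b \<in> B. wt b = n}"
  proof (cases "n \<ge> 1")
    case True
    have sub: "{b \<in> B. wt b = n} \<subseteq> B \<inter> \<chi> n"
      using wt by auto
    have "independent (B \<inter> \<chi> n)"
      using B(1) independent_mono by blast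
    then have "card (B \<inter> \<chi> n) = dim (\<chi> n)"
      using B(2) by (intro basis_card_eq_dim) auto
    then have "real (card {b \<in> B. wt b = n}) \<le> real (dim (\<chi> n))"
      using card_mono[OF B(3) sub] by simp
    also have "\<dots> \<le> c ^ n"
      using c(2)[OF True] by simp
    also have "\<dots> \<le> real K ^ n"
      using c(1) by (intro power_mono) (auto simp: K_def)
    finally have "card {b \<in> B. wt b = n} \<le> card (lists_of n)"
      by (simp add: lists_of_def card_lists_length_eq flip: of_nat_power)
    then show ?thesis
      using card_le_inj[OF finite_subset[OF sub B(3)], of "lists_of n"] finite_lists_length_eq
      by (auto simp: lists_of_def)
  next
    case False
    then have "{b \<in> B. wt b = n} = {}"
      using wt_pos by auto
    then show ?thesis by (simp only: image_empty inj_on_empty) simp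
  qed
  qed
  from choice[OF this] obtain f where f: "f n ` {b \<in> B. wt b = n} \<subseteq> lists_of n"
    "inj_on (f n) {b \<in> B. wt b = n}" for n
    by blast
  define code where "code b = f (wt b) b" for b
  have code: "code b \<in> lists_of (wt b)" if "b \<in> B" for b
    using f(1)[of "wt b"] that by (auto simp: code_def)
  have "inj_on code B"
  proof (rule inj_onI)
    fix a b assume ab: "a \<in> B" "b \<in> B" "code a = code b"
    then have "wt a = wt b"
      using code[of a] code[of b] by (simp add: lists_of_def)
    then show "a = b"
      using ab inj_onD[OF f(2)[of "wt b"]] by (simp add: code_def)
  qed
  moreover have "code b \<noteq> []" if "b \<in> B" for b
    using code[OF that] wt_pos[OF that] by (auto simp: lists_of_def)
  ultimately have sync: "synchronized B (\<lambda>b. mark_ends (code b))"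
    by (rule synchronized_mark_ends)
  show thesis
  proof (rule that[OF B(1,2,4) sync])
    show "set (mark_ends (code b)) \<subseteq> {..<K} \<times> UNIV" if "b \<in> B" for b
      using code[OF that] set_mark_ends[of "code b"] by (auto simp: lists_of_def)
    show "finite ({..<K} \<times> (UNIV :: (bool \<times> bool) set))"
      by simp
    show "b \<in> \<chi> n \<longleftrightarrow> length (mark_ends (code b)) \<le> n" if "b \<in> B" for b n
      using wt[OF that] code[OF that] by (simp add: lists_of_def)
  qed
qed

lemma binary_coding:
  fixes word :: "'b \<Rightarrow> ('v::countable) list"
  assumes "synchronized B word" "\<And>b. b \<in> B \<Longrightarrow> set (word b) \<subseteq> \<Lambda>" "finite \<Lambda>"
  obtains word' :: "'b \<Rightarrow> bool list" and t where "synchronized B word'" "t > 0"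
    "\<And>b. b \<in> B \<Longrightarrow> length (word b) \<le> length (word' b)"
    "\<And>b. b \<in> B \<Longrightarrow> length (word' b) \<le> t * length (word b)"
proof -
  define f :: "'v \<Rightarrow> bool list" where "f = (\<lambda>l. comma_word (to_nat l))"
  have f: "synchronized UNIV f"
  proof -
    have "synchronized UNIV (\<lambda>l :: 'v. concat (map comma_word [to_nat l]))"
    proof (rule synchronized_compose[OF _ synchronized_comma_word])
      show "synchronized UNIV (\<lambda>l :: 'v. [to_nat l])"
        unfolding synchronized_def
      proof (intro conjI ballI allI impI)
        fix l :: 'v and bs :: "'v list" and u v
        assume eq: "concat (map (\<lambda>l. [to_nat l]) bs) = u @ [to_nat l] @ v"
        have single: "concat (map (\<lambda>l. [g l]) xs) = map g xs" for g :: "'v \<Rightarrow> nat" and xs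
          by (induction xs) auto
        from eq have "map to_nat bs = u @ to_nat l # v"
          by (simp add: single)
        then show "\<exists>ys zs. bs = ys @ l # zs \<and> u = concat (map (\<lambda>l. [to_nat l]) ys) \<and>
            v = concat (map (\<lambda>l. [to_nat l]) zs)"
          unfolding single by (auto simp: map_eq_append_conv map_eq_Cons_conv)
      qed simp
    qed simp
    then show ?thesis by (simp add: f_def)
  qed
  \<comment> \<open>any bound on the lengths of the letter codes works; \<open>Suc\<close> makes it positive\<close>
  define t where "t = Suc (\<Sum>l\<in>\<Lambda>. length (f l))"
  have upper: "length (f l) \<le> t" if "l \<in> \<Lambda>" for l
    using member_le_sum[OF that, of "\<lambda>l. length (f l)"] assms(3) by (simp add: t_def)
  have lower: "1 \<le> length (f l)" for l
    by (simp add: f_def comma_word_def)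
  have "length xs \<le> length (concat (map f xs)) \<and> (set xs \<subseteq> \<Lambda> \<longrightarrow> length (concat (map f xs)) \<le> t * length xs)" for xs
  proof (induction xs)
    case (Cons x xs)
    then show ?case
      using upper[of x] lower[of x] by (auto simp: algebra_simps)
  qed simp
  then show thesis
    using that[of "\<lambda>b. concat (map f (word b))" t] synchronized_compose[OF assms(1) f] assms(2)
    by (simp add: t_def)
qed

section \<open>Lie algebra valued functions on words\<close>

definition scale_fun :: "('f \<Rightarrow> 'a \<Rightarrow> 'a) \<Rightarrow> 'f \<Rightarrow> ('x \<Rightarrow> 'a) \<Rightarrow> 'x \<Rightarrow> 'a"
  where "scale_fun s c f = (\<lambda>x. s c (f x))"

lemma scale_fun_apply [simp]: "scale_fun s c f x = s c (f x)"
  by (simp add: scale_fun_def)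

lemma vector_space_scale_fun:
  assumes "vector_space s"
  shows "vector_space (scale_fun s)"
proof -
  interpret vector_space s by fact
  show ?thesis
    by unfold_locales (simp_all add: scale_fun_def fun_eq_iff scale_right_distrib scale_left_distrib)
qed

definition scale_pair ::
  "('f \<Rightarrow> 'a \<Rightarrow> 'a) \<Rightarrow> ('f \<Rightarrow> 'b \<Rightarrow> 'b) \<Rightarrow> 'f \<Rightarrow> 'a \<times> 'b \<Rightarrow> 'a \<times> 'b"
  where "scale_pair s t c = map_prod (s c) (t c)"

lemma vector_space_scale_pair:
  assumes "vector_space s" "vector_space t"
  shows "vector_space (scale_pair s t)"
proof -
  interpret s: vector_space s by fact
  interpret t: vector_space t by fact
  show ?thesis
    by unfold_locales (auto simp: scale_pair_def s.scale_right_distrib s.scale_left_distrib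
        t.scale_right_distrib t.scale_left_distrib)
qed

text \<open>
  Elements of the semidirect product of the maps on words with operators on these maps.
\<close>

type_synonym ('v, 'a) wreath = "('v list \<Rightarrow> 'a) \<times> (('v list \<Rightarrow> 'a) \<Rightarrow> 'v list \<Rightarrow> 'a)"

definition shift :: "'v \<Rightarrow> ('v list \<Rightarrow> 'a) \<Rightarrow> 'v list \<Rightarrow> 'a"
  where "shift j f = (\<lambda>w. f (j # w))"

lemma shift_apply [simp]: "shift j f w = f (j # w)"
  by (simp add: shift_def)

lemma shift_add: "shift j (f + g) = shift j f + shift j g"
  and shift_scale: "shift j (scale_fun s c f) = scale_fun s c (shift j f)"
  by (auto simp: fun_eq_iff scale_fun_def)

text \<open>
  At a word \<open>w\<close> this is the sum of \<open>b (f w') (g w'')\<close> over all ways to split \<open>w\<close> into two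
  complementary subwords: the bracket of \<open>H\<close> convolved with the coproduct dual to the shuffle
  product. The recursion says that every shift is a derivation, which drives all proofs
  below by induction on the word.
\<close>

fun shuffle_br :: "('a::plus \<Rightarrow> 'a \<Rightarrow> 'a) \<Rightarrow> ('v list \<Rightarrow> 'a) \<Rightarrow> ('v list \<Rightarrow> 'a) \<Rightarrow> 'v list \<Rightarrow> 'a" where
  "shuffle_br b f g [] = b (f []) (g [])"
| "shuffle_br b f g (j # w) = shuffle_br b (shift j f) g w + shuffle_br b f (shift j g) w"

lemma shift_shuffle_br:
  "shift j (shuffle_br b f g) = shuffle_br b (shift j f) g + shuffle_br b f (shift j g)"
  by (simp add: fun_eq_iff)

text \<open>
  For a one-letter alphabet this is \<open>h\<close> times the \<open>n\<close>-th divided power of the variable. For \<open>n = 0\<close>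
  and any alphabet it is the constant \<open>h\<close>.
\<close>

definition delta_map :: "nat \<Rightarrow> 'a::zero \<Rightarrow> 'v list \<Rightarrow> 'a"
  where "delta_map n h w = (if length w = n then h else 0)"

abbreviation const_map :: "'a::zero \<Rightarrow> 'v list \<Rightarrow> 'a"
  where "const_map \<equiv> delta_map 0"

lemma shift_delta_map: "shift j (delta_map (Suc n) h) = delta_map n h"
  and shift_const_map: "shift j (const_map h) = 0"
  by (auto simp: fun_eq_iff delta_map_def)

context lie_algebra
begin

abbreviation sbr :: "('v list \<Rightarrow> 'a) \<Rightarrow> ('v list \<Rightarrow> 'a) \<Rightarrow> 'v list \<Rightarrow> 'a"
  where "sbr \<equiv> shuffle_br br"

lemmas carrier_add = subspace_add[OF subspace_carrier]
  and carrier_diff = subspace_diff[OF subspace_carrier]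
  and carrier_scale = subspace_scale[OF subspace_carrier]
  and carrier_0 = subspace_0[OF subspace_carrier]

definition maps :: "('v list \<Rightarrow> 'a) set"
  where "maps = {f. \<forall>w. f w \<in> L}"

lemma maps_apply: "f \<in> maps \<Longrightarrow> f w \<in> L"
  by (simp add: maps_def)

lemma maps_shift: "f \<in> maps \<Longrightarrow> shift j f \<in> maps"
  and maps_add: "\<lbrakk>f \<in> maps; g \<in> maps\<rbrakk> \<Longrightarrow> f + g \<in> maps"
  and maps_diff: "\<lbrakk>f \<in> maps; g \<in> maps\<rbrakk> \<Longrightarrow> f - g \<in> maps"
  and maps_scale: "f \<in> maps \<Longrightarrow> scale_fun scale c f \<in> maps"
  and maps_0: "0 \<in> maps"
  and maps_delta_map: "h \<in> L \<Longrightarrow> delta_map n h \<in> maps"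
  by (auto simp: maps_def scale_fun_def delta_map_def carrier_add carrier_diff carrier_scale carrier_0)

lemma shuffle_br_closed: "\<lbrakk>f \<in> maps; g \<in> maps\<rbrakk> \<Longrightarrow> sbr f g \<in> maps"
proof -
  have "sbr f g w \<in> L" if "f \<in> maps" "g \<in> maps" for f g w
    using that
    by (induction w arbitrary: f g) (auto simp: maps_apply br_closed maps_shift carrier_add)
  then show "\<lbrakk>f \<in> maps; g \<in> maps\<rbrakk> \<Longrightarrow> sbr f g \<in> maps"
    unfolding maps_def by blast
qed

lemma shuffle_br_add_left:
  assumes "f \<in> maps" "g \<in> maps" "h \<in> maps"
  shows "sbr (f + g) h = sbr f h + sbr g h"
proof
  show "sbr (f + g) h w = (sbr f h + sbr g h) w" for w
    using assms
    by (induction w arbitrary: f g h)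
      (simp_all add: br_add_left maps_apply shift_add maps_shift add_ac)
qed

lemma shuffle_br_add_right:
  assumes "f \<in> maps" "g \<in> maps" "h \<in> maps"
  shows "sbr f (g + h) = sbr f g + sbr f h"
proof
  show "sbr f (g + h) w = (sbr f g + sbr f h) w" for w
    using assms
    by (induction w arbitrary: f g h)
      (simp_all add: br_add_right maps_apply shift_add maps_shift add_ac)
qed

lemma shuffle_br_scale_left:
  assumes "f \<in> maps" "g \<in> maps"
  shows "sbr (scale_fun scale c f) g = scale_fun scale c (sbr f g)"
proof
  show "sbr (scale_fun scale c f) g w = scale_fun scale c (sbr f g) w" for w
    using assms
    by (induction w arbitrary: f g)
      (simp_all add: br_scale_left maps_apply shift_scale maps_shift scale_right_distrib)
qed

lemma shuffle_br_scale_right: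
  assumes "f \<in> maps" "g \<in> maps"
  shows "sbr f (scale_fun scale c g) = scale_fun scale c (sbr f g)"
proof
  show "sbr f (scale_fun scale c g) w = scale_fun scale c (sbr f g) w" for w
    using assms
    by (induction w arbitrary: f g)
      (simp_all add: br_scale_right maps_apply shift_scale maps_shift scale_right_distrib)
qed

lemma shuffle_br_0_left: "g \<in> maps \<Longrightarrow> sbr 0 g = 0"
  and shuffle_br_0_right: "f \<in> maps \<Longrightarrow> sbr f 0 = 0"
proof -
  have zero: "scale_fun scale 0 f = 0" for f :: "'v list \<Rightarrow> 'a"
    by (simp add: fun_eq_iff)
  show "g \<in> maps \<Longrightarrow> sbr 0 g = 0" "f \<in> maps \<Longrightarrow> sbr f 0 = 0"
    using shuffle_br_scale_left[of g g 0] shuffle_br_scale_right[of f f 0] by (simp_all add: zero)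
qed

lemma shuffle_br_anticomm:
  assumes "f \<in> maps" "g \<in> maps"
  shows "sbr g f = - sbr f g"
proof
  show "sbr g f w = (- sbr f g) w" for w
    using assms
  proof (induction w arbitrary: f g)
    case Nil
    then show ?case by (simp add: br_anticomm[of "f []" "g []"] maps_apply)
  next
    case (Cons j w)
    have "sbr (shift j g) f w = - sbr f (shift j g) w"
      "sbr g (shift j f) w = - sbr (shift j f) g w"
      using Cons.IH[OF Cons.prems(1) maps_shift[OF Cons.prems(2)]]
        Cons.IH[OF maps_shift[OF Cons.prems(1)] Cons.prems(2)]
      by (simp_all only: uminus_apply)
    then show ?case by simp
  qed
qed

lemma shuffle_br_self: "f \<in> maps \<Longrightarrow> sbr f f = 0"
proof
  show "sbr f f w = 0 w" if "f \<in> maps" for w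
    using that
  proof (induction w arbitrary: f)
    case Nil
    then show ?case by (simp add: br_self maps_apply)
  next
    case (Cons j w)
    then show ?case
      using shuffle_br_anticomm[of "shift j f" f] by (simp add: maps_shift)
  qed
qed

text \<open>
  The value of the Jacobi expression at \<open>j # w\<close> is the sum of three Jacobi expressions at \<open>w\<close>, in
  each of which one argument has been shifted.
\<close>

lemma shuffle_br_jacobi:
  assumes "f \<in> maps" "g \<in> maps" "h \<in> maps"
  shows "sbr f (sbr g h) + sbr g (sbr h f) +
    sbr h (sbr f g) = 0"
proof
  show "(sbr f (sbr g h) + sbr g (sbr h f) +
    sbr h (sbr f g)) w = 0 w" for w
    using assms
  proof (induction w arbitrary: f g h)
    case Nil
    then show ?case by (simp add: jacobi maps_apply)
  next
    case (Cons j w)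
    have "(sbr f (sbr g h) + sbr g (sbr h f) +
        sbr h (sbr f g)) (j # w) =
      (sbr (shift j f) (sbr g h) + sbr g (sbr h (shift j f)) +
        sbr h (sbr (shift j f) g)) w +
      (sbr f (sbr (shift j g) h) + sbr (shift j g) (sbr h f) +
        sbr h (sbr f (shift j g))) w +
      (sbr f (sbr g (shift j h)) + sbr g (sbr (shift j h) f) +
        sbr (shift j h) (sbr f g)) w"
      using Cons.prems
      by (simp add: shift_shuffle_br shuffle_br_add_right shuffle_br_closed maps_shift add_ac)
    also have "\<dots> = 0"
      using Cons.prems by (simp only: Cons.IH maps_shift) simp
    finally show ?case by simp
  qed
qed

text \<open>
  Constants are killed by every shift, so all letters of the word go to the other factor.
\<close>

lemma shuffle_br_const_map:
  assumes "h \<in> L" "f \<in> maps"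
  shows "sbr (const_map h) f w = br h (f w)"
  using assms(2)
proof (induction w arbitrary: f)
  case Nil
  then show ?case by (simp add: delta_map_def)
next
  case (Cons j w)
  have "sbr 0 f w = 0"
    using Cons.prems by (simp add: shuffle_br_0_left)
  moreover have "sbr (const_map h) (shift j f) w = br h (shift j f w)"
    by (rule Cons.IH[OF maps_shift[OF Cons.prems]])
  ultimately show ?case
    by (simp add: shift_const_map)
qed

text \<open>
  The Leibniz rule is required only for maps with values in \<open>L\<close>, where the bracket is bilinear;
  linearity holds on all maps, which keeps sums and commutators of derivations inside the set.
\<close>

definition derivations :: "(('v list \<Rightarrow> 'a) \<Rightarrow> 'v list \<Rightarrow> 'a) set"
  where "derivations = {T. (\<forall>f g. T (f + g) = T f + T g) \<and>
    (\<forall>c f. T (scale_fun scale c f) = scale_fun scale c (T f)) \<and>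
    (\<forall>f\<in>maps. T f \<in> maps) \<and>
    (\<forall>f\<in>maps. \<forall>g\<in>maps.
      T (sbr f g) = sbr (T f) g + sbr f (T g))}"

lemma derivation_simps:
  assumes "T \<in> derivations"
  shows derivation_add: "T (f + g) = T f + T g"
    and derivation_diff: "T (f - g) = T f - T g"
    and derivation_scale: "T (scale_fun scale c f) = scale_fun scale c (T f)"
    and derivation_closed: "f \<in> maps \<Longrightarrow> T f \<in> maps"
    and derivation_shuffle_br: "\<lbrakk>f \<in> maps; g \<in> maps\<rbrakk> \<Longrightarrow>
      T (sbr f g) = sbr (T f) g + sbr f (T g)"
proof -
  show add: "T (f + g) = T f + T g" for f g
    using assms by (simp add: derivations_def)
  show "T (f - g) = T f - T g"
    using add[of "f - g" g] by (simp add: algebra_simps)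
qed (use assms in \<open>simp_all add: derivations_def\<close>)

definition scale_wreath ::
    "'f \<Rightarrow> ('v, 'a) wreath \<Rightarrow> _"
  where "scale_wreath = scale_pair (scale_fun scale) (scale_fun (scale_fun scale))"

text \<open>
  The bracket of the semidirect product of the maps with their derivations.
\<close>

fun wreath_br :: "('v, 'a) wreath \<Rightarrow> _ \<Rightarrow> _"
  where "wreath_br (f, T) (g, S) = (sbr f g + T g - S f, (\<lambda>h. T (S h) - S (T h)))"

lemma shift_derivation: "shift j \<in> derivations"
  by (simp add: derivations_def shift_add shift_scale maps_shift shift_shuffle_br)

lemma zero_derivation: "0 \<in> derivations"
  by (auto simp: derivations_def maps_0 shuffle_br_0_left shuffle_br_0_right fun_eq_iff)

lemma derivation_commutator:
  fixes T S :: "('v list \<Rightarrow> 'a) \<Rightarrow> 'v list \<Rightarrow> 'a"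
  assumes T: "T \<in> derivations" and S: "S \<in> derivations"
  shows "(\<lambda>h. T (S h) - S (T h)) \<in> derivations"
  unfolding derivations_def
proof (intro CollectI conjI ballI allI)
  fix f g :: "'v list \<Rightarrow> 'a"
  assume fg: "f \<in> maps" "g \<in> maps"
  have "sbr (a - b) c = sbr a c - sbr b c"
    "sbr c (a - b) = sbr c a - sbr c b"
    if "a \<in> maps" "b \<in> maps" "c \<in> maps" for a b c :: "'v list \<Rightarrow> 'a"
    using shuffle_br_add_left[of "a - b" b c] shuffle_br_add_right[of c "a - b" b] that
    by (simp_all add: maps_diff)
  then show "T (S (sbr f g)) - S (T (sbr f g)) =
      sbr (T (S f) - S (T f)) g + sbr f (T (S g) - S (T g))"
    using fg by (simp add: derivation_shuffle_br[OF T] derivation_shuffle_br[OF S]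
        derivation_closed[OF T] derivation_closed[OF S] derivation_add[OF S] derivation_add[OF T]
        shuffle_br_closed algebra_simps)
next
  fix c and f :: "'v list \<Rightarrow> 'a"
  show "T (S (scale_fun scale c f)) - S (T (scale_fun scale c f)) =
      scale_fun scale c (T (S f) - S (T f))"
    by (simp add: derivation_scale[OF T] derivation_scale[OF S])
      (simp add: fun_eq_iff scale_right_diff_distrib)
qed (simp_all add: derivation_add[OF T] derivation_add[OF S] derivation_closed[OF T]
    derivation_closed[OF S] maps_diff algebra_simps)

lemma derivations_subspace:
  "module.subspace (scale_fun (scale_fun scale)) (derivations :: (('v list \<Rightarrow> 'a) \<Rightarrow> _) set)"
proof -
  interpret O: vector_space "scale_fun (scale_fun scale) :: _ \<Rightarrow> (('v list \<Rightarrow> 'a) \<Rightarrow> 'v list \<Rightarrow> 'a) \<Rightarrow> _"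
    by (intro vector_space_scale_fun vector_space_axioms)
  show ?thesis
  proof (rule O.subspaceI[OF zero_derivation])
    fix S T :: "('v list \<Rightarrow> 'a) \<Rightarrow> 'v list \<Rightarrow> 'a"
    assume T: "S \<in> derivations" "T \<in> derivations"
    show "S + T \<in> derivations"
      unfolding derivations_def
      using derivation_simps[OF T(1)] derivation_simps[OF T(2)]
      by (auto simp: maps_add shuffle_br_add_left shuffle_br_add_right fun_eq_iff
          scale_right_distrib)
  next
    fix c and T :: "('v list \<Rightarrow> 'a) \<Rightarrow> 'v list \<Rightarrow> 'a"
    assume T: "T \<in> derivations"
    interpret V: vector_space "scale_fun scale :: _ \<Rightarrow> ('v list \<Rightarrow> 'a) \<Rightarrow> _"
      by (intro vector_space_scale_fun vector_space_axioms)
    show "scale_fun (scale_fun scale) c T \<in> derivations"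
      unfolding derivations_def scale_fun_def[of "scale_fun scale"]
      using derivation_simps[OF T]
      by (auto simp: maps_scale shuffle_br_scale_left shuffle_br_scale_right V.scale_right_distrib
          mult.commute)
  qed
qed

lemma wreath_lie_algebra:
  "lie_algebra scale_wreath ((maps :: ('v list \<Rightarrow> 'a) set) \<times> derivations) wreath_br"
proof -
  interpret V: vector_space "scale_fun scale :: _ \<Rightarrow> ('v list \<Rightarrow> 'a) \<Rightarrow> _"
    by (intro vector_space_scale_fun vector_space_axioms)
  interpret O: vector_space "scale_fun (scale_fun scale) :: _ \<Rightarrow> (('v list \<Rightarrow> 'a) \<Rightarrow> 'v list \<Rightarrow> 'a) \<Rightarrow> _"
    by (intro vector_space_scale_fun vector_space_axioms)
  interpret W: vector_space "scale_wreath :: _ \<Rightarrow> ('v list \<Rightarrow> 'a) \<times> _ \<Rightarrow> _"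
    unfolding scale_wreath_def
    by (intro vector_space_scale_pair V.vector_space_axioms O.vector_space_axioms)
  have O_apply: "scale_fun (scale_fun scale) c T h = scale_fun scale c (T h)"
    for c and T :: "('v list \<Rightarrow> 'a) \<Rightarrow> 'v list \<Rightarrow> 'a" and h
    by (simp add: scale_fun_def)
  note rules = shuffle_br_closed maps_add maps_diff shuffle_br_add_left shuffle_br_add_right
    shuffle_br_scale_left shuffle_br_scale_right shuffle_br_self
    O.subspace_add[OF derivations_subspace] O.subspace_scale[OF derivations_subspace]
  have sub: "W.subspace (maps \<times> derivations)"
    by (rule W.subspaceI) (auto simp: zero_prod_def scale_wreath_def scale_pair_def maps_0 rules
        maps_scale zero_derivation)
  show ?thesis
  proof (unfold_locales, goal_cases)
    case 1
    show ?case by (rule sub)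
  next
    case (2 x y)
    then obtain f T g S where xy: "x = (f, T)" "y = (g, S)"
      and mem: "f \<in> maps" "g \<in> maps" and T: "T \<in> derivations" and S: "S \<in> derivations"
      by auto
    show ?case
      using mem derivation_simps[OF T] derivation_simps[OF S] derivation_commutator[OF T S]
      by (simp add: xy rules)
  next
    case (3 x y z)
    then obtain f T g S h U where xyz: "x = (f, T)" "y = (g, S)" "z = (h, U)"
      and mem: "f \<in> maps" "g \<in> maps" "h \<in> maps"
      and T: "T \<in> derivations" and S: "S \<in> derivations" and U: "U \<in> derivations"
      by auto
    show ?case
      using mem derivation_simps[OF U] by (simp add: xyz rules) (simp add: fun_eq_iff)
  next
    case (4 x y z)
    then obtain f T g S h U where xyz: "x = (f, T)" "y = (g, S)" "z = (h, U)"
      and mem: "f \<in> maps" "g \<in> maps" "h \<in> maps"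
      and T: "T \<in> derivations" and S: "S \<in> derivations" and U: "U \<in> derivations"
      by auto
    show ?case
      using mem derivation_simps[OF T] by (simp add: xyz rules) (simp add: fun_eq_iff)
  next
    case (5 x y c)
    then obtain f T g S where xy: "x = (f, T)" "y = (g, S)"
      and mem: "f \<in> maps" "g \<in> maps" and T: "T \<in> derivations" and S: "S \<in> derivations"
      by auto
    show ?case
      using mem derivation_simps[OF S]
      by (simp add: xy rules scale_wreath_def scale_pair_def O_apply)
        (simp add: fun_eq_iff scale_right_distrib scale_right_diff_distrib)
  next
    case (6 x y c)
    then obtain f T g S where xy: "x = (f, T)" "y = (g, S)"
      and mem: "f \<in> maps" "g \<in> maps" and T: "T \<in> derivations" and S: "S \<in> derivations"
      by auto
    show ?case
      using mem derivation_simps[OF T]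
      by (simp add: xy rules scale_wreath_def scale_pair_def O_apply)
        (simp add: fun_eq_iff scale_right_distrib scale_right_diff_distrib)
  next
    case (7 x)
    then show ?case by (auto simp: rules zero_prod_def fun_eq_iff)
  next
    case (8 x y z)
    then obtain f T g S h U where xyz: "x = (f, T)" "y = (g, S)" "z = (h, U)"
      and mem: "f \<in> maps" "g \<in> maps" "h \<in> maps"
      and T: "T \<in> derivations" and S: "S \<in> derivations" and U: "U \<in> derivations"
      by auto
    note der = derivation_simps[OF T] derivation_simps[OF S] derivation_simps[OF U]
    have diff: "sbr c (a - b) = sbr c a - sbr c b"
      if "a \<in> maps" "b \<in> maps" "c \<in> maps" for a b c :: "'v list \<Rightarrow> 'a"
      using shuffle_br_add_right[of c "a - b" b] that by (simp_all add: maps_diff)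
    have anti: "sbr (S h) f = - sbr f (S h)"
      "sbr (T g) h = - sbr h (T g)"
      "sbr (U f) g = - sbr g (U f)"
      using mem by (auto intro!: shuffle_br_anticomm der)
    have "fst (wreath_br x (wreath_br y z) + wreath_br y (wreath_br z x) + wreath_br z (wreath_br x y))
        = sbr f (sbr g h) + sbr g (sbr h f) +
          sbr h (sbr f g)"
      using mem by (simp add: xyz rules diff der anti)
    also have "\<dots> = 0"
      by (rule shuffle_br_jacobi[OF mem(1-3)])
    finally have "fst (wreath_br x (wreath_br y z) + wreath_br y (wreath_br z x) +
        wreath_br z (wreath_br x y)) = 0" .
    moreover have "snd (wreath_br x (wreath_br y z) + wreath_br y (wreath_br z x) +
        wreath_br z (wreath_br x y)) = 0"
      by (simp add: xyz der fun_eq_iff)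
    ultimately show ?case
      by (simp add: prod_eq_iff)
  qed
qed

end

locale filtered_lie_algebra = lie_algebra scale L br
  for scale :: "'f::field \<Rightarrow> 'a::ab_group_add \<Rightarrow> 'a" and L br +
  fixes \<chi> :: "nat \<Rightarrow> 'a set"
  assumes filt_subspace: "subspace (\<chi> n)"
    and filt_carrier: "\<chi> n \<subseteq> L"
    and filt_Suc: "\<chi> n \<subseteq> \<chi> (Suc n)"
    and filt_br: "\<lbrakk>x \<in> \<chi> k; y \<in> \<chi> l\<rbrakk> \<Longrightarrow> br x y \<in> \<chi> (k + l)"
begin

lemma filt_mono: "m \<le> n \<Longrightarrow> \<chi> m \<subseteq> \<chi> n"
  by (rule lift_Suc_mono_le[of \<chi>, OF filt_Suc])

lemmas filt_add = subspace_add[OF filt_subspace]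
  and filt_diff = subspace_diff[OF filt_subspace]
  and filt_scale = subspace_scale[OF filt_subspace]
  and filt_0 = subspace_0[OF filt_subspace]

text \<open>
  The parameter \<open>\<omega>\<close> is the weight of a letter, which a shift consumes: with \<open>\<omega> = 1\<close> shifts
  have degree one, with \<open>\<omega> = 0\<close> they have degree zero and only the values of maps are filtered.
\<close>

definition map_filt :: "nat \<Rightarrow> nat \<Rightarrow> ('v list \<Rightarrow> 'a) set"
  where "map_filt \<omega> n = {f. \<forall>w. f w \<in> \<chi> (n + \<omega> * length w)}"

definition wreath_filt ::
    "nat \<Rightarrow> nat \<Rightarrow> ('v, 'a) wreath set"
  where "wreath_filt \<omega> n = map_filt \<omega> n \<times>
    {T \<in> derivations. \<forall>m. \<forall>g\<in>map_filt \<omega> m. T g \<in> map_filt \<omega> (n + m)}"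

lemma map_filt_maps: "f \<in> map_filt \<omega> n \<Longrightarrow> f \<in> maps"
  using filt_carrier by (auto simp: map_filt_def maps_def)

lemma map_filt_add: "\<lbrakk>f \<in> map_filt \<omega> n; g \<in> map_filt \<omega> n\<rbrakk> \<Longrightarrow> f + g \<in> map_filt \<omega> n"
  and map_filt_diff: "\<lbrakk>f \<in> map_filt \<omega> n; g \<in> map_filt \<omega> n\<rbrakk> \<Longrightarrow> f - g \<in> map_filt \<omega> n"
  and map_filt_scale: "f \<in> map_filt \<omega> n \<Longrightarrow> scale_fun scale c f \<in> map_filt \<omega> n"
  and map_filt_0: "0 \<in> map_filt \<omega> n"
  by (auto simp: map_filt_def filt_add filt_diff filt_scale filt_0)

lemma map_filt_mono: "m \<le> n \<Longrightarrow> map_filt \<omega> m \<subseteq> (map_filt \<omega> n :: ('v list \<Rightarrow> 'a) set)"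
proof
  fix f :: "'v list \<Rightarrow> 'a" assume mn: "m \<le> n" and f: "f \<in> map_filt \<omega> m"
  have "\<chi> (m + \<omega> * length w) \<subseteq> \<chi> (n + \<omega> * length w)" for w :: "'v list"
    using mn by (intro filt_mono) simp
  then show "f \<in> map_filt \<omega> n"
    using f unfolding map_filt_def by blast
qed

lemma map_filt_shift: "f \<in> map_filt \<omega> n \<Longrightarrow> shift j f \<in> map_filt \<omega> (\<omega> + n)"
proof -
  assume "f \<in> map_filt \<omega> n"
  then have "f (j # w) \<in> \<chi> (n + \<omega> * length (j # w))" for w
    unfolding map_filt_def by blast
  then show ?thesis by (simp add: map_filt_def add_ac)
qed

lemma map_filt_shuffle_br:
  assumes "f \<in> map_filt \<omega> k" "g \<in> map_filt \<omega> l"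
  shows "sbr f g \<in> map_filt \<omega> (k + l)"
proof -
  have "sbr f g w \<in> \<chi> (k + l + \<omega> * length w)" for w
    using assms
  proof (induction w arbitrary: f g k l)
    case Nil
    then have "f [] \<in> \<chi> k" "g [] \<in> \<chi> l"
      by (auto simp: map_filt_def dest: spec[of _ "[]"])
    then show ?case by (simp add: filt_br)
  next
    case (Cons j w)
    have "sbr (shift j f) g w \<in> \<chi> ((\<omega> + k) + l + \<omega> * length w)"
      "sbr f (shift j g) w \<in> \<chi> (k + (\<omega> + l) + \<omega> * length w)"
      by (rule Cons.IH[OF map_filt_shift[OF Cons.prems(1)] Cons.prems(2)])
        (rule Cons.IH[OF Cons.prems(1) map_filt_shift[OF Cons.prems(2)]])
    then show ?case
      by (simp add: add_ac filt_add)
  qed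
  then show ?thesis by (simp add: map_filt_def)
qed

text \<open>
  The term of index \<open>n\<close> allows derivations that raise the index of maps by at most \<open>n\<close>, so the filtration
  is multiplicative as soon as the bracket of maps respects the one on maps.
\<close>

lemma wreath_filtered_lie_algebra:
  "filtered_lie_algebra scale_wreath ((maps :: ('v list \<Rightarrow> 'a) set) \<times> derivations) wreath_br
    (wreath_filt \<omega>)"
proof -
  interpret W: lie_algebra scale_wreath "(maps :: ('v list \<Rightarrow> 'a) set) \<times> derivations" wreath_br
    by (rule wreath_lie_algebra)
  let ?P = "wreath_filt \<omega> :: nat \<Rightarrow> (('v, 'a) wreath) set"
  show ?thesis
  proof
    fix n
    show sub: "?P n \<subseteq> maps \<times> derivations"
      by (auto simp: wreath_filt_def map_filt_maps)
    show "W.subspace (?P n)"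
    proof (rule W.subspaceI)
      show "0 \<in> ?P n"
        using W.subspace_0[OF W.subspace_carrier] by (auto simp: wreath_filt_def zero_prod_def map_filt_0)
      show "x + y \<in> ?P n" if "x \<in> ?P n" "y \<in> ?P n" for x y
      proof -
        have "x + y \<in> maps \<times> derivations"
          by (rule W.subspace_add[OF W.subspace_carrier]) (use that sub in blast)+
        then show ?thesis
          using that by (cases x, cases y) (auto simp: wreath_filt_def map_filt_add)
      qed
      show "scale_wreath c x \<in> ?P n" if "x \<in> ?P n" for c x
      proof -
        have "scale_wreath c x \<in> maps \<times> derivations"
          by (rule W.subspace_scale[OF W.subspace_carrier]) (use that sub in blast)
        then show ?thesis
          using that by (cases x) (auto simp: wreath_filt_def scale_wreath_def scale_pair_def
            map_filt_scale scale_fun_def[of "scale_fun scale"])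
      qed
    qed
    show "?P n \<subseteq> ?P (Suc n)"
      using map_filt_mono[of "m" "Suc m" for m] by (fastforce simp: wreath_filt_def)
  next
    fix x y k l
    assume x: "x \<in> ?P k" and y: "y \<in> ?P l"
    obtain f T g S where xy: "x = (f, T)" "y = (g, S)"
      by (cases x, cases y) auto
    have "sbr f g \<in> map_filt \<omega> (k + l)" "T g \<in> map_filt \<omega> (k + l)"
      "S f \<in> map_filt \<omega> (l + k)"
      using x y map_filt_shuffle_br by (auto simp: xy wreath_filt_def)
    moreover have "(\<lambda>h. T (S h) - S (T h)) \<in> derivations"
      using x y derivation_commutator by (auto simp: xy wreath_filt_def)
    moreover have "T (S h) - S (T h) \<in> map_filt \<omega> (k + l + m)" if "h \<in> map_filt \<omega> m" for h m
    proof (rule map_filt_diff)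
      have "T (S h) \<in> map_filt \<omega> (k + (l + m))" "S (T h) \<in> map_filt \<omega> (l + (k + m))"
        using x y that by (auto simp: xy wreath_filt_def)
      then show "T (S h) \<in> map_filt \<omega> (k + l + m)" "S (T h) \<in> map_filt \<omega> (k + l + m)"
        by (simp_all add: add_ac)
    qed
    ultimately show "wreath_br x y \<in> ?P (k + l)"
      by (simp add: xy wreath_filt_def map_filt_add map_filt_diff add.commute[of l k])
  qed
qed

lemma shift_in_wreath_filt: "(0, shift j) \<in> wreath_filt \<omega> \<omega>"
  by (auto simp: wreath_filt_def map_filt_0 shift_derivation map_filt_shift)

lemma map_in_wreath_filt: "f \<in> map_filt \<omega> n \<Longrightarrow> (f, 0) \<in> wreath_filt \<omega> n"
  by (auto simp: wreath_filt_def zero_derivation map_filt_0)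

end

context lie_algebra
begin

text \<open>
  The copy of \<open>L\<close> inside the semidirect product.
\<close>

definition base :: "'a \<Rightarrow> ('v, 'a) wreath"
  where "base h = (const_map h, 0)"

lemma base_closed: "h \<in> L \<Longrightarrow> base h \<in> maps \<times> derivations"
  by (simp add: base_def maps_delta_map zero_derivation)

lemma wreath_br_maps:
  "wreath_br (f, 0) (g, 0) = (sbr f g, 0)"
  by (simp add: fun_eq_iff)

lemma wreath_br_shift: "f \<in> maps \<Longrightarrow> wreath_br (0, shift j) (f, 0) = (shift j f, 0)"
  by (simp add: shuffle_br_0_left) (simp add: fun_eq_iff)

lemma base_br: "\<lbrakk>h \<in> L; k \<in> L\<rbrakk> \<Longrightarrow> base (br h k) = wreath_br (base h) (base k)"
  unfolding base_def wreath_br_maps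
  by (simp add: fun_eq_iff shuffle_br_const_map maps_delta_map) (simp add: delta_map_def br_zero)

lemma base_add: "base (h + k) = base h + base k"
  and base_scale: "base (scale c h) = scale_wreath c (base h)"
  by (auto simp: base_def delta_map_def scale_wreath_def scale_pair_def fun_eq_iff)

lemma base_eq_iff: "base h = base k \<longleftrightarrow> h = k"
  by (auto simp: base_def delta_map_def fun_eq_iff dest: spec[of _ "[]"])

lemma base_embedding: "base ` L \<subseteq> G \<Longrightarrow> lie_embedding scale L br scale_wreath G wreath_br base"
  by (auto simp: lie_embedding_def inj_on_def base_eq_iff base_add base_scale base_br)

end

text \<open>
  The filtration of the semidirect product induces the given one on the constants. Together with
  \<open>degree_filtration_least\<close> this is how degrees of elements of \<open>L\<close> are bounded from below.
\<close>

lemma (in filtered_lie_algebra) base_in_wreath_filt: "base h \<in> wreath_filt \<omega> n \<longleftrightarrow> h \<in> \<chi> n"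
proof
  show "base h \<in> wreath_filt \<omega> n \<Longrightarrow> h \<in> \<chi> n"
    by (auto simp: base_def wreath_filt_def map_filt_def delta_map_def dest: spec[of _ "[]"])
  show "h \<in> \<chi> n \<Longrightarrow> base h \<in> wreath_filt \<omega> n"
    unfolding base_def
    by (rule map_in_wreath_filt) (auto simp: map_filt_def delta_map_def filt_0)
qed

section \<open>Realising a tame filtration in a finitely generated Lie algebra\<close>

locale coded_filtration = filtered_lie_algebra scale L br \<chi>
  for scale :: "'f::field \<Rightarrow> 'a::ab_group_add \<Rightarrow> 'a" and L br \<chi> +
  fixes B :: "'a set" and word :: "'a \<Rightarrow> 'v list" and \<Lambda> :: "'v set"
  assumes carrier_Union: "L = (\<Union>n. \<chi> n)"
    and span_basis: "\<chi> n = span (B \<inter> \<chi> n)"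
    and word_letters: "b \<in> B \<Longrightarrow> set (word b) \<subseteq> \<Lambda>"
    and word_nonempty: "b \<in> B \<Longrightarrow> word b \<noteq> []"
    and word_prefix_free: "\<lbrakk>b \<in> B; b' \<in> B; word b' = word b @ u\<rbrakk> \<Longrightarrow> b' = b"
    and word_length: "b \<in> B \<Longrightarrow> b \<in> \<chi> n \<longleftrightarrow> length (word b) \<le> n"
    and finite_letters: "finite \<Lambda>"
begin

text \<open>
  The generating function of the basis elements whose code word starts with \<open>l\<close>: the dual basis
  vector of \<open>v\<close> is multiplied with the basis element coded by \<open>l # v\<close>. Infinitely many
  basis elements are thereby packed into one element of degree one.
\<close>

definition letter_map :: "'v \<Rightarrow> 'v list \<Rightarrow> 'a"
  where "letter_map l v = (if \<exists>b\<in>B. word b = l # v then THE b. b \<in> B \<and> word b = l # v else 0)"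

lemma letter_map_word:
  assumes "b \<in> B" "word b = l # v"
  shows "letter_map l v = b"
proof -
  have "b' = b" if "b' \<in> B" "word b' = l # v" for b'
    by (rule word_prefix_free[OF assms(1) that(1), of "[]"]) (simp add: that(2) assms(2))
  then have "(THE b. b \<in> B \<and> word b = l # v) = b"
    by (intro the_equality) (use assms in blast)+
  moreover have "\<exists>b\<in>B. word b = l # v"
    using assms by blast
  ultimately show ?thesis
    unfolding letter_map_def by (simp only: if_True)
qed

lemma letter_map_no_word: "\<not> (\<exists>b\<in>B. word b = l # v) \<Longrightarrow> letter_map l v = 0"
  by (simp add: letter_map_def)

lemma letter_map_filt: "letter_map l \<in> map_filt 1 1"
proof -
  have "letter_map l v \<in> \<chi> (1 + 1 * length v)" for v
  proof (cases "\<exists>b\<in>B. word b = l # v")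
    case True
    then obtain b where "b \<in> B" "word b = l # v" by blast
    then show ?thesis
      using letter_map_word word_length by auto
  qed (simp add: letter_map_no_word filt_0)
  then show ?thesis by (simp add: map_filt_def)
qed

definition generators :: "('v, 'a) wreath set"
  where "generators = (\<lambda>l. (letter_map l, 0)) ` \<Lambda> \<union> (\<lambda>l. (0, shift l)) ` \<Lambda>"

text \<open>
  Bracketing with the shift by \<open>j\<close> reads off one more letter.
\<close>

lemma partial_word_commutator:
  assumes "l \<in> \<Lambda>" "set p \<subseteq> \<Lambda>"
  shows "lie_commutator wreath_br generators (Suc (length p)) ((\<lambda>v. letter_map l (p @ v)), 0)"
  using assms(2)
proof (induction p rule: rev_induct)
  case Nil
  have "(letter_map l, 0) \<in> generators"
    using assms(1) by (auto simp: generators_def)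
  then show ?case
    using lie_commutator.generator[of "(letter_map l, 0)" generators wreath_br]
    unfolding append_Nil list.size One_nat_def by blast
next
  case (snoc j p)
  have "(0, shift j) \<in> generators"
    using snoc.prems by (auto simp: generators_def)
  then have "lie_commutator wreath_br generators (1 + Suc (length p))
      (wreath_br (0, shift j) ((\<lambda>v. letter_map l (p @ v)), 0))"
    by (rule lie_commutator.bracket[OF lie_commutator.generator snoc.IH]) (use snoc.prems in auto)
  moreover have "(\<lambda>v. letter_map l (p @ v)) \<in> maps"
    using map_filt_maps[OF letter_map_filt, of l] by (simp add: maps_def)
  moreover have "shift j (\<lambda>v. letter_map l (p @ v)) = (\<lambda>v. letter_map l ((p @ [j]) @ v))"
    by (simp add: shift_def)
  ultimately show ?case
    by (simp only: wreath_br_shift length_append list.size add_Suc_right add_0_right plus_1_eq_Suc)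
qed

text \<open>
  After reading the whole code word of \<open>b\<close>, the value at the empty word is \<open>b\<close>, and all other
  values vanish because no code word properly extends another.
\<close>

lemma basis_commutator:
  assumes "b \<in> B"
  shows "lie_commutator wreath_br generators (length (word b)) (base b)"
proof -
  obtain l p where w: "word b = l # p"
    using word_nonempty[OF assms] by (cases "word b") auto
  have "letter_map l (p @ v) = const_map b v" for v
  proof (cases v)
    case Nil
    then show ?thesis
      using letter_map_word[OF assms w] by (simp add: delta_map_def)
  next
    case (Cons j v')
    have False if "b' \<in> B" "word b' = l # (p @ v)" for b'
    proof -
      have "b' = b"
        by (rule word_prefix_free[OF assms that(1)]) (simp add: that(2) w)
      then show False
        using w that Cons by simp
    qed
    then have "letter_map l (p @ v) = 0"
      by (intro letter_map_no_word) blast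
    then show ?thesis
      using Cons by (simp add: delta_map_def)
  qed
  then have "((\<lambda>v. letter_map l (p @ v)), 0) = base b"
    by (simp add: base_def fun_eq_iff)
  then show ?thesis
    using partial_word_commutator[of l p] word_letters[OF assms] w by simp
qed

text \<open>
  Each element of \<open>\<chi> n\<close> is a combination of commutators of length at most \<open>n\<close>; conversely the
  generators have degree one for the filtration with letter weight one, so a constant of degree at
  most \<open>n\<close> lies in \<open>\<chi> n\<close>.
\<close>

lemma eq_fin_gen_lie:
  "eq_fin_gen_lie TYPE(('v, 'a) wreath) scale L br \<chi>"
proof -
  interpret W: filtered_lie_algebra scale_wreath "(maps :: ('v list \<Rightarrow> 'a) set) \<times> derivations"
    wreath_br "wreath_filt 1"
    by (rule wreath_filtered_lie_algebra)
  let ?\<gamma> = "lie_degree_filtration scale_wreath wreath_br generators"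
  have gen1: "generators \<subseteq> wreath_filt 1 1"
    using map_in_wreath_filt[OF letter_map_filt] shift_in_wreath_filt
    by (auto simp: generators_def)
  then have gen: "generators \<subseteq> maps \<times> derivations"
    using W.filt_carrier by blast
  define G where "G = W.span {u. \<exists>m. lie_commutator wreath_br generators m u}"
  have lower: "?\<gamma> n \<subseteq> wreath_filt 1 n" for n
    by (rule W.degree_filtration_least[OF W.filt_subspace W.filt_Suc W.filt_br gen1])
  have upper: "base h \<in> ?\<gamma> n" if "h \<in> \<chi> n" for h n
  proof -
    have "h \<in> span (B \<inter> \<chi> n)"
      using that span_basis by blast
    then show ?thesis
    proof (induction rule: span_induct_alt)
    case base
    have "lie_algebra.base 0 = (0 :: ('v, 'a) wreath)"
      by (simp add: base_def delta_map_def zero_prod_def fun_eq_iff)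
    then show ?case
      using W.subspace_0[OF W.degree_filtration_subspace] by simp
  next
    case (step c b h)
    have "base b \<in> ?\<gamma> (length (word b))"
      using step basis_commutator W.commutator_in_degree_filtration by blast
    moreover have "?\<gamma> (length (word b)) \<subseteq> ?\<gamma> n"
      using step word_length by (intro W.degree_filtration_mono) auto
    ultimately show ?case
      using step W.degree_filtration_subspace
      by (auto simp: base_add base_scale intro!: W.subspace_add W.subspace_scale)
    qed
  qed
  have "?\<gamma> n \<subseteq> G" for n
    unfolding lie_degree_filtration_def G_def by (rule W.span_mono) auto
  then have "base ` L \<subseteq> G"
    using upper carrier_Union by blast
  moreover have "\<chi> = restrict_filtration L base ?\<gamma>"
    using upper lower filt_carrier base_in_wreath_filt
    by (force simp: restrict_filtration_def fun_eq_iff)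
  moreover have "finite generators"
    using finite_letters by (simp add: generators_def)
  ultimately show ?thesis
    unfolding eq_fin_gen_lie_def
    using W.generated_lie_algebra[OF gen, folded G_def] base_embedding[of G] by blast
qed

end

section \<open>From finitely many generators to two\<close>

context lie_algebra
begin

lemma wreath_br_base:
  assumes "h \<in> L" "f \<in> maps"
  shows "wreath_br (base h) (f, 0) = ((\<lambda>w. br h (f w)), 0)"
  unfolding base_def wreath_br_maps using assms by (simp add: fun_eq_iff shuffle_br_const_map)

lemma wreath_br_shift_power:
  assumes "h \<in> L"
  shows "(wreath_br (0, shift j) ^^ i) (delta_map n h, 0) =
    (if i \<le> n then delta_map (n - i) h else 0, 0)"
proof (induction i)
  case (Suc i)
  have eq: "shift j (if i \<le> n then delta_map (n - i) h else 0) =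
      (if Suc i \<le> n then delta_map (n - Suc i) h else 0)"
  proof (cases "Suc i \<le> n")
    case True
    then have "n - i = Suc (n - Suc i)" "i \<le> n" by simp_all
    then show ?thesis
      using True by (simp only: shift_delta_map if_True)
  next
    case False
    then show ?thesis
      by (cases "i = n") (auto simp: shift_const_map fun_eq_iff delta_map_def)
  qed
  have mem: "(if i \<le> n then delta_map (n - i) h else 0) \<in> maps"
    using assms by (simp add: maps_delta_map maps_0)
  show ?case
    unfolding funpow.simps comp_def Suc.IH wreath_br_shift[OF mem] eq ..
qed simp

end

text \<open>
  Let \<open>g\<^sub>1, \<dots>, g\<^sub>m\<close> generate \<open>L\<close>. Write \<open>s\<close> and \<open>t\<close> for the variables of two successive
  extensions by maps on words over a one-letter alphabet; exponents in parentheses denote divided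
  powers. In the double extension take
  \<open>x = \<partial>\<^sub>t\<close> and \<open>y = (\<Sum>k. t^(m - k) s^(k) g\<^sub>k) + t^(m) \<partial>\<^sub>s\<close>.
  Bracketing \<open>y\<close> with \<open>x\<close> repeatedly, \<open>m\<close> times, leaves \<open>\<partial>\<^sub>s\<close>, while \<open>m - k\<close> times leaves
  \<open>s^(k) g\<^sub>k\<close> plus terms \<open>t^(k - i) s^(i) g\<^sub>i\<close> with \<open>i < k\<close> and \<open>t^(k) \<partial>\<^sub>s\<close>. Bracketing \<open>k\<close> times
  with \<open>\<partial>\<^sub>s\<close> kills all terms but the first and turns it into the constant \<open>g\<^sub>k\<close>.
  In the code the inner extension has prefix \<open>W\<close>, the outer one \<open>V\<close>, and indices of generators start at \<open>0\<close>.
\<close>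

locale finitely_generated_lie_algebra = lie_algebra scale L br
  for scale :: "'f::field \<Rightarrow> 'a::ab_group_add \<Rightarrow> 'a" and L br +
  fixes gs :: "'a list"
  assumes generated: "lie_generated_by scale L br (set gs)"
begin

abbreviation "\<kappa> \<equiv> lie_degree_filtration scale br (set gs)"

lemma generator_carrier: "k < length gs \<Longrightarrow> gs ! k \<in> L"
  using generated lie_generated_by_iff nth_mem by blast

abbreviation "W_carrier \<equiv> (maps :: (unit list \<Rightarrow> 'a) set) \<times> derivations"

sublocale W: lie_algebra scale_wreath W_carrier wreath_br
  by (rule wreath_lie_algebra)

abbreviation "V_carrier \<equiv> (W.maps :: (unit list \<Rightarrow> _) set) \<times> W.derivations"

sublocale V: lie_algebra W.scale_wreath V_carrier W.wreath_br
  by (rule W.wreath_lie_algebra)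

text \<open>
  The element \<open>\<partial>\<^sub>s\<close>.
\<close>

definition dsh :: "(unit, 'a) wreath"
  where "dsh = (0, shift ())"

text \<open>
  The coefficient of the \<open>j\<close>-th divided power of \<open>t\<close> in \<open>y\<close>.
\<close>

definition y_coeff :: "nat \<Rightarrow> (unit, 'a) wreath"
  where "y_coeff j =
    (if j < length gs then (delta_map (length gs - j) (gs ! (length gs - j - 1)), 0)
     else if j = length gs then dsh else 0)"

text \<open>
  The \<open>j\<close>-th derivative of \<open>y\<close> with respect to \<open>t\<close>.
\<close>

definition y_tail :: "nat \<Rightarrow> unit list \<Rightarrow> (unit, 'a) wreath"
  where "y_tail j w = y_coeff (length w + j)"

abbreviation "gen_x \<equiv> (0, shift ()) :: (unit, (unit, 'a) wreath) wreath"
abbreviation "gen_y \<equiv> (y_tail 0, 0) :: (unit, (unit, 'a) wreath) wreath"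
abbreviation "xy_commutator \<equiv> lie_commutator W.wreath_br {gen_x, gen_y}"

lemma dsh_carrier: "dsh \<in> W_carrier"
  by (simp add: dsh_def maps_0 shift_derivation)

lemma y_coeff_carrier: "y_coeff j \<in> W_carrier"
  using dsh_carrier W.carrier_0
  by (auto simp: y_coeff_def maps_delta_map generator_carrier zero_derivation)

lemma y_tail_maps: "y_tail j \<in> W.maps"
  using y_coeff_carrier by (simp add: W.maps_def y_tail_def)

lemma y_tail_commutator: "xy_commutator (Suc j) (y_tail j, 0)"
proof (induction j)
  case 0
  show ?case
    using lie_commutator.generator[of gen_y "{gen_x, gen_y}" W.wreath_br]
    unfolding One_nat_def by blast
next
  case (Suc j)
  have "xy_commutator (1 + Suc j) (W.wreath_br gen_x (y_tail j, 0))"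
    by (rule lie_commutator.bracket[OF lie_commutator.generator[OF insertI1] Suc.IH])
  moreover have "shift () (y_tail j) = y_tail (Suc j)"
    by (simp add: fun_eq_iff y_tail_def)
  ultimately show ?case
    by (simp only: W.wreath_br_shift[OF y_tail_maps] plus_1_eq_Suc)
qed

lemma y_tail_length: "y_tail (length gs) = const_map dsh"
  by (auto simp: fun_eq_iff y_tail_def y_coeff_def delta_map_def)

lemma ad_power_carrier: "h \<in> W_carrier \<Longrightarrow> (wreath_br dsh ^^ i) h \<in> W_carrier"
  using W.br_closed[OF dsh_carrier] by (induction i) auto

lemma ad_power_y_tail_commutator:
  "xy_commutator (Suc j + i * Suc (length gs)) ((\<lambda>w. (wreath_br dsh ^^ i) (y_tail j w)), 0)"
proof (induction i)
  case 0
  show ?case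
    using y_tail_commutator[of j] by (simp only: funpow.simps id_apply mult_0 add_0_right)
next
  case (Suc i)
  have "xy_commutator (Suc (length gs)) (W.base dsh)"
    using y_tail_commutator[of "length gs"] by (simp only: y_tail_length W.base_def)
  then have "xy_commutator (Suc (length gs) + (Suc j + i * Suc (length gs)))
      (W.wreath_br (W.base dsh) ((\<lambda>w. (wreath_br dsh ^^ i) (y_tail j w)), 0))"
    by (rule lie_commutator.bracket[OF _ Suc.IH])
  moreover have "(\<lambda>w. (wreath_br dsh ^^ i) (y_tail j w)) \<in> W.maps"
    using ad_power_carrier y_tail_maps by (simp add: W.maps_def)
  moreover have "Suc (length gs) + (Suc j + i * Suc (length gs)) = Suc j + Suc i * Suc (length gs)"
    by simp
  ultimately show ?case
    by (simp only: W.wreath_br_base[OF dsh_carrier] funpow.simps comp_def)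
qed

lemma ad_power_y_coeff:
  assumes "k < length gs"
  shows "(wreath_br dsh ^^ Suc k) (y_coeff (l + (length gs - Suc k))) =
    (if l = 0 then base (gs ! k) else 0)"
proof -
  let ?j = "l + (length gs - Suc k)"
  have zero: "(wreath_br dsh ^^ i) 0 = 0" for i
    by (induction i) (auto simp: W.br_zero[OF dsh_carrier])
  consider "l = 0" | "0 < l" "l \<le> k" | "l = Suc k" | "Suc k < l"
    by linarith
  then show ?thesis
  proof cases
    case 1
    then have "y_coeff ?j = (delta_map (Suc k) (gs ! k), 0)"
      using assms by (auto simp: y_coeff_def)
    then show ?thesis
      using 1 wreath_br_shift_power[OF generator_carrier[OF assms], where j = "()" and n = "Suc k" and i = "Suc k"]
      by (simp add: dsh_def base_def del: funpow.simps)
  next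
    case 2
    then have "?j < length gs" "length gs - ?j = Suc k - l" "Suc k - l - 1 = k - l"
      using assms by linarith+
    then have "y_coeff ?j = (delta_map (Suc k - l) (gs ! (k - l)), 0)"
      unfolding y_coeff_def by (simp only: if_True)
    moreover have "\<not> Suc k \<le> Suc k - l"
      using 2 by linarith
    ultimately show ?thesis
      using 2 assms wreath_br_shift_power[OF generator_carrier[of "k - l"], where j = "()" and i = "Suc k" and n = "Suc k - l"]
      by (simp add: dsh_def zero_prod_def del: funpow.simps)
  next
    case 3
    then have "?j = length gs"
      using assms by linarith
    then have "y_coeff ?j = dsh"
      by (simp add: y_coeff_def)
    then show ?thesis
      using 3 by (simp add: funpow_swap1 W.br_self[OF dsh_carrier] zero)
  next
    case 4
    then have "length gs < ?j"
      using assms by linarith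
    then have "y_coeff ?j = 0"
      by (simp add: y_coeff_def)
    then show ?thesis
      using 4 zero by (simp del: funpow.simps)
  qed
qed

lemma generator_commutator:
  assumes "k < length gs"
  shows "xy_commutator (Suc (length gs - Suc k) + Suc k * Suc (length gs)) (W.base (base (gs ! k)))"
proof -
  have "(\<lambda>w. (wreath_br dsh ^^ Suc k) (y_tail (length gs - Suc k) w)) = const_map (base (gs ! k))"
    by (auto simp: fun_eq_iff y_tail_def ad_power_y_coeff[OF assms] delta_map_def
        simp del: funpow.simps)
  then show ?thesis
    using ad_power_y_tail_commutator[of "length gs - Suc k" "Suc k"]
    by (simp only: W.base_def)
qed

text \<open>
  Generators of \<open>L\<close> become commutators of length at most \<open>t\<close>, hence elements of degree \<open>n\<close>
  get degree at most \<open>t * n\<close>. In the other direction give both variables weight zero: then \<open>x\<close> and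
  \<open>y\<close> have degree one for the filtration induced by the degree filtration of \<open>L\<close>, and degrees cannot
  drop.
\<close>

lemma two_generator_embedding:
  defines "\<gamma> \<equiv> lie_degree_filtration W.scale_wreath W.wreath_br {gen_x, gen_y}"
  obtains G t where "lie_algebra W.scale_wreath G W.wreath_br"
    "lie_generated_by W.scale_wreath G W.wreath_br {gen_x, gen_y}"
    "lie_embedding scale L br W.scale_wreath G W.wreath_br (W.base \<circ> base)" "t > 0"
    "\<And>n u. u \<in> \<kappa> n \<Longrightarrow> W.base (base u) \<in> \<gamma> (t * n)"
    "\<And>n u. \<lbrakk>u \<in> L; W.base (base u) \<in> \<gamma> n\<rbrakk> \<Longrightarrow> u \<in> \<kappa> n"
proof -
  have gs: "set gs \<subseteq> L"
    using generated lie_generated_by_iff by blast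
  have xy: "{gen_x, gen_y} \<subseteq> V_carrier"
    by (simp add: W.maps_0 W.shift_derivation y_tail_maps W.zero_derivation)
  \<comment> \<open>the bound on the length of the commutators in \<open>generator_commutator\<close>\<close>
  define t where "t = Suc (length gs) * Suc (length gs)"
  define G where "G = V.span {u. \<exists>m. xy_commutator m u}"
  define \<iota> :: "'a \<Rightarrow> (unit, (unit, 'a) wreath) wreath"
    where "\<iota> = W.base \<circ> base"
  have \<iota>_br: "\<iota> (br u v) = W.wreath_br (\<iota> u) (\<iota> v)" if "u \<in> L" "v \<in> L" for u v
    using that by (simp add: \<iota>_def base_br W.base_br base_closed)
  have \<iota>_add: "\<iota> (u + v) = \<iota> u + \<iota> v" and \<iota>_scale: "\<iota> (scale c u) = W.scale_wreath c (\<iota> u)" for u v c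
    by (simp_all add: \<iota>_def base_add W.base_add base_scale W.base_scale)
  have gen: "\<iota> g \<in> \<gamma> t" if g: "g \<in> set gs" for g
  proof -
    obtain k where k: "k < length gs" "g = gs ! k"
      using g by (metis in_set_conv_nth)
    have "Suc (length gs - Suc k) + Suc k * Suc (length gs) \<le> length gs + Suc k * Suc (length gs)"
      using k by simp
    also have "\<dots> \<le> length gs + length gs * Suc (length gs)"
      using k by (intro add_left_mono mult_le_mono1) simp
    also have "\<dots> \<le> t"
      by (simp add: t_def)
    finally have "\<gamma> (Suc (length gs - Suc k) + Suc k * Suc (length gs)) \<subseteq> \<gamma> t"
      unfolding \<gamma>_def by (rule V.degree_filtration_mono)
    then show ?thesis
      using V.commutator_in_degree_filtration[OF generator_commutator[OF k(1)]] k(2)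
      by (auto simp: \<gamma>_def \<iota>_def)
  qed
  have commutator: "\<iota> u \<in> \<gamma> (t * m)" if "lie_commutator br (set gs) m u" for m u
    using that
  proof induction
    case (generator x)
    then show ?case using gen by simp
  next
    case (bracket m u n v)
    then show ?case
      using V.degree_filtration_br[OF xy, of "\<iota> u" "t * m" "\<iota> v" "t * n"] commutator_in_carrier[OF gs]
      by (simp add: \<gamma>_def \<iota>_br distrib_left)
  qed
  have sub: "V.subspace (\<gamma> n)" for n
    by (simp add: \<gamma>_def V.degree_filtration_subspace)
  have upper: "\<iota> u \<in> \<gamma> (t * n)" if "u \<in> \<kappa> n" for n u
    using that unfolding lie_degree_filtration_def
  proof (induction rule: span_induct_alt)
    case base
    have "\<iota> 0 = 0"
      using \<iota>_scale[of 0 0] by simp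
    then show ?case
      using V.subspace_0[OF sub] by simp
  next
    case (step c u v)
    then obtain m where "m \<le> n" "lie_commutator br (set gs) m u" by blast
    then have "\<iota> u \<in> \<gamma> (t * n)"
      using commutator V.degree_filtration_mono[of "t * m" "t * n"] by (auto simp: \<gamma>_def)
    then show ?case
      using step by (simp add: \<iota>_add \<iota>_scale V.subspace_add[OF sub] V.subspace_scale[OF sub])
  qed
  \<comment> \<open>letter weight zero in both extensions\<close>
  have lower: "u \<in> \<kappa> n" if u: "\<iota> u \<in> \<gamma> n" for n u
  proof -
    interpret F: filtered_lie_algebra scale L br \<kappa>
      by unfold_locales (use degree_filtration_subspace degree_filtration_in_carrier[OF gs]
          degree_filtration_mono degree_filtration_br[OF gs] in auto)
    interpret FW: filtered_lie_algebra scale_wreath W_carrier wreath_br "F.wreath_filt 0"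
      by (rule F.wreath_filtered_lie_algebra)
    interpret FV: filtered_lie_algebra W.scale_wreath V_carrier W.wreath_br "FW.wreath_filt 0"
      by (rule FW.wreath_filtered_lie_algebra)
    have dsh: "dsh \<in> F.wreath_filt 0 1"
      using F.shift_in_wreath_filt[of "()" 0] FW.filt_Suc[of 0] by (auto simp: dsh_def)
    have "gs ! k \<in> \<kappa> 1" if "k < length gs" for k
      using that lie_commutator.generator nth_mem commutator_in_degree_filtration by metis
    then have "y_coeff j \<in> F.wreath_filt 0 1" for j
      using dsh FW.filt_0 by (auto simp: y_coeff_def F.map_filt_def delta_map_def F.filt_0
          intro!: F.map_in_wreath_filt)
    then have "gen_y \<in> FW.wreath_filt 0 1"
      by (intro FW.map_in_wreath_filt) (simp add: FW.map_filt_def y_tail_def)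
    moreover have "gen_x \<in> FW.wreath_filt 0 1"
      using FW.shift_in_wreath_filt[of "()" 0] FV.filt_Suc[of 0] by auto
    ultimately have "\<gamma> n \<subseteq> FW.wreath_filt 0 n"
      unfolding \<gamma>_def
      by (intro V.degree_filtration_least[OF FV.filt_subspace FV.filt_Suc FV.filt_br]) auto
    then show ?thesis
      using u by (auto simp: \<iota>_def FW.base_in_wreath_filt F.base_in_wreath_filt)
  qed
  have "\<gamma> n \<subseteq> G" for n
    unfolding \<gamma>_def lie_degree_filtration_def G_def by (rule V.span_mono) auto
  moreover have "\<exists>n. u \<in> \<kappa> n" if "u \<in> L" for u
  proof -
    have "u \<in> span {u. \<exists>m. lie_commutator br (set gs) m u}"
      using that generated lie_generated_by_iff by blast
    then show ?thesis
    proof (induction rule: span_induct_alt)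
      case base
      show ?case using subspace_0[OF degree_filtration_subspace] by blast
    next
      case (step c x y)
      then obtain m n where "lie_commutator br (set gs) m x"
        "y \<in> \<kappa> n" by blast
      then have "x \<in> \<kappa> (max m n)"
        "y \<in> \<kappa> (max m n)"
        using commutator_in_degree_filtration[of "set gs" m x]
          subsetD[OF degree_filtration_mono[of m "max m n"]]
          subsetD[OF degree_filtration_mono[of n "max m n"]] by simp_all
      then show ?case
        by (intro exI[of _ "max m n"] subspace_add subspace_scale degree_filtration_subspace)
    qed
  qed
  ultimately have "\<iota> ` L \<subseteq> G"
    using upper by blast
  then have "lie_embedding scale L br W.scale_wreath G W.wreath_br (W.base \<circ> base)"
    unfolding lie_embedding_def \<iota>_def[symmetric]
    by (auto simp: \<iota>_br \<iota>_add \<iota>_scale inj_on_def)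
      (simp add: \<iota>_def base_eq_iff W.base_eq_iff)
  moreover have "t > 0"
    by (simp add: t_def)
  ultimately show thesis
    using that V.generated_lie_algebra[OF xy] upper lower by (simp add: G_def \<iota>_def)
qed

end

lemma equiv_two_generator_lie_if_eq_fin_gen_lie:
  fixes scale :: "'f::field \<Rightarrow> 'h::ab_group_add \<Rightarrow> 'h"
  assumes "eq_fin_gen_lie TYPE('g::ab_group_add) scale H br \<chi>"
  shows "equiv_two_generator_lie TYPE(nat \<Rightarrow>\<^sub>0 'f) scale H br \<chi>"
proof -
  obtain scale' :: "'f \<Rightarrow> 'g \<Rightarrow> 'g" and G br' X \<iota> where
    G: "lie_algebra scale' G br'" "finite X" "lie_generated_by scale' G br' X"
    "lie_embedding scale H br scale' G br' \<iota>"
    "\<chi> = restrict_filtration H \<iota> (lie_degree_filtration scale' br' X)"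
    using assms unfolding eq_fin_gen_lie_def by (elim exE conjE)
  obtain gs where gs: "set gs = X"
    using finite_list[OF G(2)] by blast
  interpret finitely_generated_lie_algebra scale' G br' gs
    using G gs by (simp add: finitely_generated_lie_algebra_def finitely_generated_lie_algebra_axioms_def)
  let ?\<gamma> = "lie_degree_filtration W.scale_wreath W.wreath_br {gen_x, gen_y}"
  obtain K t where K: "lie_algebra W.scale_wreath K W.wreath_br"
    "lie_generated_by W.scale_wreath K W.wreath_br {gen_x, gen_y}"
    and e: "lie_embedding scale' G br' W.scale_wreath K W.wreath_br (W.base \<circ> base)"
    and t: "t > 0" 
    and up: "\<And>n u. u \<in> lie_degree_filtration scale' br' X n \<Longrightarrow> W.base (base u) \<in> ?\<gamma> (t * n)"
    and lo: "\<And>n u. \<lbrakk>u \<in> G; W.base (base u) \<in> ?\<gamma> n\<rbrakk> \<Longrightarrow> u \<in> lie_degree_filtration scale' br' X n"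
    using two_generator_embedding unfolding gs by blast
  have e': "lie_embedding scale H br W.scale_wreath K W.wreath_br ((W.base \<circ> base) \<circ> \<iota>)"
    using G(4) e unfolding lie_embedding_def
    by (auto simp: image_subset_iff intro!: comp_inj_on[of \<iota>] elim!: inj_on_subset)
  have \<iota>: "\<iota> u \<in> G" if "u \<in> H" for u
    using G(4) that by (auto simp: lie_embedding_def)
  have "\<chi> n \<subseteq> restrict_filtration H ((W.base \<circ> base) \<circ> \<iota>) ?\<gamma> (t * n)" for n
    unfolding G(5) restrict_filtration_def using up by auto
  moreover have "restrict_filtration H ((W.base \<circ> base) \<circ> \<iota>) ?\<gamma> n \<subseteq> \<chi> (t * n)" for n
  proof -
    have "lie_degree_filtration scale' br' X n \<subseteq> lie_degree_filtration scale' br' X (t * n)"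
      using t by (intro degree_filtration_mono) simp
    then show ?thesis
      unfolding G(5) restrict_filtration_def using lo \<iota> by auto
  qed
  ultimately have "filtration_equiv \<chi> (restrict_filtration H ((W.base \<circ> base) \<circ> \<iota>) ?\<gamma>)"
    using t unfolding filtration_equiv_def by blast
  then have "equiv_two_generator_lie TYPE((unit, (unit, 'g) wreath) wreath) scale H br \<chi>"
    unfolding equiv_two_generator_lie_def using K e' by blast
  then show ?thesis
    by (rule equiv_two_generator_lie_sequences)
qed

section \<open>The Poincare-Birkhoff-Witt map\<close>

context lie_algebra
begin

text \<open>
  For independent \<open>B\<close>, the linear extension of the restriction of \<open>g\<close> to \<open>B\<close>.
\<close>

definition lin_ext :: "'a set \<Rightarrow> ('a \<Rightarrow> 'a) \<Rightarrow> 'a \<Rightarrow> 'a"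
  where "lin_ext B g h = (\<Sum>k | representation B h k \<noteq> 0. scale (representation B h k) (g k))"

lemma lin_ext_superset:
  assumes "finite S" "{k. representation B h k \<noteq> 0} \<subseteq> S"
  shows "lin_ext B g h = (\<Sum>k\<in>S. scale (representation B h k) (g k))"
  unfolding lin_ext_def by (rule sum.mono_neutral_left) (use assms in auto)

lemma lin_ext_cong: "(\<And>k. k \<in> B \<Longrightarrow> g k = g' k) \<Longrightarrow> lin_ext B g h = lin_ext B g' h"
  unfolding lin_ext_def by (rule sum.cong) (auto dest: representation_ne_zero)

lemma lin_ext_plus: "lin_ext B (\<lambda>k. g k + g' k) h = lin_ext B g h + lin_ext B g' h"
  by (simp add: lin_ext_def scale_right_distrib sum.distrib)

lemma lin_ext_const_scale: "lin_ext B (\<lambda>k. scale c (g k)) h = scale c (lin_ext B g h)"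
  by (simp add: lin_ext_def scale_sum_right mult.commute)

lemma lin_ext_swap: "lin_ext B (\<lambda>k. lin_ext B (g k) h') h = lin_ext B (\<lambda>l. lin_ext B (\<lambda>k. g k l) h) h'"
  unfolding lin_ext_def scale_sum_right by (subst sum.swap) (simp add: mult.commute)

lemma lin_ext_in_subspace:
  assumes "subspace U" "\<And>k. representation B h k \<noteq> 0 \<Longrightarrow> g k \<in> U"
  shows "lin_ext B g h \<in> U"
  unfolding lin_ext_def using assms by (intro subspace_sum subspace_scale) auto

context
  fixes B
  assumes B: "independent B"
begin

lemma lin_ext_basis: "b \<in> B \<Longrightarrow> lin_ext B g b = g b"
  by (subst lin_ext_superset[of "{b}"]) (auto simp: representation_basis[OF B])

lemma lin_ext_add:
  assumes "h \<in> span B" "h' \<in> span B"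
  shows "lin_ext B g (h + h') = lin_ext B g h + lin_ext B g h'"
proof -
  let ?S = "{k. representation B h k \<noteq> 0} \<union> {k. representation B h' k \<noteq> 0}"
  have "finite ?S"
    by (simp add: finite_representation)
  then show ?thesis
    by (subst (1 2 3) lin_ext_superset[of ?S])
      (auto simp: representation_add[OF B assms(2,1)] scale_left_distrib sum.distrib)
qed

lemma lin_ext_scale:
  assumes "h \<in> span B"
  shows "lin_ext B g (scale c h) = scale c (lin_ext B g h)"
proof -
  let ?S = "{k. representation B h k \<noteq> 0}"
  have "finite ?S"
    by (simp add: finite_representation)
  then show ?thesis
    by (subst (1 2) lin_ext_superset[of ?S])
      (auto simp: representation_scale[OF B assms] scale_sum_right)
qed

lemma lin_ext_zero: "lin_ext B g 0 = 0"
  using lin_ext_scale[of 0 g 0] span_zero by simp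

lemma lin_ext_diff:
  assumes "h \<in> span B" "h' \<in> span B"
  shows "lin_ext B g (h - h') = lin_ext B g h - lin_ext B g h'"
  using lin_ext_add[of "h - h'" h'] assms span_diff by (simp add: algebra_simps)

lemma lin_ext_id: "h \<in> span B \<Longrightarrow> lin_ext B (\<lambda>k. k) h = h"
  unfolding lin_ext_def by (rule sum_nonzero_representation_eq[OF B])

end

end

text \<open>
  A commutation relation between basis elements extends bilinearly to all elements of \<open>L\<close>.
\<close>

lemma (in lie_algebra) lin_ext_commutator:
  assumes B: "independent B" "span B = L"
    and g: "\<And>a b. \<lbrakk>a \<in> B; b \<in> B\<rbrakk> \<Longrightarrow> g a b - g b a = lin_ext B g' (br a b)"
    and "h \<in> L" "h' \<in> L"
  shows "lin_ext B (\<lambda>k. lin_ext B (g k) h') h - lin_ext B (\<lambda>k. lin_ext B (g k) h) h' = lin_ext B g' (br h h')"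
proof -
  have BL: "b \<in> L" if "b \<in> B" for b
    using B(2) span_base[OF that] by simp
  have add: "lin_ext B f (x + y) = lin_ext B f x + lin_ext B f y" if "x \<in> L" "y \<in> L" for f x y
    using lin_ext_add[OF B(1)] that B(2) by simp
  have sc: "lin_ext B f (scale c x) = scale c (lin_ext B f x)" if "x \<in> L" for f c x
    using lin_ext_scale[OF B(1)] that B(2) by simp
  have left: "x \<in> L \<and> lin_ext B (\<lambda>k. g k a) x - lin_ext B (g a) x = lin_ext B g' (br x a)"
    if "a \<in> B" "x \<in> span B" for a x
    using that(2)
  proof (induction rule: span_induct_alt)
    case base
    show ?case
      using BL[OF that(1)] by (simp add: br_zero lin_ext_zero[OF B(1)] subspace_0[OF subspace_carrier])
  next
    case (step c x y)
    then have "x \<in> L" "scale c x \<in> L" "a \<in> L" "scale c x + y \<in> L"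
      using BL that(1) subspace_carrier by (auto intro: subspace_scale subspace_add)
    moreover have "lin_ext B (\<lambda>k. g k a) x - lin_ext B (g a) x = lin_ext B g' (br x a)"
      using g[OF step(1) that(1)] step(1) by (simp add: lin_ext_basis[OF B(1)])
    then have "scale c (lin_ext B (\<lambda>k. g k a) x) - scale c (lin_ext B (g a) x) = scale c (lin_ext B g' (br x a))"
      by (simp flip: scale_right_diff_distrib)
    ultimately show ?case
      using step by (simp add: add sc br_add_left br_scale_left br_closed
          subspace_scale[OF subspace_carrier] add_diff_add)
  qed
  have "y \<in> L \<and> lin_ext B (\<lambda>k. lin_ext B (g k) y) h - lin_ext B (\<lambda>k. lin_ext B (g k) h) y = lin_ext B g' (br h y)"
    if "y \<in> span B" for y
    using that
  proof (induction rule: span_induct_alt)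
    case base
    have "lin_ext B (\<lambda>k. lin_ext B (g k) 0) h = 0"
      by (simp add: lin_ext_zero[OF B(1)]) (simp add: lin_ext_def)
    then show ?case
      using assms(4) by (simp add: br_zero lin_ext_zero[OF B(1)] subspace_0[OF subspace_carrier])
  next
    case (step c x y)
    then have "x \<in> L" "scale c x \<in> L" "scale c x + y \<in> L"
      using BL subspace_carrier by (auto intro: subspace_scale subspace_add)
    moreover have "lin_ext B (\<lambda>k. lin_ext B (g k) x) h - lin_ext B (\<lambda>k. lin_ext B (g k) h) x = lin_ext B g' (br h x)"
      using left[OF step(1), of h] assms(4) B(2) step(1) by (simp add: lin_ext_basis[OF B(1)])
    then have "scale c (lin_ext B (\<lambda>k. lin_ext B (g k) x) h) - scale c (lin_ext B (\<lambda>k. lin_ext B (g k) h) x) =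
        scale c (lin_ext B g' (br h x))"
      by (simp flip: scale_right_diff_distrib)
    ultimately show ?case
      using step assms(4)
      by (simp add: add sc br_add_right br_scale_right br_closed subspace_scale[OF subspace_carrier]
          add_diff_add lin_ext_plus lin_ext_const_scale)
  qed
  then show ?thesis
    using assms(5) B(2) by simp
qed

locale ordered_basis_lie_algebra = lie_algebra scale L br
  for scale :: "'f::field \<Rightarrow> 'a::ab_group_add \<Rightarrow> 'a" and L br +
  fixes B :: "'a set" and key :: "'a \<Rightarrow> nat"
  assumes independent: "independent B" and span_B: "span B = L" and inj_key: "inj_on key B"
begin

lemma basis_in_carrier: "b \<in> B \<Longrightarrow> b \<in> L"
  using span_B span_base by blast

definition is_descent :: "'a list \<Rightarrow> 'a list \<times> 'a \<times> 'a \<times> 'a list \<Rightarrow> bool"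
  where "is_descent w = (\<lambda>(u, a, b, v). w = u @ a # b # v \<and> key b < key a)"

primrec inversions :: "'a list \<Rightarrow> nat" where
  "inversions [] = 0"
| "inversions (a # w) = length (filter (\<lambda>b. key b < key a) w) + inversions w"

lemma inversions_swap:
  "key b < key a \<Longrightarrow> inversions (u @ a # b # v) = Suc (inversions (u @ b # a # v))"
  by (induction u) auto

text \<open>
  Straightening either exchanges two neighbours in the wrong order or replaces them by one
  letter, so it terminates in this order.
\<close>

definition simpler :: "('a list \<times> 'a list) set"
  where "simpler = measures [length, inversions]"

lemma wf_simpler: "wf simpler"
  by (simp add: simpler_def)

lemma simpler_swap: "key b < key a \<Longrightarrow> (u @ b # a # v, u @ a # b # v) \<in> simpler"
  by (simp add: simpler_def inversions_swap)

lemma simpler_shorter: "length w < length w' \<Longrightarrow> (w, w') \<in> simpler"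
  by (simp add: simpler_def)

lemma simpler_trans: "(x, y) \<in> simpler \<Longrightarrow> (y, z) \<in> simpler \<Longrightarrow> (x, z) \<in> simpler"
  by (auto simp: simpler_def)

text \<open>
  Straightening rewrites a product of two neighbours in the wrong order as the product in the right
  order plus their bracket; sorted words of length at least two have value zero. The result is the
  linear part of the sorted form of a word in the enveloping algebra. An arbitrary descent is
  chosen; that the choice does not matter is the content of \<open>pbw_descent\<close>. The sum is a linear
  extension written out, so that the recursive calls under it are visible.
\<close>

function pbw :: "'a list \<Rightarrow> 'a" where
  "pbw w = (if Ex (is_descent w) then
      (case Eps (is_descent w) of (u, a, b, v) \<Rightarrow> pbw (u @ b # a # v) +
        (\<Sum>k | representation B (br a b) k \<noteq> 0.
          scale (representation B (br a b) k) (pbw (u @ k # v))))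
    else (case w of [b] \<Rightarrow> b | _ \<Rightarrow> 0))"
  by pat_completeness auto
termination
proof (relation simpler, rule wf_simpler)
  fix w u q a r b v
  assume "Ex (is_descent w)" "(u, q) = Eps (is_descent w)" "(a, r) = q" "(b, v) = r"
  then have w: "w = u @ a # b # v" "key b < key a"
    using someI_ex[of "is_descent w"] by (auto simp: is_descent_def split: prod.splits)
  show "(u @ b # a # v, w) \<in> simpler"
    using simpler_swap w by simp
  show "(u @ k # v, w) \<in> simpler" for k
    using simpler_shorter w by simp
qed

declare pbw.simps [simp del]

definition straighten :: "'a list \<Rightarrow> 'a \<Rightarrow> 'a \<Rightarrow> 'a list \<Rightarrow> 'a"
  where "straighten u a b v = pbw (u @ b # a # v) + lin_ext B (\<lambda>k. pbw (u @ k # v)) (br a b)"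

lemma pbw_single: "pbw [b] = b"
proof -
  have "\<not> Ex (is_descent [b])"
    by (auto simp: is_descent_def append_eq_Cons_conv)
  then show ?thesis
    by (simp add: pbw.simps)
qed

lemma pbw_some_descent:
  assumes "w = u @ a # b # v" "key b < key a"
  obtains u' a' b' v' where "w = u' @ a' # b' # v'" "key b' < key a'" "pbw w = straighten u' a' b' v'"
proof -
  have ex: "Ex (is_descent w)"
    using assms by (intro exI[of _ "(u, a, b, v)"]) (simp add: is_descent_def)
  obtain u' a' b' v' where p: "Eps (is_descent w) = (u', a', b', v')"
    by (cases "Eps (is_descent w)") auto
  have "is_descent w (u', a', b', v')"
    using someI_ex[OF ex] p by simp
  moreover have "pbw w = straighten u' a' b' v'"
    using ex p by (subst pbw.simps) (simp add: straighten_def lin_ext_def)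
  ultimately show thesis
    using that by (simp add: is_descent_def)
qed

text \<open>
  Two descents that share a letter. Both ways to start lead to the same word \<open>d' b' a'\<close> up to
  brackets, and the difference of the brackets is a Jacobi expression.
\<close>

lemma straighten_confluent_overlap:
  assumes IH: "\<And>u a b v. \<lbrakk>(u @ a # b # v, u' @ a' # b' # d' # v') \<in> simpler; set (u @ a # b # v) \<subseteq> B;
      key b < key a\<rbrakk> \<Longrightarrow> pbw (u @ a # b # v) = straighten u a b v"
    and w: "set (u' @ a' # b' # d' # v') \<subseteq> B" and key: "key b' < key a'" "key d' < key b'"
  shows "straighten u' a' b' (d' # v') = straighten (u' @ [a']) b' d' v'"
proof -
  let ?E = "\<lambda>u v h. lin_ext B (\<lambda>k. pbw (u @ k # v)) h"
  have mem: "a' \<in> L" "b' \<in> L" "d' \<in> L" "a' \<in> B" "b' \<in> B" "d' \<in> B"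
    using w basis_in_carrier by auto
  \<comment> \<open>the commutation relation for words shorter than the given one, with one argument in \<open>L\<close>\<close>
  have swap: "?E u' (x # v') h - ?E (u' @ [x]) v' h = ?E u' v' (br h x)"
    if x: "x \<in> B" and h: "h \<in> L" for x h
  proof -
    have "pbw (u' @ p # q # v') - pbw (u' @ q # p # v') = ?E u' v' (br p q)"
      if pq: "p \<in> B" "q \<in> B" for p q
    proof -
      have short: "(u' @ p # q # v', u' @ a' # b' # d' # v') \<in> simpler" for p q
        by (rule simpler_shorter) simp
      have inB: "set (u' @ p # q # v') \<subseteq> B" "set (u' @ q # p # v') \<subseteq> B"
        using w pq by auto
      consider "key q < key p" | "key p < key q" | "p = q"
        using inj_onD[OF inj_key _ pq] by linarith
      then show ?thesis
      proof cases
        case 1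
        show ?thesis
          using IH[OF short inB(1) 1] by (simp add: straighten_def)
      next
        case 2
        have "pbw (u' @ q # p # v') = pbw (u' @ p # q # v') + ?E u' v' (- br p q)"
          using IH[OF short inB(2) 2] br_anticomm[of p q] basis_in_carrier pq
          by (simp add: straighten_def)
        moreover have "?E u' v' (- br p q) = - ?E u' v' (br p q)"
          using lin_ext_diff[OF independent, of 0 "br p q"] pq basis_in_carrier
          by (simp add: span_B br_closed lin_ext_zero[OF independent] subspace_0[OF subspace_carrier])
        ultimately show ?thesis by simp
      next
        case 3
        then show ?thesis
          using basis_in_carrier pq by (simp add: br_self lin_ext_zero[OF independent])
      qed
    qed
    from lin_ext_commutator[of B "\<lambda>p q. pbw (u' @ p # q # v')", OF independent span_B this h
        basis_in_carrier[OF x]]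
    show ?thesis
      using x by (simp add: lin_ext_basis[OF independent])
  qed
  have ba: "(u' @ b' # a' # d' # v', u' @ a' # b' # d' # v') \<in> simpler"
    using simpler_swap key by simp
  have db: "(u' @ a' # d' # b' # v', u' @ a' # b' # d' # v') \<in> simpler"
    using simpler_swap[of d' b' "u' @ [a']"] key by simp
  have bda: "(u' @ b' # d' # a' # v', u' @ a' # b' # d' # v') \<in> simpler"
    using simpler_trans[OF _ ba] simpler_swap[of d' a' "u' @ [b']"] key by simp
  have dab: "(u' @ d' # a' # b' # v', u' @ a' # b' # d' # v') \<in> simpler"
    using simpler_trans[OF _ db] simpler_swap[of d' a' u'] key by simp
  have 1: "pbw (u' @ b' # a' # d' # v') = pbw (u' @ b' # d' # a' # v') + ?E (u' @ [b']) v' (br a' d')"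
    using IH[of "u' @ [b']" a' d' v'] ba w key by (simp add: straighten_def)
  have 2: "pbw (u' @ b' # d' # a' # v') = pbw (u' @ d' # b' # a' # v') + ?E u' (a' # v') (br b' d')"
    using IH[of u' b' d' "a' # v'"] bda w key by (simp add: straighten_def)
  have 3: "pbw (u' @ a' # d' # b' # v') = pbw (u' @ d' # a' # b' # v') + ?E u' (b' # v') (br a' d')"
    using IH[of u' a' d' "b' # v'"] db w key by (simp add: straighten_def)
  have 4: "pbw (u' @ d' # a' # b' # v') = pbw (u' @ d' # b' # a' # v') + ?E (u' @ [d']) v' (br a' b')"
    using IH[of "u' @ [d']" a' b' v'] dab w key by (simp add: straighten_def)
  have jac: "br (br a' b') d' - br (br a' d') b' + br (br b' d') a' = 0"
  proof -
    have "br (br a' b') d' = - br d' (br a' b')" "br (br b' d') a' = - br a' (br b' d')"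
      "br (br a' d') b' = br b' (br d' a')"
      using mem br_anticomm[of d' a'] br_anticomm[of "br a' b'" d'] br_anticomm[of "br b' d'" a']
        br_anticomm[of "br d' a'" b'] br_scale_left[of "br d' a'" b' "- 1"]
      by (simp_all add: br_closed)
    then have "br (br a' b') d' - br (br a' d') b' + br (br b' d') a' =
        - (br a' (br b' d') + br b' (br d' a') + br d' (br a' b'))"
      by simp
    then show ?thesis
      using jacobi[of a' b' d'] mem by simp
  qed
  have "?E u' v' (br (br a' b') d') - ?E u' v' (br (br a' d') b') + ?E u' v' (br (br b' d') a') = 0"
    using mem arg_cong[OF jac, of "?E u' v'"] subspace_diff[OF subspace_carrier]
    by (simp add: lin_ext_add[OF independent] lin_ext_diff[OF independent] lin_ext_zero[OF independent] span_B br_closed)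
  then have "(?E u' (d' # v') (br a' b') - ?E (u' @ [d']) v' (br a' b')) -
      (?E u' (b' # v') (br a' d') - ?E (u' @ [b']) v' (br a' d')) +
      (?E u' (a' # v') (br b' d') - ?E (u' @ [a']) v' (br b' d')) = 0"
    using swap mem by (simp only: br_closed)
  then show ?thesis
    unfolding straighten_def using 1 2 3 4 by (simp add: algebra_simps)
qed

text \<open>
  Two descents without a common letter commute: straightening both gives four terms that do not
  depend on the order.
\<close>

lemma straighten_confluent_disjoint:
  assumes IH: "\<And>u a b v. \<lbrakk>(u @ a # b # v, u' @ a' # b' # m' @ c' # d' # v') \<in> simpler;
      set (u @ a # b # v) \<subseteq> B; key b < key a\<rbrakk> \<Longrightarrow> pbw (u @ a # b # v) = straighten u a b v"
    and w: "set (u' @ a' # b' # m' @ c' # d' # v') \<subseteq> B" and key: "key b' < key a'" "key d' < key c'"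
  shows "straighten u' a' b' (m' @ c' # d' # v') = straighten (u' @ a' # b' # m') c' d' v'"
proof -
  let ?w = "u' @ a' # b' # m' @ c' # d' # v'"
  have ba: "(u' @ b' # a' # m' @ c' # d' # v', ?w) \<in> simpler"
    using simpler_swap key by simp
  have dc: "(u' @ a' # b' # m' @ d' # c' # v', ?w) \<in> simpler"
    using simpler_swap[of d' c' "u' @ a' # b' # m'"] key by simp
  have 1: "pbw (u' @ b' # a' # m' @ c' # d' # v') = pbw (u' @ b' # a' # m' @ d' # c' # v') +
      lin_ext B (\<lambda>l. pbw (u' @ b' # a' # m' @ l # v')) (br c' d')"
    using IH[of "u' @ b' # a' # m'" c' d' v'] ba w key by (simp add: straighten_def)
  have 2: "pbw (u' @ a' # b' # m' @ d' # c' # v') = pbw (u' @ b' # a' # m' @ d' # c' # v') +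
      lin_ext B (\<lambda>k. pbw (u' @ k # m' @ d' # c' # v')) (br a' b')"
    using IH[of u' a' b' "m' @ d' # c' # v'"] dc w key by (simp add: straighten_def)
  have "pbw (u' @ k # m' @ c' # d' # v') = pbw (u' @ k # m' @ d' # c' # v') +
      lin_ext B (\<lambda>l. pbw (u' @ k # m' @ l # v')) (br c' d')" if "k \<in> B" for k
    using IH[of "u' @ k # m'" c' d' v'] simpler_shorter[of "u' @ k # m' @ c' # d' # v'" ?w] w key that
    by (simp add: straighten_def)
  then have 3: "lin_ext B (\<lambda>k. pbw (u' @ k # m' @ c' # d' # v')) (br a' b') =
      lin_ext B (\<lambda>k. pbw (u' @ k # m' @ d' # c' # v')) (br a' b') +
      lin_ext B (\<lambda>k. lin_ext B (\<lambda>l. pbw (u' @ k # m' @ l # v')) (br c' d')) (br a' b')"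
    by (simp add: lin_ext_cong[of B "\<lambda>k. pbw (u' @ k # m' @ c' # d' # v')"] flip: lin_ext_plus)
  have "pbw (u' @ a' # b' # m' @ l # v') = pbw (u' @ b' # a' # m' @ l # v') +
      lin_ext B (\<lambda>k. pbw (u' @ k # m' @ l # v')) (br a' b')" if "l \<in> B" for l
    using IH[of u' a' b' "m' @ l # v'"] simpler_shorter[of "u' @ a' # b' # m' @ l # v'" ?w] w key that
    by (simp add: straighten_def)
  then have 4: "lin_ext B (\<lambda>l. pbw (u' @ a' # b' # m' @ l # v')) (br c' d') =
      lin_ext B (\<lambda>l. pbw (u' @ b' # a' # m' @ l # v')) (br c' d') +
      lin_ext B (\<lambda>l. lin_ext B (\<lambda>k. pbw (u' @ k # m' @ l # v')) (br a' b')) (br c' d')"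
    by (simp add: lin_ext_cong[of B "\<lambda>l. pbw (u' @ a' # b' # m' @ l # v')"] flip: lin_ext_plus)
  show ?thesis
    unfolding straighten_def
    using 1 2 3 4 lin_ext_swap[of B "\<lambda>k l. pbw (u' @ k # m' @ l # v')" "br c' d'" "br a' b'"]
    by (simp add: add_ac)
qed

text \<open>
  Newman's lemma in linear form: by induction, simpler words may be straightened at any descent,
  so two first steps can be compared through the overlapping or the disjoint case.
\<close>

lemma pbw_descent:
  "\<lbrakk>set (u @ a # b # v) \<subseteq> B; key b < key a\<rbrakk> \<Longrightarrow> pbw (u @ a # b # v) = straighten u a b v"
proof (induction "u @ a # b # v" arbitrary: u a b v rule: wf_induct_rule[OF wf_simpler])
  case (1 u a b v)
  let ?w = "u @ a # b # v"
  have inB: "set ?w \<subseteq> B"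
    using 1 by blast
  have IH: "pbw (u' @ a' # b' # v') = straighten u' a' b' v'"
    if "(u' @ a' # b' # v', ?w) \<in> simpler" "set (u' @ a' # b' # v') \<subseteq> B" "key b' < key a'" for u' a' b' v'
    using 1(1) that by blast
  have confluent: "straighten u1 a1 b1 v1 = straighten u2 a2 b2 v2"
    if 1: "?w = u1 @ a1 # b1 # v1" "key b1 < key a1"
      and 2: "?w = u2 @ a2 # b2 # v2" "key b2 < key a2" and len: "length u1 < length u2"
    for u1 a1 b1 v1 u2 a2 b2 v2
  proof -
    obtain m where m: "u2 = u1 @ m" "m @ a2 # b2 # v2 = a1 # b1 # v1"
      using 1(1) 2(1) len by (auto simp: append_eq_append_conv2)
    obtain m' where m': "m = a1 # m'" "m' @ a2 # b2 # v2 = b1 # v1"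
      using m len by (cases m) auto
    show ?thesis
    proof (cases m')
      case Nil
      then have eqs: "a2 = b1" "v1 = b2 # v2" "u2 = u1 @ [a1]"
        using m m' by auto
      have w: "?w = u1 @ a1 # b1 # b2 # v2"
        using 1 eqs by simp
      show ?thesis
        unfolding eqs
        by (rule straighten_confluent_overlap)
          (use IH[unfolded w] inB[unfolded w] 1(2) 2(2) eqs in auto)
    next
      case (Cons x m'')
      then have eqs: "x = b1" "v1 = m'' @ a2 # b2 # v2" "u2 = u1 @ a1 # b1 # m''"
        using m m' by auto
      have w: "?w = u1 @ a1 # b1 # m'' @ a2 # b2 # v2"
        using 1 eqs by simp
      show ?thesis
        unfolding eqs
        by (rule straighten_confluent_disjoint)
          (use IH[unfolded w] inB[unfolded w] 1(2) 2(2) eqs in auto)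
    qed
  qed
  obtain u' a' b' v' where d: "?w = u' @ a' # b' # v'" "key b' < key a'" "pbw ?w = straighten u' a' b' v'"
    using pbw_some_descent[OF refl 1(3)] by blast
  consider "length u < length u'" | "length u' < length u" | "length u = length u'"
    by linarith
  then show ?case
  proof cases
    case 1
    then show ?thesis
      using confluent[OF refl _ d(1,2)] d(3) \<open>key b < key a\<close> by simp
  next
    case 2
    then show ?thesis
      using confluent[OF d(1,2) refl] d(3) \<open>key b < key a\<close> by simp
  next
    case 3
    then show ?thesis
      using d by simp
  qed
qed

lemma pbw_commutator:
  assumes "set u \<subseteq> B" "set v \<subseteq> B" "a \<in> B" "b \<in> B"
  shows "pbw (u @ a # b # v) - pbw (u @ b # a # v) = lin_ext B (\<lambda>k. pbw (u @ k # v)) (br a b)"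
proof -
  consider "key b < key a" | "key a < key b" | "a = b"
    using inj_onD[OF inj_key _ assms(3,4)] by linarith
  then show ?thesis
  proof cases
    case 1
    then show ?thesis
      using pbw_descent[of u a b v] assms by (simp add: straighten_def)
  next
    case 2
    have ab: "a \<in> L" "b \<in> L"
      using assms basis_in_carrier by auto
    have "lin_ext B (\<lambda>k. pbw (u @ k # v)) (br b a) = - lin_ext B (\<lambda>k. pbw (u @ k # v)) (br a b)"
      using lin_ext_diff[OF independent, of 0 "br a b"] ab br_anticomm[OF ab]
      by (simp add: span_B br_closed lin_ext_zero[OF independent] subspace_0[OF subspace_carrier])
    then show ?thesis
      using pbw_descent[of u b a v] 2 assms by (simp add: straighten_def)
  next
    case 3
    then show ?thesis
      using basis_in_carrier assms by (simp add: br_self lin_ext_zero[OF independent])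
  qed
qed

text \<open>
  Exchanging letters preserves the total weight of a word and replacing two letters by their
  bracket does not increase it.
\<close>

lemma pbw_filtered:
  fixes \<chi> :: "nat \<Rightarrow> 'a set"
  assumes filt: "\<And>n. subspace (\<chi> n)" "\<And>m n. m \<le> n \<Longrightarrow> \<chi> m \<subseteq> \<chi> n"
    and br: "\<And>a b k. \<lbrakk>a \<in> B; b \<in> B; representation B (br a b) k \<noteq> 0\<rbrakk> \<Longrightarrow> wt k \<le> wt a + wt b"
    and wt: "\<And>b. b \<in> B \<Longrightarrow> b \<in> \<chi> (wt b)"
  shows "set w \<subseteq> B \<Longrightarrow> pbw w \<in> \<chi> (sum_list (map wt w))"
proof (induction w rule: wf_induct_rule[OF wf_simpler])
  case (1 w)
  show ?case
  proof (cases "\<exists>u a b v. w = u @ a # b # v \<and> key b < key a")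
    case True
    then obtain u a b v where w: "w = u @ a # b # v" "key b < key a" by blast
    have "pbw (u @ b # a # v) \<in> \<chi> (sum_list (map wt (u @ b # a # v)))"
      by (rule "1.IH") (use "1.prems" w simpler_swap in auto)
    moreover have "lin_ext B (\<lambda>k. pbw (u @ k # v)) (br a b) \<in> \<chi> (sum_list (map wt w))"
    proof (rule lin_ext_in_subspace[OF filt(1)])
      fix k assume k: "representation B (br a b) k \<noteq> 0"
      then have "wt k \<le> wt a + wt b" "k \<in> B"
        using br 1(2) w representation_ne_zero by auto
      then have "sum_list (map wt (u @ k # v)) \<le> sum_list (map wt w)"
        using w by simp
      moreover have "pbw (u @ k # v) \<in> \<chi> (sum_list (map wt (u @ k # v)))"
        by (rule "1.IH") (use "1.prems" w \<open>k \<in> B\<close> simpler_shorter[of "u @ k # v" w] in auto)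
      ultimately show "pbw (u @ k # v) \<in> \<chi> (sum_list (map wt w))"
        using filt(2) by blast
    qed
    moreover have "sum_list (map wt (u @ b # a # v)) = sum_list (map wt w)"
      using w by simp
    ultimately show ?thesis
      using pbw_descent[of u a b v] 1(2) w subspace_add[OF filt(1)]
      by (simp add: straighten_def add_ac)
  next
    case False
    then have "\<not> Ex (is_descent w)"
      by (auto simp: is_descent_def)
    then have "pbw w = (case w of [b] \<Rightarrow> b | _ \<Rightarrow> 0)"
      by (simp add: pbw.simps)
    then show ?thesis
      using wt 1(2) subspace_0[OF filt(1)] by (auto split: list.splits)
  qed
qed

end

section \<open>Realising a tame filtration in a finitely generated associative algebra\<close>

text \<open>
  Code words may be longer than the weight by a factor \<open>t\<close>; the case \<open>t = 1\<close> gives equality of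
  filtrations, the general one allows a two-letter alphabet.
\<close>

locale coded_lie_algebra = ordered_basis_lie_algebra scale L br B key
  for scale :: "'f::field \<Rightarrow> 'a::ab_group_add \<Rightarrow> 'a" and L br B key +
  fixes \<chi> :: "nat \<Rightarrow> 'a set" and wt :: "'a \<Rightarrow> nat" and w :: "'a \<Rightarrow> 'v list"
    and \<Lambda> :: "'v set" and t :: nat
  assumes filtration: "lie_filtration scale L br \<chi>"
    and span_basis: "span (B \<inter> \<chi> n) = \<chi> n"
    and wt: "b \<in> B \<Longrightarrow> b \<in> \<chi> n \<longleftrightarrow> wt b \<le> n"
    and sync: "synchronized B w"
    and letters: "b \<in> B \<Longrightarrow> set (w b) \<subseteq> \<Lambda>"
    and wt_le_length: "b \<in> B \<Longrightarrow> wt b \<le> length (w b)"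
    and length_le_wt: "b \<in> B \<Longrightarrow> length (w b) \<le> t * wt b"
begin

lemmas filt = lie_filtrationD[OF lie_algebra_axioms filtration]

lemma representation_weight:
  assumes "h \<in> \<chi> n" "representation B h k \<noteq> 0"
  shows "k \<in> B" "wt k \<le> n"
proof -
  have "representation B h = representation (B \<inter> \<chi> n) h"
    using assms(1) span_basis[of n] independent by (intro representation_extend) auto
  then have "k \<in> B \<inter> \<chi> n"
    using assms(2) representation_ne_zero by metis
  then show "k \<in> B" "wt k \<le> n"
    using wt by auto
qed

lemma pbw_weight: "set bs \<subseteq> B \<Longrightarrow> pbw bs \<in> \<chi> (sum_list (map wt bs))"
proof (rule pbw_filtered[OF filt(1,4)])
  fix a b k
  assume ab: "a \<in> B" "b \<in> B" and k: "representation B (br a b) k \<noteq> 0"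
  have "a \<in> \<chi> (wt a)" "b \<in> \<chi> (wt b)"
    using wt[OF ab(1), of "wt a"] wt[OF ab(2), of "wt b"] by simp_all
  then have "br a b \<in> \<chi> (wt a + wt b)"
    by (rule filt(5))
  then show "wt k \<le> wt a + wt b"
    using representation_weight k by blast
next
  show "b \<in> \<chi> (wt b)" if "b \<in> B" for b
    using wt[OF that, of "wt b"] by simp
qed

definition decode :: "'v list \<Rightarrow> 'a"
  where "decode x = (if \<exists>bs. set bs \<subseteq> B \<and> concat (map w bs) = x
    then pbw (THE bs. set bs \<subseteq> B \<and> concat (map w bs) = x) else 0)"

lemma decode_concat:
  assumes "set bs \<subseteq> B"
  shows "decode (concat (map w bs)) = pbw bs"
proof -
  have "(THE cs. set cs \<subseteq> B \<and> concat (map w cs) = concat (map w bs)) = bs"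
    using assms synchronized_unique[OF sync] by (intro the_equality) blast+
  moreover have "\<exists>cs. set cs \<subseteq> B \<and> concat (map w cs) = concat (map w bs)"
    using assms by blast
  ultimately show ?thesis
    unfolding decode_def by (simp only: if_True)
qed

lemma decode_eq_0: "\<nexists>bs. set bs \<subseteq> B \<and> concat (map w bs) = x \<Longrightarrow> decode x = 0"
  unfolding decode_def by (simp only: if_False)

lemma decode_filtered: "decode x \<in> \<chi> (length x)"
proof (cases "\<exists>bs. set bs \<subseteq> B \<and> concat (map w bs) = x")
  case True
  then obtain bs where bs: "set bs \<subseteq> B" "concat (map w bs) = x"
    by blast
  have "sum_list (map wt bs) \<le> length (concat (map w bs))"
    using bs(1)
  proof (induction bs)
    case (Cons b bs)
    then show ?case
      using wt_le_length[of b] by simp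
  qed simp
  then show ?thesis
    using pbw_weight[OF bs(1)] filt(4) decode_concat[OF bs(1)] bs(2) by auto
next
  case False
  then show ?thesis
    using decode_eq_0 subspace_0[OF filt(1)] by metis
qed

text \<open>
  The functions on which exchanging two neighbouring code words has the effect prescribed by the
  bracket. Translation on the right preserves this space.
\<close>

definition module_maps :: "('v list \<Rightarrow> 'a) set"
  where "module_maps = {f. \<forall>u v. \<forall>a\<in>B. \<forall>b\<in>B.
    f (u @ w a @ w b @ v) - f (u @ w b @ w a @ v) = lin_ext B (\<lambda>k. f (u @ w k @ v)) (br a b)}"

lemma module_mapsD:
  "\<lbrakk>f \<in> module_maps; a \<in> B; b \<in> B\<rbrakk> \<Longrightarrow>
    f (u @ w a @ w b @ v) - f (u @ w b @ w a @ v) = lin_ext B (\<lambda>k. f (u @ w k @ v)) (br a b)"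
  by (simp add: module_maps_def)

lemma lin_ext_0: "lin_ext B (\<lambda>k. 0) h = 0"
  by (simp add: lin_ext_def)

text \<open>
  If the context \<open>u\<close>, \<open>v\<close> of the code words decodes, the relation is the one for \<open>pbw\<close>. If it does
  not, synchronization makes all three words undecodable.
\<close>

lemma decode_in_module_maps: "decode \<in> module_maps"
  unfolding module_maps_def
proof (intro CollectI allI ballI)
  fix u v a b
  assume ab: "a \<in> B" "b \<in> B"
  show "decode (u @ w a @ w b @ v) - decode (u @ w b @ w a @ v) =
      lin_ext B (\<lambda>k. decode (u @ w k @ v)) (br a b)"
  proof (cases "\<exists>ys zs. set ys \<subseteq> B \<and> set zs \<subseteq> B \<and> u = concat (map w ys) \<and> v = concat (map w zs)")
    case True
    then obtain ys zs where yz: "set ys \<subseteq> B" "set zs \<subseteq> B" "u = concat (map w ys)" "v = concat (map w zs)"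
      by blast
    have "decode (u @ w a @ w b @ v) = pbw (ys @ a # b # zs)"
      "decode (u @ w b @ w a @ v) = pbw (ys @ b # a # zs)"
      using decode_concat[of "ys @ a # b # zs"] decode_concat[of "ys @ b # a # zs"] ab yz by simp_all
    moreover have "decode (u @ w k @ v) = pbw (ys @ k # zs)" if "k \<in> B" for k
      using decode_concat[of "ys @ k # zs"] that yz by simp
    ultimately show ?thesis
      using pbw_commutator[OF yz(1,2) ab]
        lin_ext_cong[of B "\<lambda>k. decode (u @ w k @ v)" "\<lambda>k. pbw (ys @ k # zs)"] by simp
  next
    case False
    have single: "decode (u @ w k @ v) = 0" if k: "k \<in> B" for k
    proof (rule decode_eq_0, rule notI, elim exE conjE)
      fix bs assume bs: "set bs \<subseteq> B" "concat (map w bs) = u @ w k @ v"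
      obtain ys zs where "bs = ys @ k # zs" "u = concat (map w ys)" "v = concat (map w zs)"
        by (rule synchronizedE[OF sync k bs])
      moreover from this have "set ys \<subseteq> B" "set zs \<subseteq> B"
        using bs(1) by auto
      ultimately show False
        using False by blast
    qed
    have double: "decode (u @ w k @ w l @ v) = 0" if kl: "k \<in> B" "l \<in> B" for k l
    proof (rule decode_eq_0, rule notI, elim exE conjE)
      fix bs assume bs: "set bs \<subseteq> B" "concat (map w bs) = u @ w k @ w l @ v"
      have "concat (map w bs) = u @ concat (map w [k, l]) @ v"
        using bs(2) by simp
      then obtain us vs where "bs = us @ [k, l] @ vs" "u = concat (map w us)" "v = concat (map w vs)"
        using synchronized_word[OF sync bs(1), of "[k, l]" u v] kl by auto
      moreover from this have "set us \<subseteq> B" "set vs \<subseteq> B"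
        using bs(1) by auto
      ultimately show False
        using False by blast
    qed
    have "lin_ext B (\<lambda>k. decode (u @ w k @ v)) (br a b) = lin_ext B (\<lambda>k. 0) (br a b)"
      by (rule lin_ext_cong) (rule single)
    then show ?thesis
      using double ab by (simp add: lin_ext_0)
  qed
qed

lemma module_maps_0: "0 \<in> module_maps"
  by (simp add: module_maps_def lin_ext_0)

lemma module_maps_add: "\<lbrakk>f \<in> module_maps; g \<in> module_maps\<rbrakk> \<Longrightarrow> f + g \<in> module_maps"
  by (simp add: module_maps_def lin_ext_plus add_diff_add)

lemma module_maps_scale: "f \<in> module_maps \<Longrightarrow> scale_fun scale c f \<in> module_maps"
  by (simp add: module_maps_def lin_ext_const_scale flip: scale_right_diff_distrib)

lemma module_maps_translate: "f \<in> module_maps \<Longrightarrow> (\<lambda>u. f (u @ x)) \<in> module_maps"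
  by (simp add: module_maps_def)

abbreviation "scale_op \<equiv> scale_fun (scale_fun scale)"

text \<open>
  Operators on the space of module maps, extended by zero so that equality of operators only
  depends on that space.
\<close>

definition operators :: "(('v list \<Rightarrow> 'a) \<Rightarrow> 'v list \<Rightarrow> 'a) set"
  where "operators = {T. (\<forall>f. f \<notin> module_maps \<longrightarrow> T f = 0) \<and> (\<forall>f\<in>module_maps. T f \<in> module_maps) \<and>
    (\<forall>f\<in>module_maps. \<forall>g\<in>module_maps. T (f + g) = T f + T g) \<and>
    (\<forall>c. \<forall>f\<in>module_maps. T (scale_fun scale c f) = scale_fun scale c (T f))}"

abbreviation mul_op :: "(('v list \<Rightarrow> 'a) \<Rightarrow> 'v list \<Rightarrow> 'a) \<Rightarrow> (('v list \<Rightarrow> 'a) \<Rightarrow> 'v list \<Rightarrow> 'a) \<Rightarrow> _"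
  where "mul_op T S \<equiv> (\<lambda>f. T (S f))"

definition word_op :: "'v list \<Rightarrow> ('v list \<Rightarrow> 'a) \<Rightarrow> 'v list \<Rightarrow> 'a"
  where "word_op x f = (if f \<in> module_maps then (\<lambda>u. f (u @ x)) else 0)"

lemma operator_0: "T \<in> operators \<Longrightarrow> T 0 = 0"
proof -
  assume "T \<in> operators"
  then have "T (0 + 0) = T 0 + T 0"
    using module_maps_0 unfolding operators_def by blast
  then show ?thesis by simp
qed

lemma operators_algebra: "unital_assoc_algebra scale_op operators mul_op (word_op [])"
proof -
  interpret V: vector_space "scale_fun scale :: _ \<Rightarrow> ('v list \<Rightarrow> 'a) \<Rightarrow> _"
    by (intro vector_space_scale_fun vector_space_axioms)
  interpret O: vector_space "scale_op :: _ \<Rightarrow> (('v list \<Rightarrow> 'a) \<Rightarrow> _) \<Rightarrow> _"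
    by (intro vector_space_scale_fun vector_space_axioms)
  have closed: "T f \<in> module_maps" if "T \<in> operators" for T f
    using that module_maps_0 by (cases "f \<in> module_maps") (auto simp: operators_def)
  have add: "T (f + g) = T f + T g" if "T \<in> operators" "f \<in> module_maps" "g \<in> module_maps" for T f g
    using that by (simp add: operators_def)
  have sc: "T (scale_fun scale c f) = scale_fun scale c (T f)" if "T \<in> operators" "f \<in> module_maps" for T c f
    using that by (simp add: operators_def)
  have outside: "T f = 0" if "T \<in> operators" "f \<notin> module_maps" for T f
    using that by (simp add: operators_def)
  show ?thesis
  proof (unfold_locales, goal_cases)
    case 1
    show ?case
    proof (rule O.subspaceI)
      show "S + T \<in> operators" if "S \<in> operators" "T \<in> operators" for S T
        unfolding operators_def
        using that closed[of S] closed[of T] add[of S] add[of T] sc[of S] sc[of T] outside[of S] outside[of T]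
        by (auto simp: module_maps_add V.scale_right_distrib)
      show "scale_op c T \<in> operators" if "T \<in> operators" for c T
        unfolding operators_def
        using that closed[of T] add[of T] sc[of T] outside[of T]
        by (auto simp: module_maps_scale V.scale_right_distrib mult.commute)
    qed (auto simp: operators_def module_maps_0 fun_eq_iff)
  next
    case (2 S T)
    then have ST: "S \<in> operators" "T \<in> operators" .
    show ?case
      unfolding operators_def
    proof (intro CollectI conjI allI ballI impI)
      show "S (T f) = 0" if "f \<notin> module_maps" for f
        unfolding outside[OF ST(2) that] by (rule operator_0[OF ST(1)])
      show "S (T f) \<in> module_maps" for f
        by (rule closed[OF ST(1)])
      show "S (T (f + g)) = S (T f) + S (T g)" if "f \<in> module_maps" "g \<in> module_maps" for f g
        unfolding add[OF ST(2) that] by (rule add[OF ST(1) closed[OF ST(2)] closed[OF ST(2)]])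
      show "S (T (scale_fun scale c f)) = scale_fun scale c (S (T f))" if "f \<in> module_maps" for c f
        unfolding sc[OF ST(2) that] by (rule sc[OF ST(1) closed[OF ST(2)]])
    qed
  next
    case 3
    show ?case
      by (auto simp: operators_def word_op_def module_maps_add module_maps_scale)
  next
    case (4 S T U)
    then show ?case by (simp add: fun_eq_iff)
  next
    case (5 S T U)
    then show ?case
      using add[of S] closed[of T] closed[of U] by (auto simp: fun_eq_iff)
  next
    case (6 S T c)
    then show ?case by (simp add: fun_eq_iff)
  next
    case (7 S T c)
    then show ?case
      using sc[of S] closed[of T] by (simp add: fun_eq_iff)
  next
    case (8 S T U)
    then show ?case by simp
  next
    case (9 T)
    then show ?case
      using closed[of T] by (simp add: fun_eq_iff word_op_def)
  next
    case (10 T)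
    then show ?case
      using outside[of T] operator_0[of T] by (simp add: fun_eq_iff word_op_def)
  qed
qed

lemma word_op_operator: "word_op x \<in> operators"
  by (auto simp: operators_def word_op_def module_maps_add module_maps_scale module_maps_translate fun_eq_iff)

lemma word_op_append: "mul_op (word_op x) (word_op y) = word_op (x @ y)"
  by (auto simp: fun_eq_iff word_op_def module_maps_translate module_maps_0)

lemma product_letters: "foldr mul_op (map (\<lambda>l. word_op [l]) x) (word_op []) = word_op x"
proof (induction x)
  case (Cons l x)
  then show ?case using word_op_append[of "[l]" x] by simp
qed simp

text \<open>
  The linear extension to \<open>L\<close> of the translation by code words.
\<close>

definition \<iota> :: "'a \<Rightarrow> ('v list \<Rightarrow> 'a) \<Rightarrow> 'v list \<Rightarrow> 'a"
  where "\<iota> h f = (if f \<in> module_maps then (\<lambda>u. lin_ext B (\<lambda>k. f (u @ w k)) h) else 0)"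

lemma \<iota>_basis: "b \<in> B \<Longrightarrow> \<iota> b = word_op (w b)"
  by (simp add: fun_eq_iff \<iota>_def word_op_def lin_ext_basis[OF independent])

lemma \<iota>_add: "\<lbrakk>h \<in> L; h' \<in> L\<rbrakk> \<Longrightarrow> \<iota> (h + h') = \<iota> h + \<iota> h'"
  by (auto simp: fun_eq_iff \<iota>_def lin_ext_add[OF independent] span_B)

lemma \<iota>_scale: "h \<in> L \<Longrightarrow> \<iota> (scale c h) = scale_op c (\<iota> h)"
  by (auto simp: fun_eq_iff \<iota>_def lin_ext_scale[OF independent] span_B)

lemma \<iota>_in_subspace:
  assumes "module.subspace scale_op U" "h \<in> span A" "A \<subseteq> B" "\<And>b. b \<in> A \<Longrightarrow> word_op (w b) \<in> U"
  shows "\<iota> h \<in> U"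
proof -
  interpret O: vector_space "scale_op :: _ \<Rightarrow> (('v list \<Rightarrow> 'a) \<Rightarrow> _) \<Rightarrow> _"
    by (intro vector_space_scale_fun vector_space_axioms)
  have "h \<in> L \<and> \<iota> h \<in> U"
    using assms(2)
  proof (induction rule: span_induct_alt)
    case base
    have zero: "\<iota> 0 = 0"
      by (simp add: fun_eq_iff \<iota>_def lin_ext_zero[OF independent])
    show ?case
      unfolding zero by (rule conjI[OF subspace_0[OF subspace_carrier] O.subspace_0[OF assms(1)]])
  next
    case (step c b h)
    then have "b \<in> B" "b \<in> L" "scale c b \<in> L"
      using assms(3) basis_in_carrier subspace_scale[OF subspace_carrier] by auto
    then have "\<iota> (scale c b + h) = scale_op c (word_op (w b)) + \<iota> h" "scale c b + h \<in> L"
      using step \<iota>_basis[of b]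
      by (simp_all add: \<iota>_add \<iota>_scale subspace_add[OF subspace_carrier])
    moreover have "scale_op c (word_op (w b)) + \<iota> h \<in> U"
      using step assms(4) by (intro O.subspace_add[OF assms(1)] O.subspace_scale[OF assms(1)]) auto
    ultimately show ?case
      by metis
  qed
  then show ?thesis by simp
qed

lemma \<iota>_decode: "h \<in> L \<Longrightarrow> \<iota> h decode [] = h"
proof -
  assume h: "h \<in> L"
  have "decode (w k) = k" if "k \<in> B" for k
    using decode_concat[of "[k]"] that by (simp add: pbw_single)
  then have "lin_ext B (\<lambda>k. decode (w k)) h = lin_ext B (\<lambda>k. k) h"
    by (rule lin_ext_cong)
  then show ?thesis
    using h by (simp add: \<iota>_def decode_in_module_maps lin_ext_id[OF independent] span_B)
qed

lemma \<iota>_operator: "h \<in> L \<Longrightarrow> \<iota> h \<in> operators"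
proof -
  interpret O: unital_assoc_algebra scale_op operators mul_op "word_op []"
    by (rule operators_algebra)
  show "h \<in> L \<Longrightarrow> \<iota> h \<in> operators"
    using \<iota>_in_subspace[OF O.subspace_carrier, of h B] span_B word_op_operator by simp
qed

text \<open>
  Applying two translations appends two code words, so the bracket relation is the defining
  property of module maps, extended bilinearly.
\<close>

lemma \<iota>_br:
  assumes "h \<in> L" "h' \<in> L"
  shows "\<iota> (br h h') = assoc_commutator mul_op (\<iota> h) (\<iota> h')"
proof (intro ext)
  fix f u
  show "\<iota> (br h h') f u = assoc_commutator mul_op (\<iota> h) (\<iota> h') f u"
  proof (cases "f \<in> module_maps")
    case True
    have closed: "\<iota> x f \<in> module_maps" if "x \<in> L" for x
      using \<iota>_operator[OF that] True by (simp add: operators_def)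
    have mul: "\<iota> x (\<iota> y f) u = lin_ext B (\<lambda>k. lin_ext B (\<lambda>l. f (u @ w k @ w l)) y) x" if "y \<in> L" for x y
      using closed[OF that] True by (simp add: \<iota>_def[of x] ) (simp add: \<iota>_def)
    have "lin_ext B (\<lambda>k. lin_ext B (\<lambda>l. f (u @ w k @ w l)) h') h - lin_ext B (\<lambda>k. lin_ext B (\<lambda>l. f (u @ w k @ w l)) h) h' =
        lin_ext B (\<lambda>k. f (u @ w k)) (br h h')"
    proof -
      show ?thesis
        by (rule lin_ext_commutator[where g = "\<lambda>k l. f (u @ w k @ w l)", OF independent span_B _ assms])
          (use module_mapsD[OF True, of _ _ u "[]"] in simp)
    qed
    then show ?thesis
      using mul assms True by (simp add: assoc_commutator_def) (simp add: \<iota>_def)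
  next
    case False
    then have "\<iota> x f = 0" for x
      by (simp add: \<iota>_def)
    then show ?thesis
      using operator_0[OF \<iota>_operator] assms by (simp add: assoc_commutator_def)
  qed
qed

text \<open>
  The linear map \<open>T \<mapsto> T decode []\<close> sends \<open>\<iota> h\<close> to \<open>h\<close> and a product of \<open>m\<close> letters to an element of
  \<open>\<chi> m\<close>. This gives both injectivity of \<open>\<iota>\<close> and the lower bound for degrees.
\<close>

lemma assoc_embedding:
  defines "X \<equiv> (\<lambda>l. word_op [l]) ` \<Lambda>"
  defines "\<rho> \<equiv> assoc_degree_filtration scale_op mul_op (word_op []) X"
  obtains R where "unital_assoc_algebra scale_op R mul_op (word_op [])"
    "assoc_generated_by scale_op R mul_op (word_op []) X"
    "lie_embedding scale L br scale_op R (assoc_commutator mul_op) \<iota>"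
    "\<And>n. \<chi> n \<subseteq> restrict_filtration L \<iota> \<rho> (t * n)"
    "\<And>n. restrict_filtration L \<iota> \<rho> n \<subseteq> \<chi> n"
proof -
  interpret O: unital_assoc_algebra scale_op operators mul_op "word_op []"
    by (rule operators_algebra)
  have X: "X \<subseteq> operators"
    using word_op_operator by (auto simp: X_def)
  define R where "R = O.span {foldr mul_op xs (word_op []) | xs. set xs \<subseteq> X}"
  have words: "word_op x \<in> {foldr mul_op xs (word_op []) | xs. set xs \<subseteq> X \<and> length xs \<le> n}"
    if "set x \<subseteq> \<Lambda>" "length x \<le> n" for x n
    using that product_letters[of x, symmetric]
    by (intro CollectI exI[of _ "map (\<lambda>l. word_op [l]) x"]) (auto simp: X_def)
  have upper: "\<iota> h \<in> \<rho> (t * n)" if "h \<in> \<chi> n" for h n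
  proof (rule \<iota>_in_subspace)
    show "h \<in> span (B \<inter> \<chi> n)"
      using that span_basis by simp
    show "word_op (w b) \<in> \<rho> (t * n)" if "b \<in> B \<inter> \<chi> n" for b
    proof -
      have "length (w b) \<le> t * n"
        using length_le_wt[of b] wt[of b n] that by (auto intro: order_trans mult_le_mono2)
      then have "word_op (w b) \<in> {foldr mul_op xs (word_op []) | xs. set xs \<subseteq> X \<and> length xs \<le> t * n}"
        using letters that by (intro words) auto
      then show ?thesis
        unfolding \<rho>_def assoc_degree_filtration_def by (rule O.span_base)
    qed
  qed (auto simp: \<rho>_def assoc_degree_filtration_def)
  have lower: "T decode [] \<in> \<chi> n" if "T \<in> \<rho> n" for T n
    using that unfolding \<rho>_def assoc_degree_filtration_def
  proof (induction rule: O.span_induct_alt)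
    case base
    show ?case by (simp add: subspace_0[OF filt(1)])
  next
    case (step c T S)
    then obtain xs where xs: "set xs \<subseteq> X" "length xs \<le> n" "T = foldr mul_op xs (word_op [])"
      by blast
    have "xs \<in> map (\<lambda>l. word_op [l]) ` lists \<Lambda>"
      using xs(1) unfolding lists_image[symmetric] X_def by (simp add: in_lists_conv_set subset_iff)
    then obtain x where x: "xs = map (\<lambda>l. word_op [l]) x"
      by auto
    then have "T decode [] = decode x"
      using xs(3) product_letters[of x] by (simp add: word_op_def decode_in_module_maps)
    then have "T decode [] \<in> \<chi> n"
      using decode_filtered[of x] filt(4)[of "length x" n] xs(2) x by auto
    then show ?case
      using step by (simp add: subspace_add[OF filt(1)] subspace_scale[OF filt(1)])
  qed
  have "\<rho> n \<subseteq> R" for n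
    unfolding \<rho>_def assoc_degree_filtration_def R_def by (rule O.span_mono) auto
  then have "\<iota> ` L \<subseteq> R"
    using upper filt(7) by blast
  moreover have "inj_on \<iota> L"
    using \<iota>_decode by (metis inj_onI)
  ultimately have "lie_embedding scale L br scale_op R (assoc_commutator mul_op) \<iota>"
    unfolding lie_embedding_def by (simp add: \<iota>_add \<iota>_scale \<iota>_br)
  moreover have "restrict_filtration L \<iota> \<rho> n \<subseteq> \<chi> n" for n
    using lower \<iota>_decode by (fastforce simp: restrict_filtration_def)
  moreover have "\<chi> n \<subseteq> restrict_filtration L \<iota> \<rho> (t * n)" for n
    using upper filt(2) by (auto simp: restrict_filtration_def)
  ultimately show thesis
    using that O.generated_assoc_algebra[OF X, folded R_def] by blast
qed

end

section \<open>The equivalences\<close>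

lemma realisations_of_tame_filtration:
  fixes scale :: "'f::field \<Rightarrow> 'h::ab_group_add \<Rightarrow> 'h"
  assumes H: "lie_algebra scale H br" "lie_filtration scale H br \<chi>" and "\<chi> 0 = {0}" "tame scale \<chi>"
  shows "eq_fin_gen_lie TYPE(nat \<Rightarrow>\<^sub>0 'f) scale H br \<chi>"
    "eq_fin_gen_assoc TYPE(nat \<Rightarrow>\<^sub>0 'f) scale H br \<chi>"
    "equiv_two_generator_lie TYPE(nat \<Rightarrow>\<^sub>0 'f) scale H br \<chi>"
    "equiv_two_generator_assoc TYPE(nat \<Rightarrow>\<^sub>0 'f) scale H br \<chi>"
proof -
  interpret lie_algebra scale H br by fact
  note filt = lie_filtrationD[OF H]
  obtain B and word :: "'h \<Rightarrow> (nat \<times> bool \<times> bool) list" and \<Lambda> where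
    B: "independent B" "\<And>n. span (B \<inter> \<chi> n) = \<chi> n" "B \<subseteq> H"
    and word: "synchronized B word" "\<And>b. b \<in> B \<Longrightarrow> set (word b) \<subseteq> \<Lambda>" "finite \<Lambda>"
    and len: "\<And>b n. b \<in> B \<Longrightarrow> b \<in> \<chi> n \<longleftrightarrow> length (word b) \<le> n"
    using tame_coding[OF assms] by metis
  interpret C: coded_filtration scale H br \<chi> B word \<Lambda>
  proof
    show "word b \<noteq> []" if "b \<in> B" for b
      by (rule synchronized_nonempty[OF word(1) that])
    show "b' = b" if "b \<in> B" "b' \<in> B" "word b' = word b @ u" for b b' u
      by (rule synchronized_prefix_free[OF word(1) that])
    show "H = \<Union> (range \<chi>)"
      using filt(7) by simp
  qed (use filt B(2) word len in auto)
  show "eq_fin_gen_lie TYPE(nat \<Rightarrow>\<^sub>0 'f) scale H br \<chi>"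
    by (rule eq_fin_gen_lie_sequences[OF C.eq_fin_gen_lie])
  then show "equiv_two_generator_lie TYPE(nat \<Rightarrow>\<^sub>0 'f) scale H br \<chi>"
    by (rule equiv_two_generator_lie_if_eq_fin_gen_lie)
  have "span B = H"
  proof
    show "span B \<subseteq> H"
      by (rule span_minimal[OF B(3) subspace_carrier])
    have "\<chi> n \<subseteq> span B" for n
      using B(2)[of n] span_mono[of "B \<inter> \<chi> n" B] by auto
    then show "H \<subseteq> span B"
      using filt(7) by blast
  qed
  moreover have "inj_on (to_nat \<circ> word) B"
    using synchronized_prefix_free[OF word(1), of _ _ "[]"] by (auto intro!: inj_onI)
  ultimately have basis: "ordered_basis_lie_algebra scale H br B (to_nat \<circ> word)"
    using B(1) H(1) by (simp add: ordered_basis_lie_algebra_def ordered_basis_lie_algebra_axioms_def)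
  \<comment> \<open>the marked code itself gives the exact equality\<close>
  interpret D: coded_lie_algebra scale H br B "to_nat \<circ> word" \<chi> "\<lambda>b. length (word b)" word \<Lambda> 1
    using basis H(2) B(2) len word
    by (simp add: coded_lie_algebra_def coded_lie_algebra_axioms_def)
  let ?\<rho> = "assoc_degree_filtration D.scale_op D.mul_op (D.word_op []) ((\<lambda>l. D.word_op [l]) ` \<Lambda>)"
  obtain R where R: "unital_assoc_algebra D.scale_op R D.mul_op (D.word_op [])"
    "assoc_generated_by D.scale_op R D.mul_op (D.word_op []) ((\<lambda>l. D.word_op [l]) ` \<Lambda>)"
    "lie_embedding scale H br D.scale_op R (assoc_commutator D.mul_op) D.\<iota>"
    and eq: "\<And>n. \<chi> n \<subseteq> restrict_filtration H D.\<iota> ?\<rho> (1 * n)"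
      "\<And>n. restrict_filtration H D.\<iota> ?\<rho> n \<subseteq> \<chi> n"
    using D.assoc_embedding by blast
  have "\<chi> = restrict_filtration H D.\<iota> ?\<rho>"
    using eq by (intro ext equalityI) simp_all
  then have "eq_fin_gen_assoc TYPE(((nat \<times> bool \<times> bool) list \<Rightarrow> 'h) \<Rightarrow> (nat \<times> bool \<times> bool) list \<Rightarrow> 'h)
      scale H br \<chi>"
    unfolding eq_fin_gen_assoc_def using R word(3) by blast
  then show "eq_fin_gen_assoc TYPE(nat \<Rightarrow>\<^sub>0 'f) scale H br \<chi>"
    by (rule eq_fin_gen_assoc_sequences)
  obtain word' :: "'h \<Rightarrow> bool list" and t where word': "synchronized B word'" "t > 0"
    "\<And>b. b \<in> B \<Longrightarrow> length (word b) \<le> length (word' b)"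
    "\<And>b. b \<in> B \<Longrightarrow> length (word' b) \<le> t * length (word b)"
    using binary_coding[OF word] by metis
  \<comment> \<open>recoding in two letters only gives equivalence\<close>
  interpret E: coded_lie_algebra scale H br B "to_nat \<circ> word" \<chi> "\<lambda>b. length (word b)" word' UNIV t
    using basis H(2) B(2) len word'
    by (simp add: coded_lie_algebra_def coded_lie_algebra_axioms_def)
  have gens: "(\<lambda>l. E.word_op [l]) ` UNIV = {E.word_op [True], E.word_op [False]}"
    by (auto simp: UNIV_bool)
  let ?\<sigma> = "assoc_degree_filtration E.scale_op E.mul_op (E.word_op []) {E.word_op [True], E.word_op [False]}"
  obtain S where S: "unital_assoc_algebra E.scale_op S E.mul_op (E.word_op [])"
    "assoc_generated_by E.scale_op S E.mul_op (E.word_op []) {E.word_op [True], E.word_op [False]}"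
    "lie_embedding scale H br E.scale_op S (assoc_commutator E.mul_op) E.\<iota>"
    and eq': "\<And>n. \<chi> n \<subseteq> restrict_filtration H E.\<iota> ?\<sigma> (t * n)"
      "\<And>n. restrict_filtration H E.\<iota> ?\<sigma> n \<subseteq> \<chi> n"
    using E.assoc_embedding unfolding gens by blast
  have "restrict_filtration H E.\<iota> ?\<sigma> n \<subseteq> \<chi> (t * n)" for n
    using eq'(2)[of n] filt(4)[of n "t * n"] word'(2) by auto
  then have "filtration_equiv \<chi> (restrict_filtration H E.\<iota> ?\<sigma>)"
    unfolding filtration_equiv_def using eq'(1) word'(2) by blast
  then have "equiv_two_generator_assoc TYPE((bool list \<Rightarrow> 'h) \<Rightarrow> bool list \<Rightarrow> 'h) scale H br \<chi>"
    unfolding equiv_two_generator_assoc_def using S by blast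
  then show "equiv_two_generator_assoc TYPE(nat \<Rightarrow>\<^sub>0 'f) scale H br \<chi>"
    by (rule equiv_two_generator_assoc_sequences)
qed

theorem theorem9:
  fixes scale :: "'f::field \<Rightarrow> 'h::ab_group_add \<Rightarrow> 'h"
    and H :: "'h set" and br :: "'h \<Rightarrow> 'h \<Rightarrow> 'h" and \<chi> :: "nat \<Rightarrow> 'h set"
  assumes "lie_algebra scale H br"
    and "lie_filtration scale H br \<chi>"
  shows
    "(\<chi> 0 = {0} \<longrightarrow>
      ((tame scale \<chi> \<longleftrightarrow> equiv_two_generator_lie TYPE(nat \<Rightarrow>\<^sub>0 'f) scale H br \<chi>) \<and>
       (tame scale \<chi> \<longleftrightarrow> equiv_two_generator_assoc TYPE(nat \<Rightarrow>\<^sub>0 'f) scale H br \<chi>)) \<and>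
      ((tame scale \<chi> \<longleftrightarrow> eq_fin_gen_lie TYPE(nat \<Rightarrow>\<^sub>0 'f) scale H br \<chi>) \<and>
       (tame scale \<chi> \<longleftrightarrow> eq_fin_gen_assoc TYPE(nat \<Rightarrow>\<^sub>0 'f) scale H br \<chi>))) \<and>
     (equiv_two_generator_lie TYPE('g::ab_group_add) scale H br \<chi> \<longrightarrow> tame scale \<chi>) \<and>
     (equiv_two_generator_assoc TYPE('r::ab_group_add) scale H br \<chi> \<longrightarrow> tame scale \<chi>) \<and>
     (eq_fin_gen_lie TYPE('g) scale H br \<chi> \<longrightarrow> tame scale \<chi>) \<and>
     (eq_fin_gen_assoc TYPE('r) scale H br \<chi> \<longrightarrow> tame scale \<chi>)"
  by (intro conjI impI iffI)
    (assumption
      | erule tame_if_equiv_two_generator_lie[OF assms] tame_if_equiv_two_generator_assoc[OF assms]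
          tame_if_eq_fin_gen_lie[OF assms] tame_if_eq_fin_gen_assoc[OF assms]
      | rule realisations_of_tame_filtration[OF assms])+

end
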